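(* Let $a>1$, $b>1$, $v(x)=(1+x^2)^{a/2}$ and $w(\xi)=(1+\xi^2)^{b/2}$. Let $m\in\{1,2,\ldots,b-1\}$ and let $f\colon\mathbb{R}\to\mathbb{C}$ satisfy $f\in\mathcal{F}_{v,m}$ and $\hat f\in\mathcal{F}_w$. Let $\alpha>1$ satisfy $$\alpha<\frac{a-1}{m}+1,$$ let $\mu(x)=C_\alpha(1+x^2)^{-\alpha/2}$ be the polynomial probability density with cumulative distribution function $\Psi(x)=\int_{-\infty}^x\mu(t)\,\mathrm{d}t$, fix $\xi\in[-\Omega,\Omega]$ (where $\Omega>0$), and let $$g(y)=\frac{f(\Psi^{-1}(y))}{\mu(\Psi^{-1}(y))}\,\mathrm{e}^{-2\pi\mathrm{i}\,\Psi^{-1}(y)\,\xi}.$$ Let $k\in\mathbb{Z}\setminus\{0\}$. In the resonant case $0<-\frac{\xi}{k}<\mu(0)$ let $x_0>0$ be determined by $\mu(x_0)=-\frac{\xi}{k}$ and set $$\delta=\min\left\{\tfrac12,\tfrac{x_0}{4}\right\},\qquad D_\delta=\{x\in\mathbb{R}\colon|x-x_0|\ge\delta\text{ and }|x+x_0|\ge\delta\},\qquad\Lambda=\frac{1+x_0^2}{x_0\,\delta}.$$ Then the Fourier coefficients of $g$ satisfy the following bounds, with an implied constant depending on $\alpha$ and $m$. (i) If $\frac{\xi}{k}\ge0$ or $-\frac{\xi}{k}\ge2\mu(0)$, then $$|c_k(g)|\lesssim_{\alpha,m}\|f\|_{\mathcal{F}_{v,m}}\int_{-\infty}^\infty\frac{1}{(1+x^2)^{(a+m)/2}\,|\xi+k\mu(x)|^m}\,\mathrm{d}x.$$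 (ii) If $0<-\frac{\xi}{k}<\mu(0)$, then $$|c_k(g)|\lesssim_{\alpha,m}\Lambda^m\,\|f\|_{\mathcal{F}_{v,m}}\int_{D_\delta}\frac{1}{(1+x^2)^{(a+m)/2}\,|\xi+k\mu(x)|^m}\,\mathrm{d}x+\frac{\|f\|_{\mathcal{F}_{v,1}}}{v(x_0)\sqrt{|k\,\mu'(x_0)|}}.$$
   Context: The Fourier transform is $\hat f(\xi)=\int_{\mathbb{R}}f(x)\mathrm{e}^{-2\pi\mathrm{i}x\xi}\,\mathrm{d}x$. For a weight $v\colon\mathbb{R}\to(0,\infty)$ and $m\in\mathbb{N}_0$, $\|f\|_{\mathcal{F}_v}=\sup_{x\in\mathbb{R}}|f(x)|v(x)$ and $$\|f\|_{\mathcal{F}_{v,m}}=\sup_{x\in\mathbb{R}}\left(\sum_{\ell=0}^m|f^{(\ell)}(x)|(1+|x|^2)^{\ell/2}\right)v(x);$$ $\mathcal{F}_v$ (resp. $\mathcal{F}_{v,m}$) is the set of continuous functions (resp. $m$ times continuously differentiable functions) on $\mathbb{R}$ for which the corresponding norm is finite. The density constant is $C_\alpha=\frac{\Gamma(\alpha/2)}{\sqrt\pi\,\Gamma((\alpha-1)/2)}$, so $\int_{\mathbb{R}}\mu=1$. The Fourier coefficients are $c_k(g)=\int_0^1g(y)\mathrm{e}^{-2\pi\mathrm{i}ky}\,\mathrm{d}y$. The notation $A\lesssim_{\alpha,m}B$ means $A\le C\,B$ with a constant $C>0$ depending on $\alpha$ and $m$. *)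

theory Defs
  imports "HOL-Analysis.Analysis"
begin

definition fourier_transform :: "(real \<Rightarrow> complex) \<Rightarrow> real \<Rightarrow> complex" where
  "fourier_transform f \<xi> = (LBINT x. f x * cis (- 2 * pi * x * \<xi>))"

definition fourier_coeff :: "(real \<Rightarrow> complex) \<Rightarrow> int \<Rightarrow> complex" where
  "fourier_coeff g k = (LBINT y:{0..1}. g y * cis (- 2 * pi * of_int k * y))"

text \<open>The library operator \<open>deriv\<close> only covers maps from a field to itself, so derivatives of
  functions of a real variable with complex values are iterated vector derivatives.\<close>

definition nth_deriv :: "nat \<Rightarrow> (real \<Rightarrow> complex) \<Rightarrow> real \<Rightarrow> complex" where
  "nth_deriv l f = ((\<lambda>h x. vector_derivative h (at x)) ^^ l) f"

definition times_cont_differentiable :: "nat \<Rightarrow> (real \<Rightarrow> complex) \<Rightarrow> bool" where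
  "times_cont_differentiable m f \<longleftrightarrow>
     (\<forall>l<m. \<forall>x. nth_deriv l f differentiable (at x)) \<and> continuous_on UNIV (nth_deriv m f)"

text \<open>The suprema below are suprema of real numbers; they are the actual norms only for
  functions in the corresponding space, where finiteness of the norm is expressed as boundedness
  of the set whose supremum is taken.\<close>

definition weighted_norm :: "(real \<Rightarrow> real) \<Rightarrow> (real \<Rightarrow> complex) \<Rightarrow> real" where
  "weighted_norm v f = (SUP x. cmod (f x) * v x)"

definition weighted_space :: "(real \<Rightarrow> real) \<Rightarrow> (real \<Rightarrow> complex) set" where
  "weighted_space v =
     {f. continuous_on UNIV f \<and> bdd_above (range (\<lambda>x. cmod (f x) * v x))}"

definition weighted_deriv_sum ::
    "(real \<Rightarrow> real) \<Rightarrow> nat \<Rightarrow> (real \<Rightarrow> complex) \<Rightarrow> real \<Rightarrow> real" where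
  "weighted_deriv_sum v m f x =
     (\<Sum>l\<le>m. cmod (nth_deriv l f x) * (1 + \<bar>x\<bar>\<^sup>2) powr (real l / 2)) * v x"

definition weighted_diff_norm :: "(real \<Rightarrow> real) \<Rightarrow> nat \<Rightarrow> (real \<Rightarrow> complex) \<Rightarrow> real" where
  "weighted_diff_norm v m f = (SUP x. weighted_deriv_sum v m f x)"

definition weighted_diff_space :: "(real \<Rightarrow> real) \<Rightarrow> nat \<Rightarrow> (real \<Rightarrow> complex) set" where
  "weighted_diff_space v m =
     {f. times_cont_differentiable m f \<and> bdd_above (range (weighted_deriv_sum v m f))}"

definition poly_weight :: "real \<Rightarrow> real \<Rightarrow> real" where
  "poly_weight a x = (1 + x\<^sup>2) powr (a / 2)"

definition density_const :: "real \<Rightarrow> real" where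
  "density_const \<alpha> = Gamma (\<alpha> / 2) / (sqrt pi * Gamma ((\<alpha> - 1) / 2))"

definition poly_density :: "real \<Rightarrow> real \<Rightarrow> real" where
  "poly_density \<alpha> x = density_const \<alpha> * (1 + x\<^sup>2) powr (- \<alpha> / 2)"

definition poly_cdf :: "real \<Rightarrow> real \<Rightarrow> real" where
  "poly_cdf \<alpha> x = (LBINT t:{..x}. poly_density \<alpha> t)"

text \<open>For \<open>\<alpha> > 1\<close> the cumulative distribution function is a bijection from the reals onto the
  open interval \<open>(0, 1)\<close>, so \<open>inv\<close> is its inverse there. The values of \<open>transplant\<close> at 0 and 1
  are arbitrary and do not affect its Fourier coefficients.\<close>

definition transplant :: "real \<Rightarrow> (real \<Rightarrow> complex) \<Rightarrow> real \<Rightarrow> real \<Rightarrow> complex" where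
  "transplant \<alpha> f \<xi> y =
     (let x = inv (poly_cdf \<alpha>) y
      in f x / complex_of_real (poly_density \<alpha> x) * cis (- 2 * pi * x * \<xi>))"

definition res_delta :: "real \<Rightarrow> real" where
  "res_delta x\<^sub>0 = min (1 / 2) (x\<^sub>0 / 4)"

definition res_domain :: "real \<Rightarrow> real set" where
  "res_domain x\<^sub>0 = {x. \<bar>x - x\<^sub>0\<bar> \<ge> res_delta x\<^sub>0 \<and> \<bar>x + x\<^sub>0\<bar> \<ge> res_delta x\<^sub>0}"

definition res_Lambda :: "real \<Rightarrow> real" where
  "res_Lambda x\<^sub>0 = (1 + x\<^sub>0\<^sup>2) / (x\<^sub>0 * res_delta x\<^sub>0)"

end

theory Submission
  imports Defs
begin

text \<open>The substitution \<open>y = \<Psi> x\<close> turns the Fourier coefficient into the oscillatory integral of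
  \<open>f\<close> against \<open>exp (- 2 \<pi> i (x \<xi> + k \<Psi> x))\<close>, whose phase has the derivative \<open>g = \<xi> + k \<mu>\<close>.
  Without resonance \<open>|g| \<ge> |k| \<mu>\<close>, so each derivative of \<open>1 / g\<close> gains a factor
  \<open>(1 + x\<^sup>2) powr (- 1 / 2)\<close>, and \<open>m\<close> integrations by parts give (i).

  In the resonant case \<open>|k| \<mu> \<le> 3 \<Lambda> |g|\<close> on \<open>D\<^sub>\<delta>\<close>, which costs a factor \<open>\<Lambda>\<close> per integration by parts.
  The integral is split by smooth cutoffs at the distances \<open>S \<le> T \<le> \<delta>\<close> from \<open>\<plusminus>x\<^sub>0\<close>, with
  \<open>S = min (|k \<mu>'(x\<^sub>0)| powr (- 1 / 2)) \<delta>\<close>: the trivial bound inside, one integration by parts between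
  \<open>S\<close> and \<open>T\<close>, since the term with \<open>1 / v(x\<^sub>0)\<close> only controls first derivatives, and \<open>m\<close> outside. The constant must not depend on \<open>a\<close>,
  although the weight \<open>v\<close> can vary by an unbounded factor on the interval of length \<open>\<delta>\<close>. Therefore \<open>T\<close> is the distance
  up to which \<open>1 / v\<close> is comparable to \<open>1 / v(x\<^sub>0)\<close>; beyond it \<open>1 / v\<close> grows so fast that it is dominated
  by its values at distance \<open>\<delta>\<close>, that is by the integral over \<open>D\<^sub>\<delta>\<close>.\<close>

text \<open>The right-hand sides of (i) and (ii) are integrals of pointwise quantities, so all
  derivative bounds keep a pointwise size \<open>B\<close> and a pointwise rate \<open>r\<close>.
  One integration by parts turns \<open>B\<close> into a constant times \<open>B * r / |g|\<close>,
  and \<open>m\<close> of them reproduce the integrand of the theorem. Away from the zeros of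
  \<open>g\<close>, \<open>1 / |g|\<close> grows at most like the power \<alpha>, while a derivative
  gains the power 1. The decay exponent of the amplitude therefore drops from \<open>a\<close> to
  \<open>a - (\<alpha> - 1)\<close> each time, and the condition on \<alpha> keeps all these
  amplitudes integrable.

  On the scale \<open>|k \<mu>'(x0)| powr (- 1 / 2)\<close> the phase varies by a bounded amount
  around its stationary points, so the trivial bound there has the size of the second term of (ii).
  That term carries no factor \<Lambda>, which is unbounded as \<open>x0\<close> tends to 0; the
  rate used in the outer region would be too costly in the middle one. The rate there is the inverse
  distance to the stationary points, which suffices because \<open>g\<close> vanishes linearly at
  them.\<close>

section \<open>Derivative bounds\<close>

text \<open>The bounds \<open>|f\<^sup>(\<^sup>l\<^sup>)| \<le> B * r ^ l\<close> on \<open>U\<close> for \<open>l \<le> n\<close>, with pointwise varying \<open>B\<close> and \<open>r\<close>. The recursion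
  makes closure under products and quotients provable without a Leibniz formula.\<close>
primrec symbol_bound ::
    "nat \<Rightarrow> real set \<Rightarrow> (real \<Rightarrow> complex) \<Rightarrow> (real \<Rightarrow> real) \<Rightarrow> (real \<Rightarrow> real) \<Rightarrow> bool" where
  "symbol_bound 0 U f B r \<longleftrightarrow> continuous_on U f \<and> (\<forall>x\<in>U. cmod (f x) \<le> B x)"
| "symbol_bound (Suc n) U f B r \<longleftrightarrow> (\<forall>x\<in>U. cmod (f x) \<le> B x) \<and>
     (\<exists>f'. (\<forall>x\<in>U. (f has_vector_derivative f' x) (at x)) \<and>
           symbol_bound n U f' (\<lambda>x. B x * r x) r)"

lemma symbol_bound_le: "symbol_bound n U f B r \<Longrightarrow> x \<in> U \<Longrightarrow> cmod (f x) \<le> B x"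
  by (cases n) auto

lemma symbol_bound_nonneg: "symbol_bound n U f B r \<Longrightarrow> x \<in> U \<Longrightarrow> 0 \<le> B x"
  by (meson symbol_bound_le norm_ge_zero order_trans)

lemma symbol_bound_continuous_on:
  assumes "symbol_bound n U f B r"
  shows "continuous_on U f"
proof (cases n)
  case (Suc k)
  then obtain f' where "\<forall>x\<in>U. (f has_vector_derivative f' x) (at x)"
    using assms by auto
  then show ?thesis
    by (meson continuous_at_imp_continuous_on has_vector_derivative_continuous)
qed (use assms in simp)

lemma symbol_bound_SucD: "symbol_bound (Suc n) U f B r \<Longrightarrow> symbol_bound n U f B r"
proof (induction n arbitrary: f B)
  case 0
  then show ?case
    using symbol_bound_continuous_on[OF 0] by simp
next
  case (Suc n)
  then obtain f' where "\<forall>x\<in>U. (f has_vector_derivative f' x) (at x)"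
      "symbol_bound (Suc n) U f' (\<lambda>x. B x * r x) r"
    unfolding symbol_bound.simps(2)[of "Suc n"] by blast
  moreover note Suc.IH[OF this(2)]
  moreover have "\<forall>x\<in>U. cmod (f x) \<le> B x"
    using symbol_bound_le[OF Suc.prems] by blast
  ultimately show ?case
    by auto
qed

lemma symbol_bound_lower: "symbol_bound n U f B r \<Longrightarrow> k \<le> n \<Longrightarrow> symbol_bound k U f B r"
  by (induction n) (auto simp: le_Suc_eq simp del: symbol_bound.simps dest: symbol_bound_SucD)

lemma symbol_bound_mono:
  assumes "symbol_bound n U f B r" "W \<subseteq> U"
    and "\<And>x. x \<in> W \<Longrightarrow> B x \<le> B' x" "\<And>x. x \<in> W \<Longrightarrow> 0 \<le> r x" "\<And>x. x \<in> W \<Longrightarrow> r x \<le> r' x"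
  shows "symbol_bound n W f B' r'"
  using assms
proof (induction n arbitrary: f B B')
  case 0
  then show ?case
    by simp (meson continuous_on_subset order_trans subsetD)
next
  case (Suc n)
  then obtain f' where f': "\<forall>x\<in>U. (f has_vector_derivative f' x) (at x)"
      "symbol_bound n U f' (\<lambda>x. B x * r x) r"
    by auto
  have "symbol_bound n W f' (\<lambda>x. B' x * r' x) r'"
  proof (rule Suc.IH[OF f'(2)])
    fix x assume x: "x \<in> W"
    have "0 \<le> B x"
      using symbol_bound_nonneg[OF Suc.prems(1)] x Suc.prems(2) by blast
    then show "B x * r x \<le> B' x * r' x"
      using Suc.prems(3-5)[OF x] by (intro mult_mono) auto
  qed (use Suc.prems in auto)
  moreover have "\<forall>x\<in>W. cmod (f x) \<le> B' x"
    using symbol_bound_le[OF Suc.prems(1)] Suc.prems(2,3) by (meson order_trans subsetD)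
  ultimately show ?case
    using f'(1) Suc.prems(2) by auto
qed

lemma symbol_bound_cong:
  assumes "symbol_bound n U f B r" "open U" "\<And>x. x \<in> U \<Longrightarrow> f x = g x"
  shows "symbol_bound n U g B r"
proof (cases n)
  case 0
  then show ?thesis
    using assms continuous_on_cong[of U U f g] by auto
next
  case (Suc k)
  then obtain f' where f': "\<forall>x\<in>U. (f has_vector_derivative f' x) (at x)"
      "symbol_bound k U f' (\<lambda>x. B x * r x) r"
    using assms by auto
  have "(g has_vector_derivative f' x) (at x)" if "x \<in> U" for x
    using has_vector_derivative_transform_within_open[of f "f' x" x U g] f'(1) assms that by auto
  moreover have "cmod (g x) \<le> B x" if "x \<in> U" for x
    using symbol_bound_le[OF assms(1) that] assms(3)[OF that] by simp
  ultimately show ?thesis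
    using Suc f' by auto
qed

lemma symbol_bound_const:
  assumes "\<And>x. x \<in> U \<Longrightarrow> cmod c \<le> B x" "\<And>x. x \<in> U \<Longrightarrow> 0 \<le> r x"
  shows "symbol_bound n U (\<lambda>x. c) B r"
  using assms
proof (induction n arbitrary: c B)
  case (Suc n)
  have "symbol_bound n U (\<lambda>x. 0) (\<lambda>x. B x * r x) r"
    by (rule Suc.IH) (use Suc.prems in \<open>auto intro: mult_nonneg_nonneg order_trans[OF norm_ge_zero]\<close>)
  then show ?case
    using Suc.prems by (auto intro!: exI[of _ "\<lambda>x. 0"])
qed auto

lemma symbol_bound_add:
  assumes "symbol_bound n U f B r" "symbol_bound n U g D r"
  shows "symbol_bound n U (\<lambda>x. f x + g x) (\<lambda>x. B x + D x) r"
  using assms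
proof (induction n arbitrary: f g B D)
  case 0
  then show ?case
    by (auto intro!: continuous_intros order_trans[OF norm_triangle_ineq] add_mono)
next
  case (Suc n)
  then obtain f' g' where f': "\<forall>x\<in>U. (f has_vector_derivative f' x) (at x)"
      "symbol_bound n U f' (\<lambda>x. B x * r x) r"
    and g': "\<forall>x\<in>U. (g has_vector_derivative g' x) (at x)"
      "symbol_bound n U g' (\<lambda>x. D x * r x) r"
    by auto
  have "symbol_bound n U (\<lambda>x. f' x + g' x) (\<lambda>x. (B x + D x) * r x) r"
    using Suc.IH[OF f'(2) g'(2)] by (simp add: distrib_right)
  moreover have "\<forall>x\<in>U. cmod (f x + g x) \<le> B x + D x"
    using symbol_bound_le[OF Suc.prems(1)] symbol_bound_le[OF Suc.prems(2)]
    by (auto intro!: order_trans[OF norm_triangle_ineq] add_mono)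
  moreover have "\<forall>x\<in>U. ((\<lambda>x. f x + g x) has_vector_derivative (f' x + g' x)) (at x)"
    using f' g' by (auto intro!: has_vector_derivative_add)
  ultimately show ?case
    by auto
qed

lemma symbol_bound_cmult:
  assumes "symbol_bound n U f B r"
  shows "symbol_bound n U (\<lambda>x. c * f x) (\<lambda>x. cmod c * B x) r"
  using assms
proof (induction n arbitrary: f B)
  case 0
  then show ?case
    by (auto intro!: continuous_intros mult_left_mono simp: norm_mult)
next
  case (Suc n)
  then obtain f' where f': "\<forall>x\<in>U. (f has_vector_derivative f' x) (at x)"
      "symbol_bound n U f' (\<lambda>x. B x * r x) r"
    by auto
  have "symbol_bound n U (\<lambda>x. c * f' x) (\<lambda>x. cmod c * B x * r x) r"
    using Suc.IH[OF f'(2)] by (simp add: mult.assoc)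
  moreover have "\<forall>x\<in>U. cmod (c * f x) \<le> cmod c * B x"
    using symbol_bound_le[OF Suc.prems(1)] by (auto simp: norm_mult intro!: mult_left_mono)
  moreover have "\<forall>x\<in>U. ((\<lambda>x. c * f x) has_vector_derivative (c * f' x)) (at x)"
    using f' by (auto intro!: derivative_eq_intros)
  ultimately show ?case
    by auto
qed

text \<open>The product rule yields two products of lower order, each with the constant
  \<open>2 ^ n\<close>, so the constant doubles with every derivative. Both factors must have the
  same rate; \<open>symbol_bound_mono\<close> brings them to a common one beforehand.\<close>

lemma symbol_bound_mult:
  assumes "symbol_bound n U f B r" "symbol_bound n U g D r"
  shows "symbol_bound n U (\<lambda>x. f x * g x) (\<lambda>x. 2 ^ n * (B x * D x)) r"
  using assms
proof (induction n arbitrary: f g B D)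
  case 0
  have "cmod (f x * g x) \<le> B x * D x" if "x \<in> U" for x
    using symbol_bound_le[OF 0(1) that] symbol_bound_le[OF 0(2) that]
    unfolding norm_mult by (intro mult_mono) (auto intro: order_trans[OF norm_ge_zero])
  then show ?case
    using 0 by (auto intro!: continuous_intros)
next
  case (Suc n)
  then obtain f' g' where f': "\<forall>x\<in>U. (f has_vector_derivative f' x) (at x)"
      "symbol_bound n U f' (\<lambda>x. B x * r x) r"
    and g': "\<forall>x\<in>U. (g has_vector_derivative g' x) (at x)"
      "symbol_bound n U g' (\<lambda>x. D x * r x) r"
    by auto
  have "symbol_bound n U (\<lambda>x. f x * g' x + f' x * g x)
      (\<lambda>x. 2 ^ n * (B x * (D x * r x)) + 2 ^ n * ((B x * r x) * D x)) r"
    by (intro symbol_bound_add Suc.IH f' g' symbol_bound_SucD[OF Suc.prems(1)]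
        symbol_bound_SucD[OF Suc.prems(2)])
  then have "symbol_bound n U (\<lambda>x. f x * g' x + f' x * g x) (\<lambda>x. 2 ^ Suc n * (B x * D x) * r x) r"
    by (simp add: algebra_simps)
  moreover have "cmod (f x * g x) \<le> 2 ^ Suc n * (B x * D x)" if "x \<in> U" for x
  proof -
    have "cmod (f x * g x) \<le> 1 * (B x * D x)"
      using symbol_bound_le[OF Suc.prems(1) that] symbol_bound_le[OF Suc.prems(2) that]
      unfolding norm_mult mult_1 by (intro mult_mono) (auto intro: order_trans[OF norm_ge_zero])
    also have "\<dots> \<le> 2 ^ Suc n * (B x * D x)"
      using symbol_bound_nonneg[OF Suc.prems(1) that] symbol_bound_nonneg[OF Suc.prems(2) that]
      by (intro mult_right_mono one_le_power) auto
    finally show ?thesis .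
  qed
  moreover have "\<forall>x\<in>U. ((\<lambda>x. f x * g x) has_vector_derivative (f x * g' x + f' x * g x)) (at x)"
    using f' g' by (auto intro!: has_vector_derivative_mult)
  ultimately show ?case
    by auto
qed

text \<open>The recursion follows the formula \<open>(1 / g)' = - (1 / g) * (g' * (1 / g))\<close>:
  two products cost \<open>2 ^ n\<close> each, both reciprocals cost the previous constant and
  \<open>g'\<close> costs \<open>K\<close>. The maximum with 1 covers the bound on
  \<open>1 / g\<close> itself.\<close>

primrec inverse_const :: "real \<Rightarrow> nat \<Rightarrow> real" where
  "inverse_const K 0 = 1"
| "inverse_const K (Suc n) = max 1 (4 ^ n * (K * (inverse_const K n)\<^sup>2))"

lemma inverse_const_ge_1: "1 \<le> inverse_const K n"
  by (cases n) auto

text \<open>Measuring the derivatives of \<open>g\<close> relative to \<open>|g|\<close> makes the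
  class stable under reciprocals: in the derivative of \<open>1 / g\<close> all powers of
  \<open>|g|\<close> cancel except one in the denominator. The constant depends on \<open>K\<close>
  and \<open>n\<close> alone.\<close>

lemma symbol_bound_inverse:
  assumes "symbol_bound n U g (\<lambda>x. K * cmod (g x)) r" "\<And>x. x \<in> U \<Longrightarrow> g x \<noteq> 0" "\<And>x. x \<in> U \<Longrightarrow> 0 \<le> r x"
  shows "symbol_bound n U (\<lambda>x. inverse (g x)) (\<lambda>x. inverse_const K n / cmod (g x)) r"
  using assms
proof (induction n)
  case 0
  then show ?case
    by (auto intro!: continuous_intros simp: norm_inverse divide_inverse)
next
  case (Suc n)
  let ?I = "inverse_const K n"
  obtain g' where g': "\<forall>x\<in>U. (g has_vector_derivative g' x) (at x)"
      "symbol_bound n U g' (\<lambda>x. K * cmod (g x) * r x) r"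
    using Suc by auto
  have inv: "symbol_bound n U (\<lambda>x. inverse (g x)) (\<lambda>x. ?I / cmod (g x)) r"
    using Suc symbol_bound_SucD by blast
  have "symbol_bound n U (\<lambda>x. (-1) * (inverse (g x) * (g' x * inverse (g x))))
     (\<lambda>x. cmod (-1) * (2 ^ n * (?I / cmod (g x) * (2 ^ n * (K * cmod (g x) * r x * (?I / cmod (g x))))))) r"
    by (intro symbol_bound_cmult symbol_bound_mult inv g')
  then have "symbol_bound n U (\<lambda>x. (-1) * (inverse (g x) * (g' x * inverse (g x))))
     (\<lambda>x. inverse_const K (Suc n) / cmod (g x) * r x) r"
  proof (rule symbol_bound_mono)
    fix x assume x: "x \<in> U"
    have "cmod (-1) * (2 ^ n * (?I / cmod (g x) * (2 ^ n * (K * cmod (g x) * r x * (?I / cmod (g x))))))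
      = 4 ^ n * (K * ?I\<^sup>2) * (r x / cmod (g x))"
      using Suc.prems(2)[OF x] by (simp add: field_simps power2_eq_square power_mult_distrib[symmetric])
    also have "\<dots> \<le> inverse_const K (Suc n) * (r x / cmod (g x))"
      using Suc.prems(3)[OF x] by (intro mult_right_mono) auto
    finally show "cmod (-1) * (2 ^ n * (?I / cmod (g x) * (2 ^ n * (K * cmod (g x) * r x * (?I / cmod (g x))))))
       \<le> inverse_const K (Suc n) / cmod (g x) * r x"
      by simp
  qed (use Suc.prems in auto)
  moreover have "cmod (inverse (g x)) \<le> inverse_const K (Suc n) / cmod (g x)" if "x \<in> U" for x
    unfolding inverse_eq_divide norm_divide norm_one
    by (intro divide_right_mono inverse_const_ge_1) auto
  moreover have "((\<lambda>x. inverse (g x)) has_vector_derivative (-1) * (inverse (g x) * (g' x * inverse (g x)))) (at x)"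
    if "x \<in> U" for x
  proof -
    have "((\<lambda>x. inverse (g x)) has_derivative
        (\<lambda>h. - (inverse (g x) * (h *\<^sub>R g' x) * inverse (g x)))) (at x)"
      using g'(1) that Suc.prems(2)[OF that] unfolding has_vector_derivative_def
      by (intro Deriv.has_derivative_inverse) auto
    then show ?thesis
      unfolding has_vector_derivative_def by (simp add: mult.assoc)
  qed
  ultimately show ?case
    unfolding symbol_bound.simps(2)
    by (intro conjI ballI exI[of _ "\<lambda>x. (-1) * (inverse (g x) * (g' x * inverse (g x)))"])
qed

text \<open>On the overlap the two derivatives agree by uniqueness, so the bound on \<open>V\<close>
  may take precedence there. This extends quotients by zero across zeros of the denominator, and it
  records that a cutoff is constant on an open set.\<close>

lemma symbol_bound_glue:
  assumes "symbol_bound n U f B r" "symbol_bound n V f D s" "open U" "open V"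
  shows "symbol_bound n (U \<union> V) f (\<lambda>x. if x \<in> V then D x else B x) (\<lambda>x. if x \<in> V then s x else r x)"
  using assms(1,2)
proof (induction n arbitrary: f B D)
  case 0
  then show ?case
    using assms(3,4) by (auto intro!: continuous_on_open_Un)
next
  case (Suc n)
  obtain f1 where f1: "\<forall>x\<in>U. (f has_vector_derivative f1 x) (at x)"
      "symbol_bound n U f1 (\<lambda>x. B x * r x) r"
    using Suc by auto
  obtain f2 where f2: "\<forall>x\<in>V. (f has_vector_derivative f2 x) (at x)"
      "symbol_bound n V f2 (\<lambda>x. D x * s x) s"
    using Suc by auto
  define f' where "f' x = (if x \<in> V then f2 x else f1 x)" for x
  have "f' x = f1 x" if "x \<in> U" for x
    using f1(1) f2(1) that vector_derivative_unique_at[of f "f1 x" x "f2 x"] by (auto simp: f'_def)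
  then have "symbol_bound n U f' (\<lambda>x. B x * r x) r"
    by (intro symbol_bound_cong[OF f1(2) assms(3)]) simp
  moreover have "symbol_bound n V f' (\<lambda>x. D x * s x) s"
    by (intro symbol_bound_cong[OF f2(2) assms(4)]) (simp add: f'_def)
  ultimately have "symbol_bound n (U \<union> V) f'
      (\<lambda>x. if x \<in> V then D x * s x else B x * r x) (\<lambda>x. if x \<in> V then s x else r x)"
    by (rule Suc.IH)
  moreover have "(\<lambda>x. if x \<in> V then D x * s x else B x * r x) =
      (\<lambda>x. (if x \<in> V then D x else B x) * (if x \<in> V then s x else r x))"
    by auto
  moreover have "\<forall>x\<in>U \<union> V. (f has_vector_derivative f' x) (at x)"
    using f1(1) f2(1) by (auto simp: f'_def)
  moreover have "\<forall>x\<in>U \<union> V. cmod (f x) \<le> (if x \<in> V then D x else B x)"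
    using symbol_bound_le[OF Suc.prems(1)] symbol_bound_le[OF Suc.prems(2)] by auto
  ultimately show ?case
    by auto
qed

lemma symbol_bound_affine:
  assumes "symbol_bound n UNIV f B r" "T > 0"
  shows "symbol_bound n UNIV (\<lambda>x. f ((x - c) / T)) (\<lambda>x. B ((x - c) / T)) (\<lambda>x. r ((x - c) / T) / T)"
  using assms(1)
proof (induction n arbitrary: f B)
  case 0
  then show ?case
    using assms(2) by (auto intro!: continuous_on_compose2[of UNIV f] continuous_intros)
next
  case (Suc n)
  then obtain f' where f': "\<And>x. (f has_vector_derivative f' x) (at x)"
      "symbol_bound n UNIV f' (\<lambda>x. B x * r x) r"
    by auto
  have "((\<lambda>x. f ((x - c) / T)) has_vector_derivative (of_real (1/T) * f' ((x - c) / T))) (at x)" for x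
  proof -
    have "((\<lambda>x. (x - c) / T) has_vector_derivative (1 / T)) (at x)"
      using assms(2) by (auto intro!: derivative_eq_intros simp: has_real_derivative_iff_has_vector_derivative[symmetric])
    from vector_diff_chain_at[OF this f'(1)] show ?thesis
      by (simp add: o_def scaleR_conv_of_real)
  qed
  moreover have "symbol_bound n UNIV (\<lambda>x. of_real (1/T) * f' ((x - c) / T))
     (\<lambda>x. B ((x - c) / T) * (r ((x - c) / T) / T)) (\<lambda>x. r ((x - c) / T) / T)"
    using symbol_bound_cmult[OF Suc.IH[OF f'(2)], of "of_real (1/T)"] assms(2)
    by (simp add: field_simps norm_divide)
  ultimately show ?case
    using Suc.prems unfolding symbol_bound.simps(2)
    by (intro conjI exI[of _ "\<lambda>x. of_real (1/T) * f' ((x - c) / T)"]) auto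
qed

section \<open>The polynomial density\<close>

lemma japanese_pos: "0 < 1 + (x::real)\<^sup>2"
  by (rule add_pos_nonneg) auto

lemma japanese_ge_1: "1 \<le> 1 + (x::real)\<^sup>2"
  by simp

text \<open>The substitution \<open>x = sqrt (u / (1 - u))\<close> turns the integral over the half line into a Beta integral.\<close>
lemma japanese_half_line:
  assumes "\<alpha> > (1::real)"
  shows "set_integrable lborel {0<..} (\<lambda>x. (1 + x\<^sup>2) powr (- \<alpha> / 2))"
    and "(LBINT x:{0<..}. (1 + x\<^sup>2) powr (- \<alpha> / 2)) = Beta (1/2) ((\<alpha> - 1) / 2) / 2"
proof -
  define b where "b u = u powr (1/2 - 1) * (1 - u) powr ((\<alpha> - 1) / 2 - 1)" for u :: real
  have b_int: "set_integrable lborel {0..1} b"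
    unfolding b_def by (rule integrable_Beta) (use assms in auto)
  have b_val: "(LBINT u:{0..1}. b u) = Beta (1/2) ((\<alpha> - 1) / 2)"
    using set_borel_integral_eq_integral(2)[OF b_int]
      has_integral_Beta_real[of "1/2" "(\<alpha> - 1) / 2"] assms by (auto simp: b_def[abs_def] integral_unique)
  define G where "G u = sqrt (u / (1 - u))" for u :: real
  define G' where "G' u = 1 / (2 * sqrt (u / (1 - u)) * (1 - u)\<^sup>2)" for u :: real
  have deriv: "DERIV G u :> G' u" if "0 < u" "u < 1" for u
    unfolding G_def[abs_def] G'_def using that
    by (auto intro!: derivative_eq_intros simp: field_simps power2_eq_square)
  have prod: "(1 + (G u)\<^sup>2) powr (- \<alpha> / 2) * G' u = b u / 2" if "0 < u" "u < 1" for u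
  proof -
    have "1 + (G u)\<^sup>2 = inverse (1 - u)"
      using that by (simp add: G_def field_simps)
    then have *: "(1 + (G u)\<^sup>2) powr (- \<alpha> / 2) = (1 - u) powr (\<alpha> / 2)"
      using that by (simp add: powr_minus powr_divide inverse_eq_divide powr_minus_divide)
    have "G' u = u powr (-1/2) * (1 - u) powr (1/2) * (1 - u) powr (-2) / 2"
      using that by (simp add: G'_def real_sqrt_divide powr_minus powr_half_sqrt powr_numeral field_simps)
    then have "(1 + (G u)\<^sup>2) powr (- \<alpha> / 2) * G' u =
        u powr (-1/2) * ((1 - u) powr (\<alpha> / 2) * (1 - u) powr (1/2) * (1 - u) powr (-2)) / 2"
      unfolding * by simp
    also have "\<dots> = u powr (-1/2) * (1 - u) powr (\<alpha> / 2 + 1 / 2 - 2) / 2"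
      by (simp only: powr_add[symmetric]) simp
    also have "\<dots> = b u / 2"
      unfolding b_def by (simp add: field_simps)
    finally show ?thesis .
  qed
  have ein: "einterval (ereal 0) (ereal 1) = {0<..<1}" "einterval 0 1 = {0<..<1::real}"
    by (auto simp: einterval_def zero_ereal_def one_ereal_def)
  have sub: "set_integrable lborel (einterval (ereal 0) (ereal 1)) (\<lambda>u. (1 + (G u)\<^sup>2) powr (- \<alpha> / 2) * G' u)"
  proof -
    have "set_integrable lborel {0<..<1} (\<lambda>u. b u / 2)"
      by (rule set_integrable_divide, rule set_integrable_subset[OF b_int]) auto
    moreover have "set_integrable lborel {0<..<1} (\<lambda>u. (1 + (G u)\<^sup>2) powr (- \<alpha> / 2) * G' u) =
        set_integrable lborel {0<..<1} (\<lambda>u. b u / 2)"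
      by (rule set_integrable_cong) (auto simp only: prod greaterThanLessThan_iff)
    ultimately show ?thesis
      unfolding ein by blast
  qed
  have lim0: "((ereal \<circ> G \<circ> real_of_ereal) \<longlongrightarrow> ereal 0) (at_right (ereal 0))"
  proof -
    have "isCont G 0"
      unfolding G_def[abs_def] by (intro continuous_intros) auto
    then have "(G \<longlongrightarrow> 0) (at_right 0)"
      using filterlim_at_split isCont_def by (metis G_def div_0 real_sqrt_zero)
    then show ?thesis
      unfolding ereal_tendsto_simps1 by (simp add: o_def)
  qed
  have lim1: "((ereal \<circ> G \<circ> real_of_ereal) \<longlongrightarrow> \<infinity>) (at_left (ereal 1))"
  proof -
    have "filterlim (\<lambda>u::real. u / (1 - u)) at_top (at_left 1)"
      by real_asymp
    then have "filterlim G at_top (at_left 1)"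
      unfolding G_def[abs_def] by (rule filterlim_compose[OF sqrt_at_top])
    then show ?thesis
      unfolding ereal_tendsto_simps1 by (simp add: o_def tendsto_PInfty_eq_at_top)
  qed
  have cont1: "isCont (\<lambda>x. (1 + x\<^sup>2) powr (- \<alpha> / 2)) x" for x :: real
    using japanese_pos[of x] by (intro continuous_intros) auto
  have cont2: "isCont G' u" if "0 < u" "u < 1" for u
    unfolding G'_def[abs_def] using that by (intro continuous_intros) auto
  note S = interval_integral_substitution_nonneg[of "ereal 0" "ereal 1" G G'
      "\<lambda>x. (1 + x\<^sup>2) powr (- \<alpha> / 2)" "ereal 0" "\<infinity>"]
  have nn: "0 \<le> G' u" if "0 \<le> u" "u \<le> 1" for u
    using that by (auto simp: G'_def)
  have "set_integrable lborel (einterval (ereal 0) \<infinity>) (\<lambda>x. (1 + x\<^sup>2) powr (- \<alpha> / 2))"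
    by (rule S(1)) (use deriv cont1 cont2 nn lim0 lim1 sub in auto)
  then show "set_integrable lborel {0<..} (\<lambda>x. (1 + x\<^sup>2) powr (- \<alpha> / 2))"
    by simp
  have "(LBINT x=ereal 0..\<infinity>. (1 + x\<^sup>2) powr (- \<alpha> / 2)) =
      (LBINT u=ereal 0..ereal 1. (1 + (G u)\<^sup>2) powr (- \<alpha> / 2) * G' u)"
    by (rule S(2)) (use deriv cont1 cont2 nn lim0 lim1 sub in auto)
  also have "\<dots> = (LBINT u:{0<..<1}. b u / 2)"
  proof -
    have "(LBINT u=ereal 0..ereal 1. (1 + (G u)\<^sup>2) powr (- \<alpha> / 2) * G' u) =
        (LBINT u:{0<..<1}. (1 + (G u)\<^sup>2) powr (- \<alpha> / 2) * G' u)"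
      by (subst interval_lebesgue_integral_le_eq) (auto simp: ein)
    also have "\<dots> = (LBINT u:{0<..<1}. b u / 2)"
      by (rule set_lebesgue_integral_cong) (auto simp only: prod greaterThanLessThan_iff, auto)
    finally show ?thesis .
  qed
  also have "\<dots> = (LBINT u:{0..1}. b u / 2)"
    unfolding set_lebesgue_integral_def
  proof (rule integral_cong_AE)
    show "AE x in lborel. indicator {0<..<1} x *\<^sub>R (b x / 2) = indicator {0..1} x *\<^sub>R (b x / 2)"
      using AE_lborel_singleton[of 0] AE_lborel_singleton[of 1]
      by eventually_elim (auto simp: indicator_def)
  qed (auto simp: b_def)
  also have "\<dots> = Beta (1/2) ((\<alpha> - 1) / 2) / 2"
    using b_val by simp
  finally show "(LBINT x:{0<..}. (1 + x\<^sup>2) powr (- \<alpha> / 2)) = Beta (1/2) ((\<alpha> - 1) / 2) / 2"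
    by (simp add: interval_integral_to_infinity_eq)
qed

lemma japanese_integrable:
  assumes "\<alpha> > (1::real)"
  shows "integrable lborel (\<lambda>x. (1 + x\<^sup>2) powr (- \<alpha> / 2))"
    and "(LBINT x. (1 + x\<^sup>2) powr (- \<alpha> / 2)) = Beta (1/2) ((\<alpha> - 1) / 2)"
proof -
  let ?f = "\<lambda>x::real. (1 + x\<^sup>2) powr (- \<alpha> / 2)"
  note H = japanese_half_line[OF assms]
  have neg: "integrable lborel (\<lambda>x. indicator {..<0} x * ?f x)"
    "(LBINT x. indicator {..<0} x * ?f x) = Beta (1/2) ((\<alpha> - 1) / 2) / 2"
  proof -
    \<comment> \<open>Reflection at the origin, written as the affine map
      \<open>0 + (-1) * x\<close> to match the substitution rule for Lebesgue measure.\<close>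
    have "(\<lambda>x. indicator {0<..} (0 + (-1) * x) * ?f (0 + (-1) * x)) = (\<lambda>x. indicator {..<0} x * ?f x)"
      by (auto simp: indicator_def)
    then show "integrable lborel (\<lambda>x. indicator {..<0} x * ?f x)"
      "(LBINT x. indicator {..<0} x * ?f x) = Beta (1/2) ((\<alpha> - 1) / 2) / 2"
      using lborel_integrable_real_affine[of "\<lambda>x. indicator {0<..} x * ?f x" "-1" 0]
        lborel_integral_real_affine[of "-1" "\<lambda>x. indicator {0<..} x * ?f x" 0] H
      by (auto simp: set_integrable_def set_lebesgue_integral_def)
  qed
  have pos: "integrable lborel (\<lambda>x. indicator {0<..} x * ?f x)"
    "(LBINT x. indicator {0<..} x * ?f x) = Beta (1/2) ((\<alpha> - 1) / 2) / 2"
    using H by (auto simp: set_integrable_def set_lebesgue_integral_def)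
  have ae: "AE x in lborel. indicator {..<0} x * ?f x + indicator {0<..} x * ?f x = ?f x"
    using AE_lborel_singleton[of 0] by eventually_elim (auto simp: indicator_def)
  have "integrable lborel (\<lambda>x. indicator {..<0} x * ?f x + indicator {0<..} x * ?f x)"
    using neg pos by simp
  then show "integrable lborel ?f"
    by (rule integrable_cong_AE_imp) (use ae in auto)
  have "(LBINT x. ?f x) = (LBINT x. indicator {..<0} x * ?f x + indicator {0<..} x * ?f x)"
    by (rule integral_cong_AE) (use ae in auto)
  then show "(LBINT x. ?f x) = Beta (1/2) ((\<alpha> - 1) / 2)"
    using neg pos by simp
qed

lemma density_const_pos: "\<alpha> > 1 \<Longrightarrow> 0 < density_const \<alpha>"
  by (simp add: density_const_def)

lemma poly_density_pos: "\<alpha> > 1 \<Longrightarrow> 0 < poly_density \<alpha> x"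
  using japanese_pos[of x] by (simp add: poly_density_def density_const_pos)

lemma poly_density_integrable: "\<alpha> > 1 \<Longrightarrow> integrable lborel (poly_density \<alpha>)"
  unfolding poly_density_def[abs_def] by (intro integrable_mult_right japanese_integrable) auto

lemma poly_density_integral:
  assumes "\<alpha> > 1"
  shows "(LBINT x. poly_density \<alpha> x) = 1"
proof -
  have "(LBINT x. poly_density \<alpha> x) = density_const \<alpha> * Beta (1/2) ((\<alpha> - 1) / 2)"
    using japanese_integrable[OF assms] by (simp add: poly_density_def)
  also have "\<dots> = 1"
    using assms Gamma_real_pos[of "(\<alpha> - 1) / 2"] Gamma_real_pos[of "\<alpha> / 2"]
    by (simp add: density_const_def Beta_def Gamma_one_half_real field_simps del: Gamma_real_pos)
  finally show ?thesis .
qed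

lemma isCont_poly_density: "isCont (poly_density \<alpha>) x"
  unfolding poly_density_def[abs_def]
  using japanese_pos[of x] by (intro continuous_intros) auto

section \<open>The cumulative distribution function and the change of variables\<close>

lemma poly_cdf_deriv:
  assumes "\<alpha> > 1"
  shows "(poly_cdf \<alpha> has_real_derivative poly_density \<alpha> x) (at x)"
proof -
  let ?\<mu> = "poly_density \<alpha>"
  \<comment> \<open>A base point strictly to the left of \<open>x\<close> makes \<open>x\<close>
    interior to the compact interval \<open>{c..x+1}\<close>, so the fundamental theorem of calculus
    gives a two-sided derivative; the mass to the left of \<open>c\<close> is a constant.\<close>
  define c where "c = x - 1"
  have int: "set_integrable lborel A ?\<mu>" if "A \<in> sets borel" for A
    using poly_density_integrable[OF assms] that unfolding set_integrable_def
    by (intro integrable_mult_indicator) auto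
  have eq: "poly_cdf \<alpha> y = poly_cdf \<alpha> c + (LBINT t:{c..y}. ?\<mu> t)" if "c \<le> y" for y
  proof -
    have "poly_cdf \<alpha> y = (LBINT t:{..<c} \<union> {c..y}. ?\<mu> t)"
      unfolding poly_cdf_def using that by (intro arg_cong2[where f="set_lebesgue_integral lborel"] ) auto
    also have "\<dots> = (LBINT t:{..<c}. ?\<mu> t) + (LBINT t:{c..y}. ?\<mu> t)"
      by (rule set_integral_Un) (auto intro: int)
    also have "(LBINT t:{..<c}. ?\<mu> t) = poly_cdf \<alpha> c"
      unfolding poly_cdf_def set_lebesgue_integral_def
    proof (rule integral_cong_AE)
      show "AE x in lborel. indicator {..<c} x *\<^sub>R ?\<mu> x = indicator {..c} x *\<^sub>R ?\<mu> x"
        using AE_lborel_singleton[of c] by eventually_elim (auto simp: indicator_def)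
    qed (use int in \<open>auto simp: set_integrable_def\<close>)
    finally show ?thesis .
  qed
  have "((\<lambda>y. integral {c..y} ?\<mu>) has_real_derivative ?\<mu> x) (at x within {c..x+1})"
    unfolding has_real_derivative_iff_has_vector_derivative
    by (rule integral_has_vector_derivative)
      (auto simp: c_def intro!: continuous_at_imp_continuous_on isCont_poly_density)
  then have "((\<lambda>y. integral {c..y} ?\<mu>) has_real_derivative ?\<mu> x) (at x)"
    by (subst (asm) at_within_Icc_at) (auto simp: c_def)
  then have "((\<lambda>y. poly_cdf \<alpha> c + integral {c..y} ?\<mu>) has_real_derivative ?\<mu> x) (at x)"
    by (auto intro!: derivative_eq_intros)
  then show ?thesis
  proof (rule has_field_derivative_transform_within_open[where S="{c<..}"])
    show "poly_cdf \<alpha> c + integral {c..y} ?\<mu> = poly_cdf \<alpha> y" if "y \<in> {c<..}" for y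
      using eq[of y] that set_borel_integral_eq_integral(2)[OF int, of "{c..y}"] by auto
  qed (auto simp: c_def)
qed

lemma isCont_poly_cdf: "\<alpha> > 1 \<Longrightarrow> isCont (poly_cdf \<alpha>) x"
  using poly_cdf_deriv DERIV_isCont by blast

lemma poly_cdf_strict_mono: "\<alpha> > 1 \<Longrightarrow> strict_mono (poly_cdf \<alpha>)"
  by (rule strict_monoI) (metis DERIV_pos_imp_increasing poly_cdf_deriv poly_density_pos)

lemma poly_cdf_tendsto:
  assumes "\<alpha> > 1"
  shows "(poly_cdf \<alpha> \<longlongrightarrow> 1) at_top" "(poly_cdf \<alpha> \<longlongrightarrow> 0) at_bot"
proof -
  have m: "poly_density \<alpha> \<in> borel_measurable lborel"
    using poly_density_integrable[OF assms] by auto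
  have "((\<lambda>x. LBINT t:{..x}. poly_density \<alpha> t) \<longlongrightarrow> (LBINT t. poly_density \<alpha> t)) at_top"
    using tendsto_integral_at_top[of lborel "poly_density \<alpha>"] poly_density_integrable[OF assms]
    by (simp add: set_lebesgue_integral_def)
  then show "(poly_cdf \<alpha> \<longlongrightarrow> 1) at_top"
    using poly_density_integral[OF assms] by (simp add: poly_cdf_def[abs_def])
  \<comment> \<open>The limit at minus infinity is taken in the reflected variable: the indicators
    tend to 0 pointwise, and the density itself dominates.\<close>
  have "((\<lambda>x. LBINT t. indicator {..-x} t * poly_density \<alpha> t) \<longlongrightarrow> (LBINT t::real. 0)) at_top"
  proof (rule integral_dominated_convergence_at_top[where w="poly_density \<alpha>"])
    show "AE t in lborel. ((\<lambda>x. indicator {..-x} t * poly_density \<alpha> t) \<longlongrightarrow> 0) at_top"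
    proof (rule AE_I2)
      fix t :: real
      have "\<forall>\<^sub>F x in at_top. indicator {..-x} t * poly_density \<alpha> t = 0"
        using eventually_gt_at_top[of "-t"] by eventually_elim auto
      then show "((\<lambda>x. indicator {..-x} t * poly_density \<alpha> t) \<longlongrightarrow> 0) at_top"
        by (rule tendsto_eventually)
    qed
  qed (use m poly_density_integrable[OF assms] poly_density_pos[OF assms] in
       \<open>auto simp: indicator_def abs_mult less_imp_le intro!: always_eventually\<close>)
  then show "(poly_cdf \<alpha> \<longlongrightarrow> 0) at_bot"
    unfolding filterlim_at_bot_mirror by (simp add: poly_cdf_def set_lebesgue_integral_def)
qed

lemma inv_poly_cdf: "\<alpha> > 1 \<Longrightarrow> inv (poly_cdf \<alpha>) (poly_cdf \<alpha> x) = x"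
  using poly_cdf_strict_mono[of \<alpha>] by (intro inv_f_f strict_mono_imp_inj_on)

lemma isCont_inv_poly_cdf:
  assumes "\<alpha> > 1"
  shows "isCont (inv (poly_cdf \<alpha>)) (poly_cdf \<alpha> x)"
  by (rule isCont_inverse_function[where d=1]) (auto simp: inv_poly_cdf assms isCont_poly_cdf)

lemma isCont_cis: "isCont cis x"
  using continuous_on_cis[OF continuous_on_id, of UNIV] by (simp add: continuous_on_eq_continuous_at)

text \<open>The Jacobian \<mu> of the substitution cancels the denominator in
  \<open>transplant\<close>. Integrability of \<open>f\<close> is what justifies the substitution;
  no bound on \<open>f / \<mu>\<close> is assumed.\<close>

lemma fourier_coeff_transplant:
  assumes "\<alpha> > 1" and f: "continuous_on UNIV f" "integrable lborel f"
  shows "fourier_coeff (transplant \<alpha> f \<xi>) k =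
    (LBINT x. f x * cis (- 2 * pi * (x * \<xi> + of_int k * poly_cdf \<alpha> x)))"
proof -
  let ?\<Psi> = "poly_cdf \<alpha>" and ?\<mu> = "poly_density \<alpha>"
  define h where "h y = transplant \<alpha> f \<xi> y * cis (- 2 * pi * of_int k * y)" for y
  have lims: "((ereal \<circ> ?\<Psi> \<circ> real_of_ereal) \<longlongrightarrow> ereal 0) (at_right (-\<infinity>))"
    "((ereal \<circ> ?\<Psi> \<circ> real_of_ereal) \<longlongrightarrow> ereal 1) (at_left \<infinity>)"
    using poly_cdf_tendsto[OF assms(1)] unfolding ereal_tendsto_simps1 by (simp_all add: o_def)
  have h\<Psi>: "h (?\<Psi> x) = f x * cis (- 2 * pi * (x * \<xi> + of_int k * ?\<Psi> x)) / of_real (?\<mu> x)" for x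
    unfolding h_def transplant_def Let_def inv_poly_cdf[OF assms(1)]
    by (simp add: cis_mult algebra_simps)
  have sc: "?\<mu> x *\<^sub>R h (?\<Psi> x) = f x * cis (- 2 * pi * (x * \<xi> + of_int k * ?\<Psi> x))" for x
    using poly_density_pos[OF assms(1), of x] unfolding h\<Psi> by (simp add: scaleR_conv_of_real)
  have nh: "norm (h (?\<Psi> x)) * ?\<mu> x = norm (f x)" for x
    using poly_density_pos[OF assms(1), of x] unfolding h\<Psi> by (simp add: norm_mult norm_divide)
  have cont_cis: "isCont (\<lambda>x. cis (c * x)) x" for c x :: real
    by (rule isCont_o2[OF _ isCont_cis]) (intro continuous_intros)
  have cont: "isCont h (?\<Psi> x)" for x
  proof -
    define F where "F x = f x / complex_of_real (?\<mu> x) * cis (- 2 * pi * \<xi> * x)" for x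
    have "isCont F z" for z
      unfolding F_def using poly_density_pos[OF assms(1), of z] f(1)
      by (intro continuous_intros isCont_poly_density cont_cis) (auto simp: continuous_on_eq_continuous_at)
    then have "isCont (\<lambda>y. F (inv ?\<Psi> y)) (?\<Psi> x)"
      using isCont_inv_poly_cdf[OF assms(1)] by (rule isCont_o2[rotated])
    moreover have "h = (\<lambda>y. F (inv ?\<Psi> y) * cis (- 2 * pi * of_int k * y))"
      unfolding h_def transplant_def Let_def F_def by (simp add: mult_ac)
    ultimately show ?thesis
      by (simp only:) (intro continuous_intros cont_cis)
  qed
  have int: "integrable lborel (\<lambda>x. f x * cis (- 2 * pi * (x * \<xi> + of_int k * ?\<Psi> x)))"
  proof (rule Bochner_Integration.integrable_bound[OF f(2)])
    show "(\<lambda>x. f x * cis (- 2 * pi * (x * \<xi> + of_int k * ?\<Psi> x))) \<in> borel_measurable lborel"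
    proof -
      have "isCont (\<lambda>x. cis (- 2 * pi * (x * \<xi> + of_int k * ?\<Psi> x))) x" for x
        by (rule isCont_o2[OF _ isCont_cis]) (intro continuous_intros isCont_poly_cdf[OF assms(1)])
      then have "continuous_on UNIV (\<lambda>x. f x * cis (- 2 * pi * (x * \<xi> + of_int k * ?\<Psi> x)))"
        by (intro continuous_on_mult f(1) continuous_at_imp_continuous_on ballI)
      then show ?thesis
        by (simp add: borel_measurable_continuous_onI)
    qed
  qed (auto simp: norm_mult)
  have ein: "einterval (ereal 0) (ereal 1) = {0<..<1}"
    by (auto simp: einterval_def)
  \<comment> \<open>The substitution rule for complex integrands presupposes that \<open>h\<close>
    is integrable. This comes from the rule for nonnegative integrands applied to
    \<open>norm h\<close>, since \<open>norm (h (\<Psi> x)) * \<mu> x = norm (f x)\<close>.\<close>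
  have nint: "set_integrable lborel (einterval (ereal 0) (ereal 1)) (\<lambda>y. norm (h y))"
    by (rule interval_integral_substitution_nonneg(1)[of "-\<infinity>" \<infinity> ?\<Psi> ?\<mu>])
      (use lims poly_cdf_deriv[OF assms(1)] isCont_poly_density poly_density_pos[OF assms(1)] cont f(2)
       in \<open>auto simp: nh set_integrable_def less_imp_le\<close>)
  have hint: "set_integrable lborel (einterval (ereal 0) (ereal 1)) h"
  proof -
    \<comment> \<open>Continuity of \<open>h\<close> is known at the values of \<Psi>; the limits 0
      and 1 and the intermediate value theorem show that these fill the open unit interval.\<close>
    have "continuous_on {0<..<1} h"
    proof (rule continuous_at_imp_continuous_on, safe)
      fix y :: real assume "y \<in> {0<..<1}"
      then have y: "0 < y" "y < 1"
        by auto
      obtain u l where "?\<Psi> l < y" "y < ?\<Psi> u"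
        using order_tendstoD(1)[OF poly_cdf_tendsto(1)[OF assms(1)] y(2)]
          order_tendstoD(2)[OF poly_cdf_tendsto(2)[OF assms(1)] y(1)]
        by (metis eventually_happens trivial_limit_at_bot_linorder trivial_limit_at_top_linorder)
      then have "\<exists>x. ?\<Psi> x = y"
        using IVT[of ?\<Psi> l y u] isCont_poly_cdf[OF assms(1)] poly_cdf_strict_mono[OF assms(1)]
        by (metis less_le_trans less_imp_le strict_mono_less_eq order_less_trans)
      then show "isCont h y" using cont by auto
    qed
    then have "set_borel_measurable lborel {0<..<1} h"
      unfolding set_borel_measurable_def
      using borel_measurable_continuous_on_indicator[of "{0<..<1}" h] by simp
    then show ?thesis
      using nint unfolding ein set_integrable_def set_borel_measurable_def
      by (intro Bochner_Integration.integrable_bound[OF nint[unfolded ein set_integrable_def]]) auto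
  qed
  have "fourier_coeff (transplant \<alpha> f \<xi>) k = (LBINT y=ereal 0..ereal 1. h y)"
    unfolding fourier_coeff_def h_def by (rule interval_integral_Icc[symmetric]) simp
  also have "\<dots> = (LBINT x=-\<infinity>..\<infinity>. ?\<mu> x *\<^sub>R h (?\<Psi> x))"
    by (rule interval_integral_substitution_integrable)
      (use lims poly_cdf_deriv[OF assms(1)] isCont_poly_density poly_density_pos[OF assms(1)] cont hint int
       in \<open>auto simp: sc set_integrable_def less_imp_le\<close>)
  finally show ?thesis
    by (simp add: sc interval_lebesgue_integral_le_eq set_lebesgue_integral_def)
qed

section \<open>Powers of the Japanese bracket\<close>

text \<open>The usual Japanese bracket is \<open>bracket (1/2)\<close>. Exponents are therefore half
  the order of growth: the weight \<open>v\<close> is \<open>bracket (a/2)\<close>, and one order of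
  decay is \<open>bracket (-1/2)\<close>.\<close>

definition bracket :: "real \<Rightarrow> real \<Rightarrow> real" where
  "bracket s x = (1 + x\<^sup>2) powr s"

lemma bracket_pos [simp]: "0 < bracket s x"
  using japanese_pos[of x] by (simp add: bracket_def)

lemma bracket_nonneg [simp]: "0 \<le> bracket s x"
  by (simp add: bracket_def)

lemma bracket_neq_0 [simp]: "bracket s x \<noteq> 0"
  using bracket_pos[of s x] by linarith

lemma bracket_mult: "bracket s x * bracket t x = bracket (s + t) x"
  by (simp add: bracket_def powr_add)

lemma bracket_divide: "bracket s x / bracket t x = bracket (s - t) x"
  by (simp add: bracket_def powr_diff)

lemma bracket_0 [simp]: "bracket 0 x = 1"
  using japanese_pos[of x] by (simp add: bracket_def)

lemma bracket_1: "bracket 1 x = 1 + x\<^sup>2"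
  using japanese_pos[of x] by (simp add: bracket_def)

lemma bracket_power: "bracket s x ^ n = bracket (real n * s) x"
  using japanese_pos[of x] by (simp add: bracket_def powr_powr powr_realpow[symmetric] mult.commute)

lemma bracket_le_1: "s \<le> 0 \<Longrightarrow> bracket s x \<le> 1"
  using japanese_pos[of x] japanese_ge_1[of x] powr_mono[of s 0 "1 + x\<^sup>2"] by (simp add: bracket_def split: if_splits)

lemma bracket_not_le_0 [simp]: "\<not> bracket s x \<le> 0"
  by (simp add: not_le)

lemma abs_le_bracket: "\<bar>x\<bar> \<le> bracket (1/2) x"
  using japanese_pos[of x] real_sqrt_le_mono[of "x\<^sup>2" "1 + x\<^sup>2"]
  by (simp add: bracket_def powr_half_sqrt)

lemma continuous_bracket [continuous_intros]: "continuous_on S (bracket s)"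
  unfolding bracket_def[abs_def] using japanese_pos
  by (intro continuous_intros) (auto simp: less_imp_neq[symmetric])

lemma measurable_bracket [measurable]: "bracket s \<in> borel_measurable borel"
  by (intro borel_measurable_continuous_onI continuous_intros)

lemma bracket_deriv: "(bracket s has_real_derivative 2 * s * x * bracket (s - 1) x) (at x)"
  unfolding bracket_def[abs_def] using japanese_pos[of x]
  by (auto intro!: derivative_eq_intros simp: powr_diff field_simps)

lemma bracket_integrable: "s < -(1/2) \<Longrightarrow> integrable lborel (bracket s)"
  using japanese_integrable(1)[of "-2 * s"] by (simp add: bracket_def[abs_def])

lemma integrable_bracket_bound:
  fixes f :: "real \<Rightarrow> complex"
  assumes "continuous_on UNIV f" "\<And>x. cmod (f x) \<le> N * bracket s x" "s < -(1/2)"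
  shows "integrable lborel f"
proof (rule Bochner_Integration.integrable_bound)
  show "integrable lborel (\<lambda>x. N * bracket s x)"
    using assms(3) by (intro integrable_mult_right bracket_integrable)
qed (use assms(1,2) in \<open>auto intro!: borel_measurable_continuous_onI order_trans[OF _ abs_ge_self]\<close>)

lemma bracket_tendsto_0:
  assumes "s < 0"
  shows "(bracket s \<longlongrightarrow> 0) at_top" "(bracket s \<longlongrightarrow> 0) at_bot"
proof -
  have "filterlim (\<lambda>x::real. 1 + x\<^sup>2) at_top F" if "F = at_top \<or> F = at_bot" for F
    using that by (auto; real_asymp)
  from this[THEN tendsto_neg_powr[OF assms]] show "(bracket s \<longlongrightarrow> 0) at_top" "(bracket s \<longlongrightarrow> 0) at_bot"
    unfolding bracket_def[abs_def] by auto
qed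

lemma poly_density_bracket: "poly_density \<alpha> x = density_const \<alpha> * bracket (- \<alpha> / 2) x"
  by (simp add: poly_density_def bracket_def)

lemma symbol_bound_ident: "symbol_bound n UNIV of_real (bracket (1/2)) (bracket (-1/2))"
proof -
  have le: "cmod (of_real x) \<le> bracket (1/2) x" for x
    using abs_le_bracket[of x] by simp
  show ?thesis
  proof (cases n)
    case (Suc k)
    have "symbol_bound k UNIV (\<lambda>x. 1) (\<lambda>x. bracket (1/2) x * bracket (-1/2) x) (bracket (-1/2))"
      by (rule symbol_bound_const) (auto simp: bracket_mult)
    moreover have "(of_real has_vector_derivative (1::complex)) (at x)" for x
      using has_vector_derivative_of_real[OF DERIV_ident[of "at x"]] by simp
    ultimately show ?thesis
      unfolding Suc symbol_bound.simps(2) using le by (intro conjI exI[of _ "\<lambda>x. 1"]) auto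
  qed (use le in \<open>auto intro!: continuous_intros\<close>)
qed

text \<open>The derivative of \<open>bracket s\<close> is
  \<open>2 * s * x * bracket (s - 1) x\<close>, and the factor \<open>x\<close> has size at most
  \<open>bracket (1/2)\<close>, so one derivative gains \<open>bracket (-1/2)\<close>. Since the
  exponent changes, the induction runs over all \<open>s\<close>.\<close>

lemma symbol_bound_bracket:
  "\<exists>C\<ge>1. symbol_bound n UNIV (\<lambda>x. of_real (bracket s x)) (\<lambda>x. C * bracket s x) (bracket (-1/2))"
proof (induction n arbitrary: s)
  case 0
  show ?case
    by (intro exI[of _ 1]) (auto intro!: continuous_intros)
next
  case (Suc n)
  obtain C where C: "C \<ge> 1" "symbol_bound n UNIV (\<lambda>x. of_real (bracket (s - 1) x))
      (\<lambda>x. C * bracket (s - 1) x) (bracket (-1/2))"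
    using Suc.IH by blast
  define D where "D = max 1 (2 * \<bar>s\<bar> * 2 ^ n * C)"
  have "symbol_bound n UNIV (\<lambda>x. of_real (2 * s) * (of_real x * of_real (bracket (s - 1) x)))
      (\<lambda>x. D * bracket s x * bracket (-1/2) x) (bracket (-1/2))"
  proof (rule symbol_bound_mono)
    show "symbol_bound n UNIV (\<lambda>x. of_real (2 * s) * (of_real x * of_real (bracket (s - 1) x)))
      (\<lambda>x. cmod (of_real (2 * s)) * (2 ^ n * (bracket (1/2) x * (C * bracket (s - 1) x)))) (bracket (-1/2))"
      by (intro symbol_bound_cmult symbol_bound_mult symbol_bound_ident C)
    fix x
    have "cmod (of_real (2 * s)) * (2 ^ n * (bracket (1/2) x * (C * bracket (s - 1) x))) =
        2 * \<bar>s\<bar> * 2 ^ n * C * (bracket (1/2) x * bracket (s - 1) x)"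
      by (simp add: norm_mult)
    also have "\<dots> \<le> D * (bracket (1/2) x * bracket (s - 1) x)"
      unfolding D_def by (intro mult_right_mono) (auto intro: mult_nonneg_nonneg)
    also have "\<dots> = D * bracket s x * bracket (-1/2) x"
      unfolding mult.assoc bracket_mult by (simp add: field_simps)
    finally show "cmod (of_real (2 * s)) * (2 ^ n * (bracket (1/2) x * (C * bracket (s - 1) x)))
      \<le> D * bracket s x * bracket (-1/2) x" .
  qed auto
  moreover have "((\<lambda>x. complex_of_real (bracket s x)) has_vector_derivative
      of_real (2 * s) * (of_real x * of_real (bracket (s - 1) x))) (at x)" for x
    using has_vector_derivative_of_real[OF bracket_deriv[of s x]]
    by (simp add: mult.assoc)
  moreover have "cmod (of_real (bracket s x)) \<le> D * bracket s x" for x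
    using mult_right_mono[of 1 D "bracket s x"] by (simp add: D_def)
  ultimately show ?case
    unfolding symbol_bound.simps(2)
    by (intro exI[of _ D] conjI ballI
        exI[of _ "\<lambda>x. of_real (2 * s) * (of_real x * of_real (bracket (s - 1) x))"]) (auto simp: D_def)
qed

text \<open>From the first derivative on, the constant \<xi> disappears and only
  \<open>k * \<mu>\<close> is left, whose derivatives are controlled by \<open>|k| * \<mu>\<close>
  and hence by \<open>\<kappa> * |g|\<close>. The single factor \<kappa> is absorbed by the first
  power of \<open>R\<close>, and \<open_placeholder>\<close>

lemma symbol_bound_phase:
  assumes "\<alpha> > 1"
  shows "\<exists>K\<ge>1. \<forall>\<xi> (k::real) U \<kappa> R.
    (\<forall>x\<in>U. \<bar>k\<bar> * poly_density \<alpha> x \<le> \<kappa> x * \<bar>\<xi> + k * poly_density \<alpha> x\<bar>) \<longrightarrow>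
    (\<forall>x\<in>U. 1 \<le> \<kappa> x \<and> \<kappa> x * bracket (-1/2) x \<le> R x) \<longrightarrow>
    symbol_bound n U (\<lambda>x. of_real (\<xi> + k * poly_density \<alpha> x))
      (\<lambda>x. K * \<bar>\<xi> + k * poly_density \<alpha> x\<bar>) R"
proof -
  have c: "continuous_on S (poly_density \<alpha>)" for S
    using isCont_poly_density by (auto intro!: continuous_at_imp_continuous_on)
  show ?thesis
  proof (cases n)
    case 0
    then show ?thesis
      by (intro exI[of _ 1]) (auto intro!: continuous_intros c simp: norm_of_real simp flip: of_real_mult of_real_add)
  next
    case (Suc j)
    obtain C where C: "C \<ge> 1" "symbol_bound (Suc j) UNIV (\<lambda>x. of_real (bracket (-\<alpha>/2) x))
      (\<lambda>x. C * bracket (-\<alpha>/2) x) (bracket (-1/2))"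
      using symbol_bound_bracket by blast
    have "symbol_bound (Suc j) UNIV (\<lambda>x. of_real (density_const \<alpha>) * of_real (bracket (-\<alpha>/2) x))
      (\<lambda>x. cmod (of_real (density_const \<alpha>)) * (C * bracket (-\<alpha>/2) x)) (bracket (-1/2))"
      by (intro symbol_bound_cmult C)
    then have "symbol_bound (Suc j) UNIV (\<lambda>x. of_real (poly_density \<alpha> x))
      (\<lambda>x. C * poly_density \<alpha> x) (bracket (-1/2))"
      using density_const_pos[OF assms] by (simp add: poly_density_bracket mult_ac del: symbol_bound.simps)
    then obtain \<mu>' where \<mu>': "\<And>x. ((\<lambda>x. complex_of_real (poly_density \<alpha> x)) has_vector_derivative \<mu>' x) (at x)"
      "symbol_bound j UNIV \<mu>' (\<lambda>x. C * poly_density \<alpha> x * bracket (-1/2) x) (bracket (-1/2))"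
      unfolding symbol_bound.simps(2) by auto
    show ?thesis
    proof (intro exI[of _ C] conjI allI impI C(1))
      fix \<xi> k :: real and U and \<kappa> R :: "real \<Rightarrow> real"
      let ?g = "\<lambda>x. \<xi> + k * poly_density \<alpha> x"
      assume k: "\<forall>x\<in>U. \<bar>k\<bar> * poly_density \<alpha> x \<le> \<kappa> x * \<bar>?g x\<bar>"
        and R: "\<forall>x\<in>U. 1 \<le> \<kappa> x \<and> \<kappa> x * bracket (-1/2) x \<le> R x"
      have "symbol_bound j U (\<lambda>x. of_real k * \<mu>' x) (\<lambda>x. C * \<bar>?g x\<bar> * R x) R"
      proof (rule symbol_bound_mono[OF symbol_bound_cmult[OF \<mu>'(2)]])
        fix x assume x: "x \<in> U"
        have "cmod (of_real k) * (C * poly_density \<alpha> x * bracket (-1/2) x) =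
            C * (\<bar>k\<bar> * poly_density \<alpha> x * bracket (-1/2) x)"
          by simp
        also have "\<dots> \<le> C * ((\<kappa> x * \<bar>?g x\<bar>) * bracket (-1/2) x)"
          using k x C(1) by (intro mult_left_mono mult_right_mono) auto
        also have "\<dots> = C * (\<bar>?g x\<bar> * (\<kappa> x * bracket (-1/2) x))"
          by simp
        also have "\<dots> \<le> C * (\<bar>?g x\<bar> * R x)"
          using R x C(1) by (intro mult_left_mono) auto
        finally show "cmod (of_real k) * (C * poly_density \<alpha> x * bracket (-1/2) x) \<le> C * \<bar>?g x\<bar> * R x"
          by simp
        show "bracket (-1/2) x \<le> R x"
        proof -
          have "1 * bracket (-1/2) x \<le> \<kappa> x * bracket (-1/2) x"
            using R x by (intro mult_right_mono) auto
          also have "\<dots> \<le> R x"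
            using R x by blast
          finally show ?thesis by simp
        qed
      qed auto
      moreover have "((\<lambda>x. of_real (?g x)) has_vector_derivative of_real k * \<mu>' x) (at x)" for x
        using has_vector_derivative_add[OF has_vector_derivative_const[of "of_real \<xi>"]
            has_vector_derivative_mult_right[OF \<mu>'(1)[of x], of "of_real k"]] by simp
      moreover have "cmod (of_real (?g x)) \<le> C * \<bar>?g x\<bar>" for x
        using C(1) mult_right_mono[of 1 C "\<bar>?g x\<bar>"] by (simp only: norm_of_real) auto
      ultimately show "symbol_bound n U (\<lambda>x. of_real (?g x)) (\<lambda>x. C * \<bar>?g x\<bar>) R"
        unfolding Suc symbol_bound.simps(2) by (intro conjI exI[of _ "\<lambda>x. of_real k * \<mu>' x"]) auto
    qed
  qed
qed

section \<open>Weighted norms as derivative bounds\<close>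

lemma nth_deriv_Suc: "nth_deriv (Suc l) f x = vector_derivative (nth_deriv l f) (at x)"
  by (simp add: nth_deriv_def)

lemma weighted_deriv_sum_mono:
  assumes "j \<le> m" "0 \<le> v x"
  shows "weighted_deriv_sum v j f x \<le> weighted_deriv_sum v m f x"
  unfolding weighted_deriv_sum_def using assms
  by (intro mult_right_mono sum_mono2) auto

lemma poly_weight_nonneg: "0 \<le> poly_weight a x"
  by (simp add: poly_weight_def)

lemma poly_weight_bracket: "poly_weight a x = bracket (a/2) x"
  by (simp add: poly_weight_def bracket_def)

lemma weighted_diff_norm_mono:
  assumes "f \<in> weighted_diff_space (poly_weight a) m" "j \<le> m"
  shows "bdd_above (range (weighted_deriv_sum (poly_weight a) j f))"
    and "weighted_diff_norm (poly_weight a) j f \<le> weighted_diff_norm (poly_weight a) m f"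
proof -
  have bdd: "bdd_above (range (weighted_deriv_sum (poly_weight a) m f))"
    using assms by (simp add: weighted_diff_space_def)
  show "weighted_diff_norm (poly_weight a) j f \<le> weighted_diff_norm (poly_weight a) m f"
    unfolding weighted_diff_norm_def
  proof (rule cSUP_mono)
    show "\<exists>y\<in>UNIV. weighted_deriv_sum (poly_weight a) j f x \<le> weighted_deriv_sum (poly_weight a) m f y" for x
      by (rule bexI[of _ x]) (auto intro: weighted_deriv_sum_mono[OF assms(2)] poly_weight_nonneg)
  qed (use bdd in auto)
  show "bdd_above (range (weighted_deriv_sum (poly_weight a) j f))"
  proof -
    obtain M where "\<And>x. weighted_deriv_sum (poly_weight a) m f x \<le> M"
      using bdd unfolding bdd_above_def by auto
    then have "weighted_deriv_sum (poly_weight a) j f x \<le> M" for x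
      using weighted_deriv_sum_mono[OF assms(2), of "poly_weight a" x f] poly_weight_nonneg order_trans
      by blast
    then show ?thesis
      by (rule bdd_aboveI2)
  qed
qed

lemma symbol_bound_weighted_diff_space:
  assumes f: "f \<in> weighted_diff_space (poly_weight a) m" and j: "j \<le> m"
  shows "symbol_bound j UNIV f (\<lambda>x. weighted_diff_norm (poly_weight a) j f * bracket (-a/2) x)
    (bracket (-1/2))"
proof -
  let ?N = "weighted_diff_norm (poly_weight a) j f"
  have le: "cmod (nth_deriv l f x) \<le> ?N * bracket (-a/2 - real l/2) x" if "l \<le> j" for l x
  proof -
    have "cmod (nth_deriv l f x) * bracket (real l/2) x * poly_weight a x
        \<le> weighted_deriv_sum (poly_weight a) j f x"
    proof -
      have "cmod (nth_deriv l f x) * bracket (real l/2) x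
          \<le> (\<Sum>l\<le>j. cmod (nth_deriv l f x) * bracket (real l/2) x)"
        using that by (intro member_le_sum[where f="\<lambda>l. cmod (nth_deriv l f x) * bracket (real l/2) x"]) auto
      then show ?thesis
        unfolding weighted_deriv_sum_def by (intro mult_right_mono poly_weight_nonneg) (simp add: bracket_def)
    qed
    also have "\<dots> \<le> ?N"
      unfolding weighted_diff_norm_def
      by (intro cSUP_upper weighted_diff_norm_mono(1)[OF assms]) auto
    finally have "cmod (nth_deriv l f x) * bracket (real l/2 + a/2) x \<le> ?N"
      by (simp add: poly_weight_bracket mult.assoc bracket_mult)
    then have "cmod (nth_deriv l f x) * bracket (real l/2 + a/2) x * bracket (-a/2 - real l/2) x
      \<le> ?N * bracket (-a/2 - real l/2) x"
      by (intro mult_right_mono) auto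
    then show ?thesis
      by (simp add: mult.assoc bracket_mult)
  qed
  have cd: "times_cont_differentiable m f"
    using f by (simp add: weighted_diff_space_def)
  have der: "(nth_deriv l f has_vector_derivative nth_deriv (Suc l) f x) (at x)" if "l < m" for l x
    using cd that unfolding nth_deriv_Suc times_cont_differentiable_def
    by (simp add: vector_derivative_works[symmetric])
  have cont: "continuous_on UNIV (nth_deriv l f)" if "l \<le> m" for l
  proof (cases "l < m")
    case True
    then show ?thesis
      using der has_vector_derivative_continuous by (blast intro: continuous_at_imp_continuous_on)
  next
    case False
    then show ?thesis
      using that cd by (simp add: times_cont_differentiable_def)
  qed
  have "l + i = j \<Longrightarrow> symbol_bound i UNIV (nth_deriv l f) (\<lambda>x. ?N * bracket (-a/2 - real l/2) x) (bracket (-1/2))" for l i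
  proof (induction i arbitrary: l)
    case 0
    then show ?case
      using le cont j by auto
  next
    case (Suc i)
    have "symbol_bound i UNIV (nth_deriv (Suc l) f) (\<lambda>x. ?N * bracket (-a/2 - real (Suc l)/2) x) (bracket (-1/2))"
      by (rule Suc.IH) (use Suc.prems in auto)
    moreover have "?N * bracket (-a/2 - real (Suc l)/2) x = ?N * bracket (-a/2 - real l/2) x * bracket (-1/2) x" for x
    proof -
      have e: "-a/2 - real (Suc l)/2 = -a/2 - real l/2 + -1/2"
        by (simp add: field_simps)
      show ?thesis
        unfolding mult.assoc bracket_mult e ..
    qed
    ultimately have "symbol_bound i UNIV (nth_deriv (Suc l) f)
        (\<lambda>x. ?N * bracket (-a/2 - real l/2) x * bracket (-1/2) x) (bracket (-1/2))"
      by (simp only:)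
    then show ?case
      using le[of l] der[of l] Suc.prems j unfolding symbol_bound.simps(2)
      by (intro conjI exI[of _ "nth_deriv (Suc l) f"]) auto
  qed
  from this[of 0 j] show ?thesis
    by (simp add: nth_deriv_def)
qed

section \<open>Repeated integration by parts\<close>

lemma isCont_oscillation:
  assumes "\<And>x. (\<phi> has_real_derivative g x) (at x)"
  shows "continuous_on UNIV (\<lambda>x. cis (- 2 * pi * \<phi> x))"
  using DERIV_isCont[OF assms] by (intro continuous_intros continuous_at_imp_continuous_on) auto

lemma oscillatory_integration_by_parts:
  fixes \<phi> g :: "real \<Rightarrow> real" and q q' h :: "real \<Rightarrow> complex"
  assumes \<phi>: "\<And>x. (\<phi> has_real_derivative g x) (at x)" and "continuous_on UNIV g"
    and q: "\<And>x. (q has_vector_derivative q' x) (at x)" and h: "\<And>x. h x = q x * of_real (g x)"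
    and "continuous_on UNIV q'" "integrable lborel q'" "integrable lborel h"
    and lim: "(q \<longlongrightarrow> 0) at_top" "(q \<longlongrightarrow> 0) at_bot"
  shows "(LBINT x. q' x * cis (- 2 * pi * \<phi> x)) = 2 * pi * \<i> * (LBINT x. h x * cis (- 2 * pi * \<phi> x))"
proof -
  let ?E = "\<lambda>x. cis (- 2 * pi * \<phi> x)"
  note cE = isCont_oscillation[OF \<phi>]
  have cq: "continuous_on UNIV q"
    using q has_vector_derivative_continuous by (blast intro: continuous_at_imp_continuous_on)
  have ch: "continuous_on UNIV h"
    unfolding h using cq assms(2) by (intro continuous_intros)
  have bounded: "integrable lborel (\<lambda>x. p x * ?E x)" if "integrable lborel p" for p :: "real \<Rightarrow> complex"
  proof (rule Bochner_Integration.integrable_bound[OF that])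
    show "(\<lambda>x. p x * ?E x) \<in> borel_measurable lborel"
      using borel_measurable_integrable[OF that] borel_measurable_continuous_onI[OF cE]
      by (intro borel_measurable_times) simp_all
  qed (auto simp: norm_mult)
  have der: "((\<lambda>x. q x * ?E x) has_vector_derivative (q' x * ?E x - 2 * pi * \<i> * (h x * ?E x))) (at x)" for x
  proof -
    have "((\<lambda>x. - 2 * pi * \<phi> x) has_derivative (\<lambda>t. t * (- 2 * pi * g x))) (at x)"
      using \<phi>[of x] by (auto intro!: derivative_eq_intros simp: has_field_derivative_def mult_ac)
    then have "(?E has_derivative (\<lambda>t. (t * (- 2 * pi * g x)) *\<^sub>R (\<i> * ?E x))) (at x)"
      by (rule has_derivative_cis)
    then have "(?E has_vector_derivative (- 2 * pi * g x) *\<^sub>R (\<i> * ?E x)) (at x)"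
      by (simp add: has_vector_derivative_def)
    from has_vector_derivative_mult[OF q this] show ?thesis
      by (simp add: h scaleR_conv_of_real algebra_simps)
  qed
  have int: "integrable lborel (\<lambda>x. q' x * ?E x - 2 * pi * \<i> * (h x * ?E x))"
    using bounded[OF assms(6)] bounded[OF assms(7)] by (intro Bochner_Integration.integrable_diff integrable_mult_right)
  have limE: "((\<lambda>x. q x * ?E x) \<longlongrightarrow> 0) F" if "(q \<longlongrightarrow> 0) F" for F
    using that by (rule tendsto_0_le[where K=1]) (auto simp: norm_mult)
  have "(LBINT x=-\<infinity>..\<infinity>. q' x * ?E x - 2 * pi * \<i> * (h x * ?E x)) = 0 - 0"
  proof (rule interval_integral_FTC_integrable)
    show "isCont (\<lambda>x. q' x * ?E x - 2 * pi * \<i> * (h x * ?E x)) x" for x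
    proof -
      have "continuous_on UNIV (\<lambda>x. q' x * ?E x - 2 * pi * \<i> * (h x * ?E x))"
        by (intro continuous_intros cE ch assms(5))
      then show ?thesis
        by (simp add: continuous_on_eq_continuous_at)
    qed
    show "(((\<lambda>x. q x * ?E x) \<circ> real_of_ereal) \<longlongrightarrow> 0) (at_right (-\<infinity>))"
      "(((\<lambda>x. q x * ?E x) \<circ> real_of_ereal) \<longlongrightarrow> 0) (at_left \<infinity>)"
      unfolding ereal_tendsto_simps1 by (intro limE lim)+
  qed (use der int in \<open>auto simp: set_integrable_def\<close>)
  then have "(LBINT x. q' x * ?E x - 2 * pi * \<i> * (h x * ?E x)) = 0"
    by (simp add: interval_lebesgue_integral_le_eq set_lebesgue_integral_def)
  moreover have "(LBINT x. q' x * ?E x - 2 * pi * \<i> * (h x * ?E x)) =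
      (LBINT x. q' x * ?E x) - 2 * pi * \<i> * (LBINT x. h x * ?E x)"
    using bounded[OF assms(6)] bounded[OF assms(7)] by (subst Bochner_Integration.integral_diff) auto
  ultimately show ?thesis
    by simp
qed

primrec parts_const :: "real \<Rightarrow> nat \<Rightarrow> real" where
  "parts_const K 0 = 1"
| "parts_const K (Suc n) = parts_const K n * (2 ^ Suc n * inverse_const K (Suc n))"

lemma parts_const_pos: "0 < parts_const K n"
proof (induction n)
  case (Suc n)
  moreover have "0 < inverse_const K (Suc n)"
    using inverse_const_ge_1[of K "Suc n"] by linarith
  ultimately show ?case
    by (simp del: inverse_const.simps)
qed auto

proposition oscillatory_integral_bound:
  fixes \<phi> g :: "real \<Rightarrow> real"
  assumes \<phi>: "\<And>x. (\<phi> has_real_derivative g x) (at x)" and g: "continuous_on UNIV g"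
    and UV: "open U" "open V" "U \<union> V = UNIV"
    and gU: "\<And>x. x \<in> U \<Longrightarrow> g x \<noteq> 0" "symbol_bound n U (\<lambda>x. of_real (g x)) (\<lambda>x. K * \<bar>g x\<bar>) R"
    and h: "symbol_bound n UNIV h B R" and BV: "\<And>x. x \<in> V \<Longrightarrow> B x = 0"
    and dec: "0 < \<epsilon>" "\<And>x. x \<notin> V \<Longrightarrow> \<epsilon> * bracket (-\<alpha>/2) x \<le> \<bar>g x\<bar>"
      "\<And>x. B x \<le> A * bracket (-a/2) x" "\<And>x. 0 \<le> R x" "\<And>x. R x \<le> \<rho> * bracket (-1/2) x"
    and a: "1 < a" "1 \<le> \<alpha>" "(\<alpha> - 1) * n < a - 1"
    and meas: "B \<in> borel_measurable borel" "R \<in> borel_measurable borel"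
  shows "integrable lborel (\<lambda>x. B x * R x ^ n / \<bar>g x\<bar> ^ n) \<and>
    cmod (LBINT x. h x * cis (- 2 * pi * \<phi> x)) \<le>
      parts_const K n * (LBINT x. B x * R x ^ n / \<bar>g x\<bar> ^ n)"
  using gU(2) h BV dec(3) a(1,3) meas(1)
proof (induction n arbitrary: h B A a)
  case 0
  have B0: "0 \<le> B x" for x
    using symbol_bound_nonneg[OF "0.prems"(2)] by simp
  have hB: "cmod (h x) \<le> B x" for x
    using symbol_bound_le[OF "0.prems"(2)] by simp
  have int: "integrable lborel B"
  proof (rule Bochner_Integration.integrable_bound)
    show "integrable lborel (\<lambda>x. A * bracket (-a/2) x)"
      using "0.prems"(5) by (intro integrable_mult_right bracket_integrable) auto
    show "AE x in lborel. norm (B x) \<le> norm (A * bracket (-a/2) x)"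
      using B0 "0.prems"(4) by (auto intro!: order_trans[OF _ abs_ge_self])
  qed (use "0.prems"(7) in auto)
  have "cmod (LBINT x. h x * cis (- 2 * pi * \<phi> x)) \<le> (LBINT x. cmod (h x * cis (- 2 * pi * \<phi> x)))"
    by (rule integral_norm_bound)
  also have "\<dots> \<le> (LBINT x. B x)"
    by (rule integral_mono_AE') (use int hB B0 in \<open>auto simp: norm_mult\<close>)
  finally show ?case
    using int by simp
next
  case (Suc n)
  note prems = Suc.prems
  let ?h = "\<lambda>x. h x / of_real (g x)"
  define c where "c = 2 ^ Suc n * inverse_const K (Suc n)"
  have c0: "0 < c"
    using inverse_const_ge_1[of K "Suc n"] by (simp add: c_def del: inverse_const.simps)
  have B0: "0 \<le> B x" for x
    using symbol_bound_nonneg[OF prems(2)] by simp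
  have A0: "0 \<le> A"
    using B0[of 0] prems(4)[of 0] by (simp add: bracket_def)
  have \<rho>0: "0 \<le> \<rho>"
    using dec(4)[of 0] dec(5)[of 0] by (simp add: bracket_def)
  have hB: "cmod (h x) \<le> B x" for x
    using symbol_bound_le[OF prems(2)] by simp
  have hV: "h x = 0" if "x \<in> V" for x
    using hB[of x] prems(3)[OF that] by simp
  have "symbol_bound (Suc n) U (\<lambda>x. h x * inverse (of_real (g x)))
      (\<lambda>x. 2 ^ Suc n * (B x * (inverse_const K (Suc n) / cmod (of_real (g x))))) R"
  proof (rule symbol_bound_mult)
    show "symbol_bound (Suc n) U h B R"
      by (rule symbol_bound_mono[OF prems(2)]) (auto simp: dec(4))
    show "symbol_bound (Suc n) U (\<lambda>x. inverse (complex_of_real (g x)))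
       (\<lambda>x. inverse_const K (Suc n) / cmod (complex_of_real (g x))) R"
      by (rule symbol_bound_inverse) (use prems(1) gU(1) dec(4) in \<open>auto simp del: symbol_bound.simps\<close>)
  qed
  then have qU: "symbol_bound (Suc n) U ?h (\<lambda>x. c * (B x / \<bar>g x\<bar>)) R"
    by (simp add: c_def divide_inverse mult_ac del: symbol_bound.simps inverse_const.simps power_Suc)
  have qV: "symbol_bound (Suc n) V ?h (\<lambda>x. 0) (\<lambda>x. 0)"
    by (rule symbol_bound_cong[OF symbol_bound_const[of V 0]]) (auto simp: hV UV)
  have q: "symbol_bound (Suc n) UNIV ?h (\<lambda>x. c * (B x / \<bar>g x\<bar>)) R"
    by (rule symbol_bound_mono[OF symbol_bound_glue[OF qU qV UV(1,2)]])
      (use UV(3) dec(4) prems(3) in auto)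
  then obtain q' where q': "\<And>x. (?h has_vector_derivative q' x) (at x)"
    "symbol_bound n UNIV q' (\<lambda>x. c * (B x / \<bar>g x\<bar>) * R x) R"
    by auto
  define B' where "B' x = c * (B x / \<bar>g x\<bar>) * R x" for x
  have Bg: "B x / \<bar>g x\<bar> \<le> A / \<epsilon> * bracket (-(a - \<alpha>)/2) x" for x
  proof (cases "x \<in> V")
    case True
    then show ?thesis
      using prems(3)[OF True] A0 dec(1) by simp
  next
    case False
    have "B x / \<bar>g x\<bar> \<le> A * bracket (-a/2) x / (\<epsilon> * bracket (-\<alpha>/2) x)"
      by (rule frac_le) (use A0 prems(4) dec(1) dec(2)[OF False] in auto)
    also have "\<dots> = A / \<epsilon> * (bracket (-a/2) x / bracket (-\<alpha>/2) x)"
      by simp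
    also have "\<dots> = A / \<epsilon> * bracket (-(a - \<alpha>)/2) x"
      unfolding bracket_divide by (simp add: field_simps)
    finally show ?thesis .
  qed
  have B'le: "B' x \<le> c * (A / \<epsilon>) * \<rho> * bracket (-(a + 1 - \<alpha>)/2) x" for x
  proof -
    have "B' x \<le> c * (A / \<epsilon> * bracket (-(a - \<alpha>)/2) x) * (\<rho> * bracket (-1/2) x)"
      unfolding B'_def using c0 A0 dec(1,4,5) Bg B0 by (intro mult_mono mult_left_mono) auto
    also have "\<dots> = c * (A / \<epsilon>) * \<rho> * bracket (-(a - \<alpha>)/2 + -1/2) x"
      unfolding bracket_mult[symmetric] by simp
    also have "-(a - \<alpha>)/2 + -1/2 = -(a + 1 - \<alpha>)/2"
      by (simp add: field_simps)
    finally show ?thesis .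
  qed
  have "0 \<le> (\<alpha> - 1) * n"
    using a by simp
  then have aa: "1 < a + 1 - \<alpha>" "(\<alpha> - 1) * n < a + 1 - \<alpha> - 1" "a - \<alpha> > 0"
    using prems(6) by (auto simp: algebra_simps)
  have gm: "g \<in> borel_measurable borel"
    by (rule borel_measurable_continuous_onI[OF g])
  have B'm: "B' \<in> borel_measurable borel"
    unfolding B'_def using prems(7) meas(2) gm by measurable
  have B'V: "B' x = 0" if "x \<in> V" for x
    using prems(3)[OF that] by (simp add: B'_def)
  have IH: "integrable lborel (\<lambda>x. B' x * R x ^ n / \<bar>g x\<bar> ^ n)"
    "cmod (LBINT x. q' x * cis (- 2 * pi * \<phi> x)) \<le> parts_const K n * (LBINT x. B' x * R x ^ n / \<bar>g x\<bar> ^ n)"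
    using Suc.IH[OF symbol_bound_SucD[OF prems(1)] q'(2)[folded B'_def] B'V B'le aa(1,2) B'm] by auto
  have eq: "B' x * R x ^ n / \<bar>g x\<bar> ^ n = c * (B x * R x ^ Suc n / \<bar>g x\<bar> ^ Suc n)" for x
    by (simp add: B'_def)
  have I: "(LBINT x. B' x * R x ^ n / \<bar>g x\<bar> ^ n) = c * (LBINT x. B x * R x ^ Suc n / \<bar>g x\<bar> ^ Suc n)"
    unfolding eq by (rule integral_mult_right_zero)
  have "integrable lborel (\<lambda>x. (1 / c) * (B' x * R x ^ n / \<bar>g x\<bar> ^ n))"
    by (rule integrable_mult_right[OF IH(1)])
  then have int: "integrable lborel (\<lambda>x. B x * R x ^ Suc n / \<bar>g x\<bar> ^ Suc n)"
    unfolding eq using c0 by simp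
    have q'B: "cmod (q' x) \<le> B' x" for x
      using symbol_bound_le[OF q'(2)] by (simp add: B'_def)
    have hq: "h x = ?h x * of_real (g x)" for x
      using hV[of x] gU(1)[of x] UV(3) by auto
    have lim: "(?h \<longlongrightarrow> 0) F" if "(bracket (-(a - \<alpha>)/2) \<longlongrightarrow> 0) F" for F
    proof (rule tendsto_0_le[OF that, where K="c * (A / \<epsilon>)"], rule always_eventually, rule allI)
      fix x
      have "cmod (?h x) \<le> c * (B x / \<bar>g x\<bar>)"
        using symbol_bound_le[OF q] by simp
      also have "\<dots> \<le> c * (A / \<epsilon> * bracket (-(a - \<alpha>)/2) x)"
        using c0 Bg by (intro mult_left_mono) auto
      finally show "cmod (?h x) \<le> norm (bracket (-(a - \<alpha>)/2) x) * (c * (A / \<epsilon>))"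
        by (simp add: mult_ac)
    qed
    have "(LBINT x. q' x * cis (- 2 * pi * \<phi> x)) = 2 * pi * \<i> * (LBINT x. h x * cis (- 2 * pi * \<phi> x))"
    proof (intro oscillatory_integration_by_parts[OF \<phi> g q'(1) hq])
      show "integrable lborel h"
        by (rule integrable_bracket_bound[OF symbol_bound_continuous_on[OF prems(2)] order_trans[OF hB prems(4)]])
          (use prems(5) in simp)
      show "integrable lborel q'"
        by (rule integrable_bracket_bound[OF symbol_bound_continuous_on[OF q'(2)] order_trans[OF q'B B'le]]) (use aa in simp)
      show "continuous_on UNIV q'"
        by (rule symbol_bound_continuous_on[OF q'(2)])
      show "(?h \<longlongrightarrow> 0) at_top" "(?h \<longlongrightarrow> 0) at_bot"
        using aa(3) by (intro lim bracket_tendsto_0; simp)+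
    qed
    then have "cmod (LBINT x. q' x * cis (- 2 * pi * \<phi> x)) = 2 * pi * cmod (LBINT x. h x * cis (- 2 * pi * \<phi> x))"
      by (simp add: norm_mult)
    moreover have "1 * cmod (LBINT x. h x * cis (- 2 * pi * \<phi> x)) \<le> 2 * pi * cmod (LBINT x. h x * cis (- 2 * pi * \<phi> x))"
      using pi_gt3 by (intro mult_right_mono) auto
    ultimately have "cmod (LBINT x. h x * cis (- 2 * pi * \<phi> x)) \<le> parts_const K n * (c * (LBINT x. B x * R x ^ Suc n / \<bar>g x\<bar> ^ Suc n))"
      using IH(2) unfolding I by linarith
    then show ?case
      using int by (simp only: parts_const.simps c_def mult.assoc)
qed

section \<open>Smooth cutoffs and the nonresonant case\<close>

lemma DERIV_max_0_power:
  "((\<lambda>t. max 0 t ^ Suc (Suc n)) has_real_derivative real (Suc (Suc n)) * max 0 t ^ Suc n) (at (t::real))"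
proof -
  consider "t > 0" | "t < 0" | "t = 0" by linarith
  then show ?thesis
  proof cases
    case 1
    have "((\<lambda>t. t ^ Suc (Suc n)) has_real_derivative real (Suc (Suc n)) * t ^ Suc n) (at t)"
      by (rule derivative_eq_intros refl | simp)+
    then have "((\<lambda>t. max 0 t ^ Suc (Suc n)) has_real_derivative real (Suc (Suc n)) * t ^ Suc n) (at t)"
      by (rule has_field_derivative_transform_within_open[where S="{0<..}"]) (use 1 in auto)
    then show ?thesis using 1 by simp
  next
    case 2
    have "((\<lambda>t. 0) has_real_derivative 0) (at t)"
      by simp
    then have "((\<lambda>t. max 0 t ^ Suc (Suc n)) has_real_derivative 0) (at t)"
      by (rule has_field_derivative_transform_within_open[where S="{..<0}"]) (use 2 in auto)
    then show ?thesis using 2 by simp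
  next
    case 3
    show ?thesis
      unfolding CARAT_DERIV
    proof (intro exI[of _ "\<lambda>z. max 0 z ^ Suc n"] conjI allI)
      show "isCont (\<lambda>z. max 0 z ^ Suc n) t"
        by (intro continuous_intros)
    qed (use 3 in \<open>auto simp: max_def\<close>)
  qed
qed

lemma symbol_bound_max_0_power:
  fixes q q' :: "real \<Rightarrow> real"
  assumes "\<And>x. (q has_real_derivative q' x) (at x)" "\<And>x. x \<in> U \<Longrightarrow> \<bar>q x\<bar> \<le> D" "1 \<le> D"
    and "symbol_bound j U (\<lambda>x. of_real (q' x)) (\<lambda>_. D) (\<lambda>_. 1)"
  shows "\<exists>C\<ge>1. symbol_bound j U (\<lambda>x. of_real (max 0 (q x) ^ Suc j)) (\<lambda>_. C) (\<lambda>_. 1)"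
  using assms(4)
proof (induction j)
  case 0
  have "continuous_on U q"
    using DERIV_isCont[OF assms(1)] by (blast intro: continuous_at_imp_continuous_on)
  then have "symbol_bound 0 U (\<lambda>x. of_real (max 0 (q x) ^ Suc 0)) (\<lambda>_. D) (\<lambda>_. 1)"
    using assms(2,3) by (force intro!: continuous_intros)
  then show ?case
    using assms(3) by blast
next
  case (Suc j)
  obtain C where C: "C \<ge> 1" "symbol_bound j U (\<lambda>x. of_real (max 0 (q x) ^ Suc j)) (\<lambda>_. C) (\<lambda>_. 1)"
    using Suc symbol_bound_SucD by blast
  define E where "E = max (D ^ Suc (Suc j)) (real (Suc (Suc j)) * (2 ^ j * (C * D)))"
  have "symbol_bound j U (\<lambda>x. of_real (real (Suc (Suc j))) * (of_real (max 0 (q x) ^ Suc j) * of_real (q' x)))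
     (\<lambda>_. cmod (of_real (real (Suc (Suc j)))) * (2 ^ j * (C * D))) (\<lambda>_. 1)"
    by (intro symbol_bound_cmult symbol_bound_mult C symbol_bound_SucD[OF Suc.prems])
  then have "symbol_bound j U (\<lambda>x. of_real (real (Suc (Suc j))) * (of_real (max 0 (q x) ^ Suc j) * of_real (q' x)))
     (\<lambda>_. E * 1) (\<lambda>_. 1)"
  proof (rule symbol_bound_mono)
    show "cmod (of_real (real (Suc (Suc j)))) * (2 ^ j * (C * D)) \<le> E * 1"
      unfolding E_def by (simp only: norm_of_real abs_of_nat mult_1_right max.cobounded2)
  qed auto
  moreover have "((\<lambda>x. complex_of_real (max 0 (q x) ^ Suc (Suc j))) has_vector_derivative
      of_real (real (Suc (Suc j))) * (of_real (max 0 (q x) ^ Suc j) * of_real (q' x))) (at x)" for x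
    using has_vector_derivative_of_real[OF DERIV_chain2[OF DERIV_max_0_power assms(1)]]
    by (simp add: mult.assoc del: power_Suc)
  moreover have "cmod (of_real (max 0 (q x) ^ Suc (Suc j))) \<le> E" if "x \<in> U" for x
  proof -
    have "cmod (of_real (max 0 (q x) ^ Suc (Suc j))) = max 0 (q x) ^ Suc (Suc j)"
      by (simp only: norm_of_real) simp
    also have "\<dots> \<le> D ^ Suc (Suc j)"
      using assms(2)[OF that] assms(3) by (intro power_mono) auto
    finally show ?thesis
      by (simp add: E_def)
  qed
  moreover have "1 \<le> E"
    using one_le_power[OF assms(3), of "Suc (Suc j)"] by (simp add: E_def del: power_Suc)
  ultimately show ?case
    unfolding symbol_bound.simps(2)
    by (intro exI[of _ E] conjI ballI
        exI[of _ "\<lambda>x. of_real (real (Suc (Suc j))) * (of_real (max 0 (q x) ^ Suc j) * of_real (q' x))"]) auto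
qed

lemma exists_cutoff:
  "\<exists>C\<ge>1. \<exists>\<beta>. (\<forall>u. 1 \<le> \<bar>u\<bar> \<longrightarrow> \<beta> u = 1) \<and>
     symbol_bound m UNIV \<beta> (\<lambda>u. if \<bar>u\<bar> < 1/2 then 0 else C) (\<lambda>u. if \<bar>u\<bar> \<le> 1 then 1 else 0)"
proof -
  define s :: "real \<Rightarrow> real" where "s u = (4 * u\<^sup>2 - 1) / 3" for u
  let ?U = "{-2<..<2::real}"
  have bounds: "-6 \<le> s u" "s u \<le> 5" if "u \<in> ?U" for u
  proof -
    have "u\<^sup>2 < 2\<^sup>2"
      using that by (intro power2_strict_mono) auto
    then show "-6 \<le> s u" "s u \<le> 5"
      unfolding s_def by auto
  qed
  have id: "symbol_bound n ?U of_real (\<lambda>_. 2) (\<lambda>_. 1)" for n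
  proof (cases n)
    case (Suc k)
    have "symbol_bound k ?U (\<lambda>x. 1) (\<lambda>_. 2 * 1) (\<lambda>_. 1)"
      by (rule symbol_bound_const) auto
    moreover have "(of_real has_vector_derivative (1::complex)) (at x)" for x
      using has_vector_derivative_of_real[OF DERIV_ident[of "at x"]] by simp
    ultimately show ?thesis
      unfolding Suc symbol_bound.simps(2) by (intro conjI exI[of _ "\<lambda>x. 1"]) auto
  qed (auto intro!: continuous_intros)
  have lin: "symbol_bound n ?U (\<lambda>x. of_real (c * x)) (\<lambda>_. 6) (\<lambda>_. 1)" if "\<bar>c\<bar> \<le> 3" for n c
    using symbol_bound_mono[OF symbol_bound_cmult[OF id, of n "of_real c"], where B'="\<lambda>_. 6"] that by auto
  have "\<exists>C\<ge>1. symbol_bound m ?U (\<lambda>x. of_real (max 0 (s x) ^ Suc m)) (\<lambda>_. C) (\<lambda>_. 1)"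
  proof (rule symbol_bound_max_0_power)
    show "(s has_real_derivative 8/3 * x) (at x)" for x
      unfolding s_def[abs_def] by (auto intro!: derivative_eq_intros)
    show "\<bar>s x\<bar> \<le> 6" if "x \<in> ?U" for x
      using bounds[OF that] by linarith
    show "symbol_bound m ?U (\<lambda>x. of_real (8/3 * x)) (\<lambda>_. 6) (\<lambda>_. 1)"
      by (rule lin) simp
  qed auto
  then obtain C1 where C1: "C1 \<ge> 1" "symbol_bound m ?U (\<lambda>x. of_real (max 0 (s x) ^ Suc m)) (\<lambda>_. C1) (\<lambda>_. 1)"
    by blast
  have "\<exists>C\<ge>1. symbol_bound m ?U (\<lambda>x. of_real (max 0 (1 - s x) ^ Suc m)) (\<lambda>_. C) (\<lambda>_. 1)"
  proof (rule symbol_bound_max_0_power)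
    show "((\<lambda>x. 1 - s x) has_real_derivative (-8/3) * x) (at x)" for x
      unfolding s_def[abs_def] by (auto intro!: derivative_eq_intros)
    show "\<bar>1 - s x\<bar> \<le> 7" if "x \<in> ?U" for x
      using bounds[OF that] by linarith
    show "symbol_bound m ?U (\<lambda>x. of_real ((-8/3) * x)) (\<lambda>_. 7) (\<lambda>_. 1)"
      by (rule symbol_bound_mono[OF lin]) auto
  qed auto
  then obtain C2 where C2: "C2 \<ge> 1" "symbol_bound m ?U (\<lambda>x. of_real (max 0 (1 - s x) ^ Suc m)) (\<lambda>_. C2) (\<lambda>_. 1)"
    by blast
  define d where "d x = max 0 (s x) ^ Suc m + max 0 (1 - s x) ^ Suc m" for x
  have d: "(1/2) ^ Suc m \<le> d x" for x
  proof (cases "s x \<ge> 1/2")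
    case True
    then have "(1/2) ^ Suc m \<le> max 0 (s x) ^ Suc m"
      by (intro power_mono) auto
    moreover have "0 \<le> max 0 (1 - s x) ^ Suc m"
      by (rule zero_le_power) simp
    ultimately show ?thesis
      unfolding d_def by linarith
  next
    case False
    then have "(1/2) ^ Suc m \<le> max 0 (1 - s x) ^ Suc m"
      by (intro power_mono) auto
    moreover have "0 \<le> max 0 (s x) ^ Suc m"
      by (rule zero_le_power) simp
    ultimately show ?thesis
      unfolding d_def by linarith
  qed
  have d0: "0 < d x" for x
    using d[of x] by (smt (verit) zero_less_power half_gt_zero)
  define K where "K = (C1 + C2) * 2 ^ Suc m"
  have "symbol_bound m ?U (\<lambda>x. of_real (max 0 (s x) ^ Suc m) + of_real (max 0 (1 - s x) ^ Suc m)) (\<lambda>_. C1 + C2) (\<lambda>_. 1)"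
    by (rule symbol_bound_add[OF C1(2) C2(2)])
  then have "symbol_bound m ?U (\<lambda>x. of_real (d x)) (\<lambda>_. C1 + C2) (\<lambda>_. 1)"
    by (simp add: d_def)
  then have "symbol_bound m ?U (\<lambda>x. of_real (d x)) (\<lambda>x. K * cmod (of_real (d x))) (\<lambda>_. 1)"
  proof (rule symbol_bound_mono)
    fix x
    have "(C1 + C2) = K * (1/2) ^ Suc m"
      by (simp add: K_def power_divide)
    also have "\<dots> \<le> K * d x"
      using C1 C2 d by (intro mult_left_mono) (auto simp: K_def)
    finally show "(C1 + C2) \<le> K * cmod (of_real (d x))"
      using d0[of x] by simp
  qed auto
  then have "symbol_bound m ?U (\<lambda>x. inverse (of_real (d x)))
      (\<lambda>x. inverse_const K m / cmod (of_real (d x))) (\<lambda>_. 1)"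
    by (rule symbol_bound_inverse) (use d0 in \<open>auto simp: less_imp_neq[symmetric]\<close>)
  then have inv: "symbol_bound m ?U (\<lambda>x. inverse (of_real (d x))) (\<lambda>x. inverse_const K m * 2 ^ Suc m) (\<lambda>_. 1)"
  proof (rule symbol_bound_mono)
    fix x
    have "inverse_const K m / d x \<le> inverse_const K m / (1/2) ^ Suc m"
      using inverse_const_ge_1[of K m] d0 d by (intro divide_left_mono mult_pos_pos) auto
    then show "inverse_const K m / cmod (of_real (d x)) \<le> inverse_const K m * 2 ^ Suc m"
      using d0[of x] by (simp add: power_divide)
  qed auto
  define \<beta> :: "real \<Rightarrow> complex" where "\<beta> x = of_real (max 0 (s x) ^ Suc m) * inverse (of_real (d x))" for x
  define C where "C = max 1 (2 ^ m * (C1 * (inverse_const K m * 2 ^ Suc m)))"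
  have \<beta>1: "\<beta> u = 1" if "1 \<le> \<bar>u\<bar>" for u
  proof -
    have "1 \<le> u\<^sup>2"
      using that power_mono[of 1 "\<bar>u\<bar>" 2] by simp
    then have "s u \<ge> 1"
      by (simp add: s_def)
    then have "max 0 (s u) ^ Suc m = d u"
      by (simp add: d_def)
    then show ?thesis
      using d0[of u] by (simp add: \<beta>_def del: power_Suc)
  qed
  have \<beta>0: "\<beta> u = 0" if "\<bar>u\<bar> < 1/2" for u
  proof -
    have "u\<^sup>2 < (1/2)\<^sup>2"
      using that by (intro power2_strict_mono) auto
    then have "s u \<le> 0" by (simp add: s_def power2_eq_square)
    then show ?thesis
      by (simp add: \<beta>_def)
  qed
  let ?V = "{u::real. 1 < \<bar>u\<bar>}" and ?W = "{u::real. \<bar>u\<bar> < 1/2}"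
  have op: "open ?V" "open ?W"
    by (intro open_Collect_less continuous_intros)+
  have SU: "symbol_bound m ?U \<beta> (\<lambda>_. C) (\<lambda>_. 1)"
    unfolding \<beta>_def by (rule symbol_bound_mono[OF symbol_bound_mult[OF C1(2) inv]]) (auto simp: C_def)
  have SV: "symbol_bound m ?V \<beta> (\<lambda>_. 1) (\<lambda>_. 0)"
    by (rule symbol_bound_cong[OF symbol_bound_const[of ?V 1] op(1)]) (auto simp: \<beta>1)
  have SW: "symbol_bound m ?W \<beta> (\<lambda>_. 0) (\<lambda>_. 0)"
    by (rule symbol_bound_cong[OF symbol_bound_const[of ?W 0] op(2)]) (auto simp: \<beta>0)
  have "symbol_bound m UNIV \<beta> (\<lambda>u. if \<bar>u\<bar> < 1/2 then 0 else C) (\<lambda>u. if \<bar>u\<bar> \<le> 1 then 1 else 0)"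
    by (rule symbol_bound_mono[OF symbol_bound_glue[OF symbol_bound_glue[OF SU SV _ op(1)] SW _ op(2)]])
      (auto simp: C_def op)
  then show ?thesis
    using \<beta>1 by (intro exI[of _ C] exI[of _ \<beta>] conjI) (auto simp: C_def)
qed

lemma symbol_bound_two_point_cutoff:
  assumes "symbol_bound m UNIV \<beta> (\<lambda>u. if \<bar>u\<bar> < 1/2 then 0 else C) (\<lambda>u. if \<bar>u\<bar> \<le> 1 then 1 else 0)"
    and "0 < T" "0 \<le> x0" "1 \<le> C"
  shows "symbol_bound m UNIV (\<lambda>x. \<beta> ((x - x0) / T) * \<beta> ((x + x0) / T))
     (\<lambda>x. if \<bar>\<bar>x\<bar> - x0\<bar> < T / 2 then 0 else 2 ^ m * (C * C)) (\<lambda>x. if \<bar>\<bar>x\<bar> - x0\<bar> \<le> T then 1 / T else 0)"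
proof -
  let ?r = "\<lambda>x. if \<bar>\<bar>x\<bar> - x0\<bar> \<le> T then 1 / T else 0"
  let ?B = "\<lambda>u. if \<bar>u\<bar> < 1/2 then 0 else C"
  have *: "symbol_bound m UNIV (\<lambda>x. \<beta> ((x - c) / T)) (\<lambda>x. ?B ((x - c) / T)) ?r" if "\<bar>c\<bar> = x0" for c
  proof (rule symbol_bound_mono[OF symbol_bound_affine[OF assms(1,2), of c]])
    fix x
    have "\<bar>\<bar>x\<bar> - x0\<bar> \<le> \<bar>x - c\<bar>"
      using that by linarith
    then show "(if \<bar>(x - c) / T\<bar> \<le> 1 then 1 else 0) / T \<le> ?r x"
      using assms(2) by (auto simp: abs_div)
  qed (use assms in auto)
  have "symbol_bound m UNIV (\<lambda>x. \<beta> ((x - x0) / T) * \<beta> ((x + x0) / T))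
     (\<lambda>x. 2 ^ m * (?B ((x - x0) / T) * ?B ((x + x0) / T))) ?r"
    using assms(3) by (intro symbol_bound_mult *[of x0] *[of "-x0", unfolded diff_minus_eq_add]) auto
  then show ?thesis
  proof (rule symbol_bound_mono)
    fix x
    have "\<bar>x - x0\<bar> < T / 2 \<or> \<bar>x + x0\<bar> < T / 2" if "\<bar>\<bar>x\<bar> - x0\<bar> < T / 2"
      using that by linarith
    then show "2 ^ m * (?B ((x - x0) / T) * ?B ((x + x0) / T)) \<le> (if \<bar>\<bar>x\<bar> - x0\<bar> < T / 2 then 0 else 2 ^ m * (C * C))"
      using assms by (auto simp: abs_div field_simps)
  qed (use assms in auto)
qed

lemma phase_deriv:
  "\<alpha> > 1 \<Longrightarrow> ((\<lambda>x. x * \<xi> + k * poly_cdf \<alpha> x) has_real_derivative \<xi> + k * poly_density \<alpha> x) (at x)"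
  by (auto intro!: derivative_eq_intros poly_cdf_deriv)

lemma continuous_poly_density: "continuous_on S (poly_density \<alpha>)"
  using isCont_poly_density by (blast intro: continuous_at_imp_continuous_on)

lemma nonresonant_bound:
  assumes "\<alpha> > 1"
  shows "\<exists>C>0. \<forall>a \<xi> (k::real) f N.
    1 < a \<longrightarrow> (\<alpha> - 1) * m < a - 1 \<longrightarrow> k \<noteq> 0 \<longrightarrow>
    symbol_bound m UNIV f (\<lambda>x. N * bracket (-a/2) x) (bracket (-1/2)) \<longrightarrow>
    (\<forall>x. \<bar>k\<bar> * poly_density \<alpha> x \<le> \<bar>\<xi> + k * poly_density \<alpha> x\<bar>) \<longrightarrow>
    cmod (LBINT x. f x * cis (- 2 * pi * (x * \<xi> + k * poly_cdf \<alpha> x))) \<le>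
      C * (N * (LBINT x. 1 / ((1 + x\<^sup>2) powr ((a + real m) / 2) * \<bar>\<xi> + k * poly_density \<alpha> x\<bar> ^ m)))"
proof -
  obtain K where K: "K \<ge> 1" "\<And>\<xi> (k::real) U \<kappa> R.
    \<forall>x\<in>U. \<bar>k\<bar> * poly_density \<alpha> x \<le> \<kappa> x * \<bar>\<xi> + k * poly_density \<alpha> x\<bar> \<Longrightarrow>
    \<forall>x\<in>U. 1 \<le> \<kappa> x \<and> \<kappa> x * bracket (-1/2) x \<le> R x \<Longrightarrow>
    symbol_bound m U (\<lambda>x. of_real (\<xi> + k * poly_density \<alpha> x))
      (\<lambda>x. K * \<bar>\<xi> + k * poly_density \<alpha> x\<bar>) R"
    using symbol_bound_phase[OF assms, of m] by blast
  show ?thesis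
  proof (intro exI[of _ "parts_const K m"] conjI parts_const_pos allI impI)
    fix a \<xi> k :: real and f N
    let ?g = "\<lambda>x. \<xi> + k * poly_density \<alpha> x"
    assume a: "1 < a" "(\<alpha> - 1) * m < a - 1" and k: "k \<noteq> 0"
      and f: "symbol_bound m UNIV f (\<lambda>x. N * bracket (-a/2) x) (bracket (-1/2))"
      and g: "\<forall>x. \<bar>k\<bar> * poly_density \<alpha> x \<le> \<bar>?g x\<bar>"
    have pos: "0 < \<bar>k\<bar> * density_const \<alpha>"
      using density_const_pos[OF assms] k by simp
    have "?g x \<noteq> 0" for x
    proof -
      have "0 < \<bar>k\<bar> * poly_density \<alpha> x"
        using k poly_density_pos[OF assms, of x] by (intro mult_pos_pos) auto
      then show ?thesis
        using g[rule_format, of x] by linarith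
    qed
    moreover have "symbol_bound m UNIV (\<lambda>x. of_real (?g x)) (\<lambda>x. K * \<bar>?g x\<bar>) (bracket (-1/2))"
      using g by (intro K(2)[where \<kappa>="\<lambda>_. 1"]) auto
    moreover have "\<bar>k\<bar> * density_const \<alpha> * bracket (-\<alpha>/2) x \<le> \<bar>?g x\<bar>" for x
      using g[rule_format, of x] by (simp only: poly_density_bracket mult.assoc)
    ultimately have "integrable lborel (\<lambda>x. N * bracket (-a/2) x * bracket (-1/2) x ^ m / \<bar>?g x\<bar> ^ m) \<and>
      cmod (LBINT x. f x * cis (- 2 * pi * (x * \<xi> + k * poly_cdf \<alpha> x))) \<le>
      parts_const K m * (LBINT x. N * bracket (-a/2) x * bracket (-1/2) x ^ m / \<bar>?g x\<bar> ^ m)"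
      by (intro oscillatory_integral_bound[where U=UNIV and V="{}" and A=N and \<rho>=1
            and \<epsilon>="\<bar>k\<bar> * density_const \<alpha>" and \<alpha>=\<alpha> and a=a] phase_deriv)
        (use assms f a pos in \<open>auto intro!: continuous_intros continuous_poly_density simp del: of_real_add of_real_mult\<close>)
    then have "cmod (LBINT x. f x * cis (- 2 * pi * (x * \<xi> + k * poly_cdf \<alpha> x))) \<le>
      parts_const K m * (LBINT x. N * bracket (-a/2) x * bracket (-1/2) x ^ m / \<bar>?g x\<bar> ^ m)"
      by blast
    moreover have "N * bracket (-a/2) x * bracket (-1/2) x ^ m / \<bar>?g x\<bar> ^ m =
        N * (1 / ((1 + x\<^sup>2) powr ((a + real m) / 2) * \<bar>?g x\<bar> ^ m))" for x
    proof -
      have "-a/2 + real m * (-1/2) = -((a + real m) / 2)"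
        by (simp add: field_simps)
      then have "bracket (-a/2) x * bracket (-1/2) x ^ m = bracket (-((a + real m) / 2)) x"
        unfolding bracket_power bracket_mult by (simp only:)
      also have "\<dots> = 1 / (1 + x\<^sup>2) powr ((a + real m) / 2)"
        by (simp only: bracket_def powr_minus_divide)
      finally show ?thesis
        by (simp add: field_simps)
    qed
    ultimately show "cmod (LBINT x. f x * cis (- 2 * pi * (x * \<xi> + k * poly_cdf \<alpha> x))) \<le>
      parts_const K m * (N * (LBINT x. 1 / ((1 + x\<^sup>2) powr ((a + real m) / 2) * \<bar>?g x\<bar> ^ m)))"
      by (simp only: integral_mult_right_zero)
  qed
qed

section \<open>Estimates near the resonance\<close>

lemma power_le_fact_exp:
  assumes "0 \<le> (y::real)"
  shows "y ^ n \<le> fact n * exp y"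
proof -
  have "(\<Sum>k\<in>{n}. y ^ k /\<^sub>R fact k) \<le> (\<Sum>k. y ^ k /\<^sub>R fact k)"
    using assms by (intro sum_le_suminf summable_exp_generic) auto
  then have "y ^ n / fact n \<le> exp y"
    by (simp add: exp_def divide_inverse_commute)
  then show ?thesis
    by (simp add: field_simps)
qed

lemma res_delta_bounds:
  assumes "0 < x0"
  shows "0 < res_delta x0" "res_delta x0 \<le> 1/2" "res_delta x0 \<le> x0 / 4"
  using assms by (auto simp: res_delta_def)

text \<open>With \<open>s = (1 + x\<^sup>2) / (1 + x0\<^sup>2)\<close> the quotient of the two densities is
  \<open>s powr (\<alpha> / 2)\<close>, which is at least as far from 1 as \<open>sqrt s\<close>.\<close>
lemma poly_density_gap:
  assumes \<alpha>: "1 < \<alpha>" and x0: "0 < x0" and t: "0 < t" "t \<le> x0" "t \<le> \<bar>\<bar>x\<bar> - x0\<bar>"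
  shows "poly_density \<alpha> x \<le> 3 * (1 + x0\<^sup>2) / (x0 * t) * \<bar>poly_density \<alpha> x - poly_density \<alpha> x0\<bar>"
proof -
  define s where "s = (1 + x\<^sup>2) / (1 + x0\<^sup>2)"
  define y where "y = x0 * t / (1 + x0\<^sup>2)"
  have pos: "0 < 1 + x\<^sup>2" "0 < 1 + x0\<^sup>2"
    by (rule japanese_pos)+
  have s0: "0 < s"
    using pos by (simp add: s_def)
  have "x0 * t \<le> x0 * x0"
    using x0 t by (intro mult_left_mono) auto
  then have "x0 * t \<le> 1 + x0\<^sup>2"
    by (simp add: power2_eq_square)
  then have y: "0 < y" "y \<le> 1"
    using x0 t pos by (auto simp: y_def)
  have "x0 * t \<le> \<bar>x\<^sup>2 - x0\<^sup>2\<bar>"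
  proof -
    have "x0 * t \<le> (\<bar>x\<bar> + x0) * \<bar>\<bar>x\<bar> - x0\<bar>"
      using x0 t by (intro mult_mono) auto
    also have "\<dots> = \<bar>(\<bar>x\<bar> + x0) * (\<bar>x\<bar> - x0)\<bar>"
      using x0 by (simp add: abs_mult)
    also have "(\<bar>x\<bar> + x0) * (\<bar>x\<bar> - x0) = x\<^sup>2 - x0\<^sup>2"
      by (simp add: algebra_simps power2_eq_square)
    finally show ?thesis .
  qed
  then have "x0 * t / (1 + x0\<^sup>2) \<le> \<bar>x\<^sup>2 - x0\<^sup>2\<bar> / (1 + x0\<^sup>2)"
    using pos by (intro divide_right_mono) auto
  also have "\<dots> = \<bar>s - 1\<bar>"
    using pos by (simp add: s_def abs_div[symmetric] diff_divide_distrib[symmetric] field_simps)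
  finally have ys: "y \<le> \<bar>s - 1\<bar>"
    by (simp add: y_def)
  have "y / 3 \<le> \<bar>1 - s powr (\<alpha> / 2)\<bar>"
  proof (cases "s \<le> 1")
    case True
    have "s powr (\<alpha> / 2) \<le> s powr (1/2)"
      using True s0 \<alpha> by (intro powr_mono') auto
    moreover have "sqrt s \<le> 1 - y / 3"
    proof (rule real_le_lsqrt)
      have "s \<le> 1 - y"
        using ys True by auto
      also have "\<dots> \<le> (1 - y / 3)\<^sup>2"
        using y by (simp add: power2_eq_square algebra_simps)
      finally show "s \<le> (1 - y / 3)\<^sup>2" .
    qed (use y s0 in auto)
    ultimately have "s powr (\<alpha> / 2) \<le> 1 - y / 3"
      using s0 by (simp add: powr_half_sqrt)
    then show ?thesis
      by linarith
  next
    case False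
    have "s powr (1/2) \<le> s powr (\<alpha> / 2)"
      using False \<alpha> by (intro powr_mono) auto
    moreover have "1 + y / 3 \<le> sqrt s"
    proof (rule real_le_rsqrt)
      have "y * y \<le> 1 * y"
        using y by (intro mult_right_mono) auto
      moreover have "(1 + y / 3)\<^sup>2 = 1 + 2 / 3 * y + y * y / 9"
        by (simp add: power2_eq_square algebra_simps)
      ultimately have "(1 + y / 3)\<^sup>2 \<le> 1 + y"
        using y by linarith
      also have "\<dots> \<le> s"
        using ys False by auto
      finally show "(1 + y / 3)\<^sup>2 \<le> s" .
    qed
    ultimately have "1 + y / 3 \<le> s powr (\<alpha> / 2)"
      using s0 by (simp add: powr_half_sqrt)
    then show ?thesis
      by linarith
  qed
  then have "1 \<le> 3 / y * \<bar>1 - s powr (\<alpha> / 2)\<bar>"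
    using y by (simp add: field_simps)
  then have "poly_density \<alpha> x * 1 \<le> poly_density \<alpha> x * (3 / y * \<bar>1 - s powr (\<alpha> / 2)\<bar>)"
    using poly_density_pos[OF \<alpha>, of x] by (intro mult_left_mono) auto
  also have "\<dots> = 3 / y * \<bar>poly_density \<alpha> x - poly_density \<alpha> x * s powr (\<alpha> / 2)\<bar>"
    using poly_density_pos[OF \<alpha>, of x]
    by (simp add: right_diff_distrib[symmetric] abs_mult)
      (metis (no_types, opaque_lifting) mult.right_neutral right_diff_distrib abs_mult abs_of_pos)
  also have "poly_density \<alpha> x * s powr (\<alpha> / 2) = poly_density \<alpha> x0"
    using pos by (simp add: poly_density_def s_def powr_divide powr_minus field_simps)
  also have "3 / y = 3 * (1 + x0\<^sup>2) / (x0 * t)"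
    by (simp add: y_def)
  finally show ?thesis
    by simp
qed

lemma bracket_comparable:
  assumes "0 < x0" "x0 / 2 \<le> \<bar>x\<bar>" "\<bar>x\<bar> \<le> 3 / 2 * x0" "0 \<le> s"
  shows "bracket (- s) x \<le> 4 powr s * bracket (- s) x0" "bracket (- s) x0 \<le> (9/4) powr s * bracket (- s) x"
proof -
  have pos: "0 < 1 + x\<^sup>2" "0 < 1 + x0\<^sup>2"
    by (rule japanese_pos)+
  have "(x0 / 2)\<^sup>2 \<le> \<bar>x\<bar>\<^sup>2" "\<bar>x\<bar>\<^sup>2 \<le> (3 / 2 * x0)\<^sup>2"
    using assms by (intro power_mono; simp)+
  then have le: "1 + x0\<^sup>2 \<le> 4 * (1 + x\<^sup>2)" "1 + x\<^sup>2 \<le> 9 / 4 * (1 + x0\<^sup>2)"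
    by (auto simp: power2_eq_square)
  have "(1 + x0\<^sup>2) powr s \<le> (4 * (1 + x\<^sup>2)) powr s" "(1 + x\<^sup>2) powr s \<le> (9 / 4 * (1 + x0\<^sup>2)) powr s"
    using le pos assms by (intro powr_mono2; simp)+
  then have "(1 + x0\<^sup>2) powr s \<le> 4 powr s * (1 + x\<^sup>2) powr s" "(1 + x\<^sup>2) powr s \<le> (9 / 4) powr s * (1 + x0\<^sup>2) powr s"
    using pos by (simp_all only: powr_mult)
  then show "bracket (- s) x \<le> 4 powr s * bracket (- s) x0" "bracket (- s) x0 \<le> (9/4) powr s * bracket (- s) x"
    using pos by (simp_all add: bracket_def powr_minus field_simps)
qed

lemma poly_density_deriv:
  assumes "1 < \<alpha>"
  shows "(poly_density \<alpha> has_real_derivative - \<alpha> * x * poly_density \<alpha> x / (1 + x\<^sup>2)) (at x)"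
proof -
  have "((\<lambda>x. density_const \<alpha> * bracket (-\<alpha>/2) x) has_real_derivative
      density_const \<alpha> * (2 * (-\<alpha>/2) * x * bracket (-\<alpha>/2 - 1) x)) (at x)"
    by (rule DERIV_cmult[OF bracket_deriv])
  moreover have "bracket (-\<alpha>/2 - 1) x = bracket (-\<alpha>/2) x / (1 + x\<^sup>2)"
    by (simp only: bracket_divide[symmetric] bracket_1)
  ultimately show ?thesis
    by (simp add: poly_density_bracket[abs_def] field_simps)
qed

definition slope :: "real \<Rightarrow> real \<Rightarrow> real" where
  "slope \<alpha> x0 = \<alpha> * x0 * poly_density \<alpha> x0 / (1 + x0\<^sup>2)"

lemma slope_pos: "1 < \<alpha> \<Longrightarrow> 0 < x0 \<Longrightarrow> 0 < slope \<alpha> x0"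
  using japanese_pos[of x0] poly_density_pos[of \<alpha> x0] by (simp add: slope_def)

lemma abs_deriv_poly_density: "1 < \<alpha> \<Longrightarrow> 0 < x0 \<Longrightarrow> \<bar>deriv (poly_density \<alpha>) x0\<bar> = slope \<alpha> x0"
  using DERIV_imp_deriv[OF poly_density_deriv[of \<alpha> x0]] slope_pos[of \<alpha> x0]
    japanese_pos[of x0] poly_density_pos[of \<alpha> x0] by (simp add: slope_def abs_mult)

lemma poly_density_deriv_near:
  assumes "1 < \<alpha>" "0 < x0" "x0 / 2 \<le> \<bar>x\<bar>" "\<bar>x\<bar> \<le> 3 / 2 * x0"
  shows "\<bar>- \<alpha> * x * poly_density \<alpha> x / (1 + x\<^sup>2)\<bar> \<le> 6 * 2 powr \<alpha> * slope \<alpha> x0"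
proof -
  have eq: "4 powr (\<alpha> / 2) = (2::real) powr \<alpha>"
    using powr_powr[of 2 2 "\<alpha>/2"] by simp
  have b1: "bracket (-1) x \<le> 4 * bracket (-1) x0"
    using bracket_comparable(1)[OF assms(2-4), of 1] by simp
  have b2: "bracket (-\<alpha>/2) x \<le> 2 powr \<alpha> * bracket (-\<alpha>/2) x0"
    using bracket_comparable(1)[OF assms(2-4), of "\<alpha>/2"] assms(1) by (simp add: eq)
  have inv: "bracket (-1) z = 1 / (1 + z\<^sup>2)" for z
    using japanese_pos[of z] by (simp add: bracket_def powr_minus inverse_eq_divide)
  have c: "0 < density_const \<alpha>"
    by (rule density_const_pos[OF assms(1)])
  have "\<bar>- \<alpha> * x * poly_density \<alpha> x / (1 + x\<^sup>2)\<bar> = \<alpha> * density_const \<alpha> * (\<bar>x\<bar> * (bracket (-\<alpha>/2) x * bracket (-1) x))"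
    using assms(1) c japanese_pos[of x] by (simp add: abs_mult poly_density_bracket inv)
  also have "\<dots> \<le> \<alpha> * density_const \<alpha> * (3 / 2 * x0 * (2 powr \<alpha> * bracket (-\<alpha>/2) x0 * (4 * bracket (-1) x0)))"
    using assms c b1 b2 by (intro mult_left_mono mult_mono) auto
  also have "\<dots> = 6 * 2 powr \<alpha> * slope \<alpha> x0"
    by (simp add: slope_def poly_density_bracket inv)
  finally show ?thesis .
qed

lemma poly_density_lower_near:
  assumes "1 < \<alpha>" "0 < x0" "\<bar>\<bar>x\<bar> - x0\<bar> \<le> x0 / 2"
  shows "(2/3) powr \<alpha> / (3 * \<alpha>) * slope \<alpha> x0 * \<bar>\<bar>x\<bar> - x0\<bar> \<le> \<bar>poly_density \<alpha> x - poly_density \<alpha> x0\<bar>"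
proof (cases "\<bar>x\<bar> = x0")
  case False
  let ?t = "\<bar>\<bar>x\<bar> - x0\<bar>"
  have t: "0 < ?t"
    using False by simp
  have x: "x0 / 2 \<le> \<bar>x\<bar>" "\<bar>x\<bar> \<le> 3 / 2 * x0"
    using assms(3) by linarith+
  have eq: "(9/4) powr (\<alpha> / 2) = (3/2::real) powr \<alpha>"
    using powr_powr[of "3/2" 2 "\<alpha>/2"] by (simp add: power2_eq_square)
  have "bracket (-\<alpha>/2) x0 \<le> (3/2) powr \<alpha> * bracket (-\<alpha>/2) x"
    using bracket_comparable(2)[OF assms(2) x, of "\<alpha>/2"] assms(1) by (simp add: eq)
  then have "(2/3) powr \<alpha> * bracket (-\<alpha>/2) x0 \<le> (2/3) powr \<alpha> * ((3/2) powr \<alpha> * bracket (-\<alpha>/2) x)"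
    by (intro mult_left_mono) auto
  also have "\<dots> = ((2/3) * (3/2)) powr \<alpha> * bracket (-\<alpha>/2) x"
    by (subst powr_mult) auto
  finally have "(2/3) powr \<alpha> * poly_density \<alpha> x0 \<le> poly_density \<alpha> x"
    using density_const_pos[OF assms(1)] by (simp add: poly_density_bracket)
  also have "\<dots> \<le> 3 * (1 + x0\<^sup>2) / (x0 * ?t) * \<bar>poly_density \<alpha> x - poly_density \<alpha> x0\<bar>"
    using assms(2,3) by (intro poly_density_gap assms(1,2) t) auto
  finally have "(2/3) powr \<alpha> * poly_density \<alpha> x0 * (x0 * ?t / (3 * (1 + x0\<^sup>2))) \<le>
     3 * (1 + x0\<^sup>2) / (x0 * ?t) * \<bar>poly_density \<alpha> x - poly_density \<alpha> x0\<bar> * (x0 * ?t / (3 * (1 + x0\<^sup>2)))"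
    using assms(2) japanese_pos[of x0] by (intro mult_right_mono) auto
  also have "\<dots> = \<bar>poly_density \<alpha> x - poly_density \<alpha> x0\<bar>"
  proof -
    have "c / d * z * (d / c) = z" if "c \<noteq> 0" "d \<noteq> 0" for c d z :: real
      using that by simp
    then show ?thesis
      using assms(2) t japanese_pos[of x0] by simp
  qed
  also have "(2/3) powr \<alpha> * poly_density \<alpha> x0 * (x0 * ?t / (3 * (1 + x0\<^sup>2))) =
      (2/3) powr \<alpha> / (3 * \<alpha>) * slope \<alpha> x0 * ?t"
    using assms(1) by (simp add: slope_def)
  finally show ?thesis .
qed auto

lemma poly_density_upper_near:
  assumes "1 < \<alpha>" "0 < x0" "x0 / 2 \<le> x" "x \<le> x0"
  shows "\<bar>poly_density \<alpha> x - poly_density \<alpha> x0\<bar> \<le> 6 * 2 powr \<alpha> * slope \<alpha> x0 * (x0 - x)"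
proof -
  have "norm (poly_density \<alpha> x - poly_density \<alpha> x0) \<le> 6 * 2 powr \<alpha> * slope \<alpha> x0 * norm (x - x0)"
  proof (rule field_differentiable_bound[where S="{x..x0}" and f'="\<lambda>z. - \<alpha> * z * poly_density \<alpha> z / (1 + z\<^sup>2)"])
    show "(poly_density \<alpha> has_real_derivative - \<alpha> * z * poly_density \<alpha> z / (1 + z\<^sup>2)) (at z within {x..x0})" for z
      by (rule has_field_derivative_at_within[OF poly_density_deriv[OF assms(1)]])
    show "norm (- \<alpha> * z * poly_density \<alpha> z / (1 + z\<^sup>2)) \<le> 6 * 2 powr \<alpha> * slope \<alpha> x0" if "z \<in> {x..x0}" for z
      unfolding real_norm_def by (rule poly_density_deriv_near) (use assms that in auto)
  qed (use assms in auto)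
  moreover have "norm (x - x0) = x0 - x"
    using assms by simp
  ultimately show ?thesis
    by (simp only: real_norm_def)
qed

text \<open>Near \<open>x0\<close> the weight may vary by a factor that is unbounded as \<open>a\<close> grows. Since \<open>ln\<close> is concave,
  \<open>ln (bracket (- a / 2))\<close> is at most the linear interpolation in \<open>x\<^sup>2\<close>, and at distance \<open>t\<close> the weight
  is therefore comparable either to its value at \<open>x0\<close> or to \<open>(t / \<delta>) ^ (2 * m)\<close> times its value at \<open>x0 - \<delta>\<close>.\<close>
lemma bracket_interpolation:
  assumes a: "0 < a" and x0: "0 < x0" and \<delta>: "0 < \<delta>" "\<delta> \<le> x0 / 4"
  defines "l \<equiv> a / 2 * (ln (1 + x0\<^sup>2) - ln (1 + (x0 - \<delta>)\<^sup>2))"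
  shows "\<bar>\<bar>x\<bar> - x0\<bar> \<le> \<delta> / max 1 l \<Longrightarrow> bracket (-a/2) x \<le> exp 2 * bracket (-a/2) x0"
    and "\<delta> / (2 * max 1 l) \<le> \<bar>\<bar>x\<bar> - x0\<bar> \<Longrightarrow> \<bar>\<bar>x\<bar> - x0\<bar> \<le> \<delta> \<Longrightarrow>
      bracket (-a/2) x \<le> exp 1 * fact (2 * m) * 4 ^ m * (bracket (-a/2) (x0 - \<delta>) * (\<bar>\<bar>x\<bar> - x0\<bar> / \<delta>) ^ (2 * m))"
proof -
  let ?t = "\<bar>\<bar>x\<bar> - x0\<bar>"
  define s where "s = ?t / \<delta>"
  define \<theta> where "\<theta> = s * ((2 * x0 - ?t) / (2 * x0 - \<delta>))"
  define L where "L = max 1 l"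
  have pos: "0 < 1 + z\<^sup>2" for z :: real
    by (rule japanese_pos)
  have L1: "1 \<le> L" "l \<le> L"
    by (auto simp: L_def)
  have "(x0 - \<delta>)\<^sup>2 \<le> x0\<^sup>2"
    using x0 \<delta> by (intro power_mono) auto
  then have l0: "0 \<le> l"
    unfolding l_def using a pos[of "x0 - \<delta>"] by (intro mult_nonneg_nonneg) auto
  have le: "bracket (-a/2) x \<le> bracket (-a/2) x0 * exp (\<theta> * l)"
    and th: "0 \<le> \<theta>" "\<theta> \<le> 1" "\<theta> \<le> 2 * s" if t: "?t \<le> \<delta>"
  proof -
    have s: "0 \<le> s" "s \<le> 1"
      using t \<delta> by (auto simp: s_def)
    show "0 \<le> \<theta>"
      using s x0 \<delta> t by (auto simp: \<theta>_def)
    have "(2 * x0 - ?t) / (2 * x0 - \<delta>) \<le> 2"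
      using x0 \<delta> by (simp add: divide_le_eq)
    then show "\<theta> \<le> 2 * s"
      unfolding \<theta>_def using s(1) by (subst mult.commute) (rule mult_right_mono)
    have "?t * (2 * x0 - ?t) \<le> \<delta> * (2 * x0 - \<delta>)"
    proof -
      have "0 \<le> (\<delta> - ?t) * (2 * x0 - ?t - \<delta>)"
        using t x0 \<delta> by (intro mult_nonneg_nonneg) auto
      then show ?thesis
        by (simp add: algebra_simps)
    qed
    then show th1: "\<theta> \<le> 1"
      using \<delta> x0 by (simp add: \<theta>_def s_def divide_le_eq)
    have "\<theta> * (\<delta> * (2 * x0 - \<delta>)) = ?t * (2 * x0 - ?t)"
      using \<delta> x0 by (simp add: \<theta>_def s_def)
    then have comb: "1 + (x0 - ?t)\<^sup>2 = (1 - \<theta>) * (1 + x0\<^sup>2) + \<theta> * (1 + (x0 - \<delta>)\<^sup>2)"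
      by (simp add: algebra_simps power2_eq_square)
    have "(1 - \<theta>) * ln (1 + x0\<^sup>2) + \<theta> * ln (1 + (x0 - \<delta>)\<^sup>2) \<le>
        ln ((1 - \<theta>) *\<^sub>R (1 + x0\<^sup>2) + \<theta> *\<^sub>R (1 + (x0 - \<delta>)\<^sup>2))"
      using concave_onD[OF ln_concave _ _ , of \<theta> "1 + x0\<^sup>2" "1 + (x0 - \<delta>)\<^sup>2"] \<open>0 \<le> \<theta>\<close> th1 pos by auto
    then have ln_le: "(1 - \<theta>) * ln (1 + x0\<^sup>2) + \<theta> * ln (1 + (x0 - \<delta>)\<^sup>2) \<le> ln (1 + (x0 - ?t)\<^sup>2)"
      by (simp add: comb)
    have "(x0 - ?t)\<^sup>2 \<le> \<bar>x\<bar>\<^sup>2"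
      using t x0 \<delta> by (intro power_mono) auto
    then have "bracket (-a/2) x \<le> bracket (-a/2) (x0 - ?t)"
      unfolding bracket_def using a pos by (intro powr_mono2') auto
    also have "\<dots> = exp (-a/2 * ln (1 + (x0 - ?t)\<^sup>2))"
      using pos[of "x0 - ?t"] by (simp add: bracket_def powr_def)
    also have "\<dots> \<le> exp (-a/2 * ((1 - \<theta>) * ln (1 + x0\<^sup>2) + \<theta> * ln (1 + (x0 - \<delta>)\<^sup>2)))"
      using a ln_le by (subst exp_le_cancel_iff) (intro mult_left_mono_neg, auto)
    also have "-a/2 * ((1 - \<theta>) * ln (1 + x0\<^sup>2) + \<theta> * ln (1 + (x0 - \<delta>)\<^sup>2)) = -a/2 * ln (1 + x0\<^sup>2) + \<theta> * l"
      by (simp add: l_def algebra_simps)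
    also have "exp \<dots> = bracket (-a/2) x0 * exp (\<theta> * l)"
      using pos[of x0] by (simp add: bracket_def powr_def exp_add[symmetric])
    finally show "bracket (-a/2) x \<le> bracket (-a/2) x0 * exp (\<theta> * l)" .
  qed
  show "bracket (-a/2) x \<le> exp 2 * bracket (-a/2) x0" if t: "?t \<le> \<delta> / max 1 l"
  proof -
    have t': "?t * L \<le> \<delta>"
      using t L1 unfolding L_def[symmetric] by (simp add: le_divide_eq)
    have "?t * 1 \<le> ?t * L"
      using L1 by (intro mult_left_mono) auto
    then have "?t \<le> \<delta>"
      using t' by simp
    note T = le[OF this] th[OF this]
    have "\<theta> * l \<le> (2 * s) * L"
      using T L1 l0 by (intro mult_mono) auto
    also have "\<dots> \<le> 2"
      using t' \<delta> by (simp add: s_def divide_le_eq)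
    finally have "exp (\<theta> * l) \<le> exp 2"
      by simp
    then have "bracket (-a/2) x0 * exp (\<theta> * l) \<le> bracket (-a/2) x0 * exp 2"
      by (intro mult_left_mono) auto
    from order_trans[OF T(1) this] show ?thesis
      by (simp only: mult.commute)
  qed
  assume t: "\<delta> / (2 * max 1 l) \<le> ?t" "?t \<le> \<delta>"
  note T = le[OF t(2)] th[OF t(2)]
  have sL: "1 \<le> 2 * s * L"
    using t(1) \<delta> L1 unfolding L_def[symmetric] s_def by (simp add: field_simps)
  then have s0: "0 < s"
    using L1 by (smt (verit) mult_nonpos_nonneg)
  have ex: "exp ((\<theta> - 1) * l) \<le> exp 1 * fact (2 * m) * 4 ^ m * s ^ (2 * m)"
  proof (cases "1 \<le> l")
    case True
    have "L = l"
      using True by (simp add: L_def)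
    then have "1 / (2 * s) \<le> l"
      using sL s0 by (simp add: divide_le_eq mult_ac)
    have "(1 / (2 * s) - 1) \<le> (1 - \<theta>) * (1 / (2 * s))"
      using T(4) s0 by (simp add: field_simps)
    also have "\<dots> \<le> (1 - \<theta>) * l"
      using T \<open>1 / (2 * s) \<le> l\<close> by (intro mult_left_mono) auto
    finally have "exp ((\<theta> - 1) * l) \<le> exp (1 - 1 / (2 * s))"
      by (simp add: algebra_simps)
    also have "\<dots> = exp 1 / exp (1 / (2 * s))"
      by (rule exp_diff)
    also have "\<dots> \<le> exp 1 * (fact (2 * m) * (2 * s) ^ (2 * m))"
    proof -
      have "1 \<le> fact (2 * m) * (2 * s) ^ (2 * m) * exp (1 / (2 * s))"
        using power_le_fact_exp[of "1 / (2 * s)" "2 * m"] s0 by (simp add: power_divide divide_le_eq mult_ac)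
      then show ?thesis
        by (simp add: divide_le_eq mult_ac)
    qed
    also have "(2 * s) ^ (2 * m) = 4 ^ m * s ^ (2 * m)"
      by (simp add: power_mult_distrib power_mult)
    finally show ?thesis
      by (simp add: mult_ac)
  next
    case False
    then have "L = 1"
      by (simp add: L_def)
    then have "1 \<le> (2 * s) ^ (2 * m)"
      using sL by (intro one_le_power) auto
    moreover have "1 \<le> exp 1 * (fact (2 * m)::real)"
      using mult_mono[of 1 "exp 1" 1 "fact (2 * m)::real"] fact_ge_1[of "2 * m"] by auto
    ultimately have "1 * 1 \<le> exp 1 * fact (2 * m) * (2 * s) ^ (2 * m)"
      by (intro mult_mono) auto
    also have "(2 * s) ^ (2 * m) = 4 ^ m * s ^ (2 * m)"
      by (simp add: power_mult_distrib power_mult)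
    finally have "1 \<le> exp 1 * fact (2 * m) * 4 ^ m * s ^ (2 * m)"
      by (simp add: mult_ac)
    moreover have "exp ((\<theta> - 1) * l) \<le> 1"
      using T l0 by (simp add: mult_nonpos_nonneg)
    ultimately show ?thesis
      by linarith
  qed
  have p1: "bracket (-a/2) (x0 - \<delta>) = bracket (-a/2) x0 * exp l"
    using pos[of x0] pos[of "x0 - \<delta>"]
    by (simp add: bracket_def powr_def l_def exp_add[symmetric] algebra_simps)
  have "bracket (-a/2) x \<le> bracket (-a/2) (x0 - \<delta>) * exp ((\<theta> - 1) * l)"
  proof -
    have "l + (\<theta> - 1) * l = \<theta> * l"
      by (simp add: algebra_simps)
    then show ?thesis
      using T(1) by (simp only: p1 mult.assoc exp_add[symmetric])
  qed
  also have "\<dots> \<le> bracket (-a/2) (x0 - \<delta>) * (exp 1 * fact (2 * m) * 4 ^ m * s ^ (2 * m))"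
    using ex by (intro mult_left_mono) auto
  finally show "bracket (-a/2) x \<le> exp 1 * fact (2 * m) * 4 ^ m *
      (bracket (-a/2) (x0 - \<delta>) * (?t / \<delta>) ^ (2 * m))"
    by (simp add: s_def mult_ac)
qed

section \<open>The resonant case\<close>

locale resonance =
  fixes \<alpha> a k x0 :: real and m :: nat
  assumes \<alpha>: "1 < \<alpha>" and a: "1 < a" and am: "(\<alpha> - 1) * m < a - 1" and m: "1 \<le> m"
    and k: "k \<noteq> 0" and x0: "0 < x0"
begin

abbreviation "\<delta> \<equiv> res_delta x0"
abbreviation "\<Lambda> \<equiv> res_Lambda x0"
abbreviation "p \<equiv> bracket (-a/2)"

text \<open>\<open>curv\<close> is \<open>|k \<mu>'(x0)|\<close>, and \<open>growth\<close> is, up to the cutoff at 1, the logarithm of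
  \<open>v(x0) / v(x0 - \<delta>)\<close>, so that \<open>1 / v\<close> is comparable to \<open>1 / v(x0)\<close> up to the distance \<open>\<delta> / growth\<close>.
  The truncation at \<open>T / 4\<close> keeps \<open>\<tau> T\<close> positive at the resonances, inside the zero set of the cutoff.\<close>

definition "\<xi> = - (k * poly_density \<alpha> x0)"
definition "g x = \<xi> + k * poly_density \<alpha> x"
definition "phase x = x * \<xi> + k * poly_cdf \<alpha> x"
definition "curv = \<bar>k\<bar> * slope \<alpha> x0"
definition "growth = max 1 (a / 2 * (ln (1 + x0\<^sup>2) - ln (1 + (x0 - \<delta>)\<^sup>2)))"
definition "dist0 x = \<bar>\<bar>x\<bar> - x0\<bar>"
definition "c1 = (2/3) powr \<alpha> / (3 * \<alpha>)"
definition "c2 = 6 * 2 powr \<alpha>"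
definition "w x = 1 / ((1 + x\<^sup>2) powr ((a + real m) / 2) * \<bar>g x\<bar> ^ m)"
definition "J = (LBINT x:res_domain x0. w x)"
definition "\<tau> T x = max (T / 4) (min \<delta> (dist0 x))"
definition "\<kappa> T x = 3 * (1 + x0\<^sup>2) / (x0 * \<tau> T x)"

lemma \<delta>: "0 < \<delta>" "\<delta> \<le> 1/2" "\<delta> \<le> x0 / 4"
  using res_delta_bounds[OF x0] by auto

lemma c1_pos: "0 < c1"
  using \<alpha> by (simp add: c1_def)

lemma c2_pos: "0 < c2"
  by (simp add: c2_def)

lemma curv_pos: "0 < curv"
  using k slope_pos[OF \<alpha> x0] by (simp add: curv_def)

lemma abs_g: "\<bar>g x\<bar> = \<bar>k\<bar> * \<bar>poly_density \<alpha> x - poly_density \<alpha> x0\<bar>"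
  by (simp add: g_def \<xi>_def abs_mult[symmetric] algebra_simps)

lemma continuous_g: "continuous_on S g"
  unfolding g_def[abs_def] by (intro continuous_intros continuous_poly_density)

lemma measurable_g [measurable]: "g \<in> borel_measurable borel"
  by (rule borel_measurable_continuous_onI[OF continuous_g])

lemma continuous_dist0: "continuous_on S dist0"
  unfolding dist0_def[abs_def] by (intro continuous_intros)

lemma measurable_dist0 [measurable]: "dist0 \<in> borel_measurable borel"
  by (rule borel_measurable_continuous_onI[OF continuous_dist0])

lemma measurable_\<kappa> [measurable]: "\<kappa> T \<in> borel_measurable borel"
  unfolding \<kappa>_def[abs_def] \<tau>_def[abs_def] by measurable

lemma measurable_w [measurable]: "w \<in> borel_measurable borel"
  unfolding w_def[abs_def] by measurable

lemma phase_has_derivative: "(phase has_real_derivative g x) (at x)"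
  unfolding phase_def[abs_def] g_def by (rule phase_deriv[OF \<alpha>])

lemma w_eq: "w x = p x * bracket (-1/2) x ^ m / \<bar>g x\<bar> ^ m"
proof -
  have "-a/2 + real m * (-1/2) = -((a + real m) / 2)"
    by (simp add: field_simps)
  then have "p x * bracket (-1/2) x ^ m = bracket (-((a + real m) / 2)) x"
    unfolding bracket_power bracket_mult by (simp only:)
  also have "\<dots> = 1 / (1 + x\<^sup>2) powr ((a + real m) / 2)"
    by (simp only: bracket_def powr_minus_divide)
  finally show ?thesis
    by (simp add: w_def field_simps)
qed

lemma mem_res_domain: "x \<in> res_domain x0 \<longleftrightarrow> \<delta> \<le> dist0 x"
  using x0 \<delta> by (auto simp: res_domain_def dist0_def)

lemma res_domain_borel [measurable]: "res_domain x0 \<in> sets borel"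
proof -
  have "res_domain x0 = {x. \<delta> \<le> dist0 x}"
    using mem_res_domain by auto
  then show ?thesis
    by simp
qed

lemma near:
  assumes "dist0 x \<le> x0 / 2"
  shows "x0 / 2 \<le> \<bar>x\<bar>" "\<bar>x\<bar> \<le> 3 / 2 * x0"
  using assms unfolding dist0_def by linarith+

lemma g_lower_near: "dist0 x \<le> x0 / 2 \<Longrightarrow> c1 * curv * dist0 x \<le> \<bar>g x\<bar>"
  using mult_left_mono[OF poly_density_lower_near[OF \<alpha> x0, of x], of "\<bar>k\<bar>"]
  by (simp add: abs_g c1_def curv_def dist0_def mult_ac)

lemma g_upper_near: "x0 / 2 \<le> x \<Longrightarrow> x \<le> x0 \<Longrightarrow> \<bar>g x\<bar> \<le> c2 * curv * (x0 - x)"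
  using mult_left_mono[OF poly_density_upper_near[OF \<alpha> x0, of x], of "\<bar>k\<bar>"]
  by (simp add: abs_g c2_def curv_def mult_ac)

context
  fixes T assumes T: "0 < T" "T \<le> \<delta>"
begin

lemma \<tau>_pos: "0 < \<tau> T x" "T / 4 \<le> \<tau> T x" "\<tau> T x \<le> \<delta>"
  using T by (auto simp: \<tau>_def)

lemma \<kappa>_ge_1: "1 \<le> \<kappa> T x"
proof -
  have "x0 * \<tau> T x \<le> x0 * x0"
    using \<tau>_pos[of x] x0 \<delta> by (intro mult_left_mono) auto
  also have "\<dots> \<le> 3 * (1 + x0\<^sup>2)"
    by (simp add: power2_eq_square)
  finally show ?thesis
    using \<tau>_pos[of x] x0 by (simp add: \<kappa>_def le_divide_eq)
qed

lemma \<kappa>_le: "\<kappa> T x \<le> 12 * (1 + x0\<^sup>2) / (x0 * T)"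
proof -
  have "\<kappa> T x \<le> 3 * (1 + x0\<^sup>2) / (x0 * (T / 4))"
    unfolding \<kappa>_def using \<tau>_pos[of x] x0 T by (intro divide_left_mono mult_left_mono mult_pos_pos) auto
  then show ?thesis
    by (simp add: field_simps)
qed

lemma g_lower:
  assumes "T / 4 \<le> dist0 x"
  shows "\<bar>k\<bar> * poly_density \<alpha> x \<le> \<kappa> T x * \<bar>g x\<bar>"
proof -
  have "\<tau> T x \<le> dist0 x" "\<tau> T x \<le> x0"
    using assms \<tau>_pos[of x] x0 \<delta> by (auto simp: \<tau>_def)
  then have "poly_density \<alpha> x \<le> \<kappa> T x * \<bar>poly_density \<alpha> x - poly_density \<alpha> x0\<bar>"
    unfolding \<kappa>_def dist0_def using \<tau>_pos[of x] by (intro poly_density_gap \<alpha> x0) auto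
  then have "\<bar>k\<bar> * poly_density \<alpha> x \<le> \<bar>k\<bar> * (\<kappa> T x * \<bar>poly_density \<alpha> x - poly_density \<alpha> x0\<bar>)"
    by (intro mult_left_mono) auto
  then show ?thesis
    by (simp add: abs_g mult_ac)
qed

definition "gap = \<bar>k\<bar> * density_const \<alpha> / (12 * (1 + x0\<^sup>2) / (x0 * T))"

lemma gap_pos: "0 < gap"
  unfolding gap_def using T x0 k density_const_pos[OF \<alpha>] japanese_pos[of x0]
  by (intro divide_pos_pos mult_pos_pos) auto

lemma gap_le:
  assumes "T / 4 \<le> dist0 x"
  shows "gap * bracket (-\<alpha>/2) x \<le> \<bar>g x\<bar>"
proof -
  let ?M = "12 * (1 + x0\<^sup>2) / (x0 * T)"
  have M: "0 < ?M"
    using T x0 japanese_pos[of x0] by (intro divide_pos_pos mult_pos_pos) auto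
  have "\<bar>k\<bar> * poly_density \<alpha> x \<le> ?M * \<bar>g x\<bar>"
    by (rule order_trans[OF g_lower[OF assms] mult_right_mono[OF \<kappa>_le]]) auto
  then have "\<bar>k\<bar> * poly_density \<alpha> x / ?M \<le> \<bar>g x\<bar>"
    using M by (subst pos_divide_le_eq) (auto simp: mult.commute)
  then show ?thesis
    by (simp add: gap_def poly_density_bracket mult_ac)
qed

lemma resonant_integral_bound:
  assumes n: "n \<le> m" and h: "symbol_bound n UNIV h B R"
    and gs: "symbol_bound n {x. T / 4 < dist0 x} (\<lambda>x. of_real (g x)) (\<lambda>x. K * \<bar>g x\<bar>) R"
    and B: "\<And>x. dist0 x < T / 2 \<Longrightarrow> B x = 0" "\<And>x. B x \<le> A * p x"
    and R: "\<And>x. 0 \<le> R x" "\<And>x. R x \<le> \<rho> * bracket (-1/2) x"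
    and meas: "B \<in> borel_measurable borel" "R \<in> borel_measurable borel"
  shows "integrable lborel (\<lambda>x. B x * R x ^ n / \<bar>g x\<bar> ^ n) \<and>
    cmod (LBINT x. h x * cis (- 2 * pi * phase x)) \<le>
      parts_const K n * (LBINT x. B x * R x ^ n / \<bar>g x\<bar> ^ n)"
proof (rule oscillatory_integral_bound[where U="{x. T / 4 < dist0 x}" and V="{x. dist0 x < T / 2}"
      and \<epsilon>=gap and \<alpha>=\<alpha>, OF phase_has_derivative continuous_g _ _ _ _ gs h])
  show "open {x. T / 4 < dist0 x}" "open {x. dist0 x < T / 2}"
    by (intro open_Collect_less continuous_intros continuous_dist0)+
  show "{x. T / 4 < dist0 x} \<union> {x. dist0 x < T / 2} = UNIV"
    using T by auto
  show "g x \<noteq> 0" if "x \<in> {x. T / 4 < dist0 x}" for x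
  proof -
    have "0 < gap * bracket (-\<alpha>/2) x"
      using gap_pos by simp
    then show ?thesis
      using gap_le[of x] that by auto
  qed
  show "gap * bracket (-\<alpha>/2) x \<le> \<bar>g x\<bar>" if "x \<notin> {x. dist0 x < T / 2}" for x
    using gap_le[of x] that T by auto
  have "(\<alpha> - 1) * n \<le> (\<alpha> - 1) * m"
    using n \<alpha> by (intro mult_left_mono) auto
  then show "(\<alpha> - 1) * n < a - 1"
    using am by linarith
qed (use \<alpha> a B R meas gap_pos in auto)

end

lemma Lambda_eq: "\<Lambda> = (1 + x0\<^sup>2) / (x0 * \<delta>)"
  by (simp add: res_Lambda_def)

lemma Lambda_pos: "0 < \<Lambda>"
  unfolding Lambda_eq using \<delta> x0 japanese_pos[of x0] by (intro divide_pos_pos mult_pos_pos) auto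

lemma Lambda_bracket: "1 / \<delta> \<le> \<Lambda> * bracket (-1/2) x0"
proof -
  have b: "bracket (1/2) x0 * bracket (-1/2) x0 = 1" "bracket (1/2) x0 * bracket (1/2) x0 = 1 + x0\<^sup>2"
    by (simp_all add: bracket_mult bracket_1)
  have "x0 \<le> bracket (1/2) x0"
    using abs_le_bracket[of x0] by linarith
  then have "x0 / (x0 * \<delta>) \<le> bracket (1/2) x0 / (x0 * \<delta>)"
    using x0 \<delta> by (intro divide_right_mono) auto
  also have "bracket (1/2) x0 = (1 + x0\<^sup>2) * bracket (-1/2) x0"
    using b by (metis mult.assoc mult.commute mult_1)
  finally show ?thesis
    using x0 by (simp add: Lambda_eq)
qed

lemma integrable_w: "integrable lborel (\<lambda>x. indicator (res_domain x0) x * w x)"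
proof (rule Bochner_Integration.integrable_bound)
  let ?s = "-a/2 + -real m / 2 + \<alpha> * real m / 2"
  have T: "0 < \<delta>" "\<delta> \<le> \<delta>"
    using \<delta> by auto
  have "?s < -1/2"
    using am by (simp add: field_simps)
  then show "integrable lborel (\<lambda>x. 1 / gap \<delta> ^ m * bracket ?s x)"
    by (intro integrable_mult_right bracket_integrable) auto
  show "AE x in lborel. norm (indicator (res_domain x0) x * w x) \<le> norm (1 / gap \<delta> ^ m * bracket ?s x)"
  proof (rule AE_I2)
    fix x
    show "norm (indicator (res_domain x0) x * w x) \<le> norm (1 / gap \<delta> ^ m * bracket ?s x)"
    proof (cases "x \<in> res_domain x0")
      case True
      then have "\<delta> / 4 \<le> dist0 x"
        using \<delta> by (auto simp: mem_res_domain)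
      note gl = gap_le[OF T this]
      have "w x \<le> p x * bracket (-1/2) x ^ m / (gap \<delta> * bracket (-\<alpha>/2) x) ^ m"
      proof -
        have pos: "0 < gap \<delta> * bracket (-\<alpha>/2) x"
          using gap_pos[OF T] by (intro mult_pos_pos) auto
        moreover have "0 < \<bar>g x\<bar>"
          using pos gl by linarith
        ultimately show ?thesis
          unfolding w_eq using gl gap_pos[OF T]
          by (intro divide_left_mono mult_pos_pos zero_less_power power_mono less_imp_le[OF pos]) auto
      qed
      also have "\<dots> = 1 / gap \<delta> ^ m * (bracket (-a/2) x * bracket (-real m/2) x / bracket (-\<alpha>*real m/2) x)"
        by (simp add: power_mult_distrib bracket_power mult_ac)
      also have "bracket (-a/2) x * bracket (-real m/2) x / bracket (-\<alpha>*real m/2) x = bracket ?s x"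
        unfolding bracket_mult bracket_divide by simp
      finally show ?thesis
        using True gap_pos[OF T] by (simp add: w_def abs_mult)
    qed simp
  qed
qed simp

lemma J_eq: "J = (LBINT x. indicator (res_domain x0) x * w x)"
  by (simp add: J_def set_lebesgue_integral_def)

lemma w_nonneg: "0 \<le> w x"
  by (simp add: w_def)

lemma J_nonneg: "0 \<le> J"
  unfolding J_eq by (rule integral_nonneg_AE) (auto simp: w_nonneg)

definition "J1 = \<delta> * p (x0 - \<delta>) * bracket (-1/2) x0 ^ m / (curv * \<delta>) ^ m"

lemma J_lower: "J1 \<le> (2 * c2) ^ m * J"
proof -
  let ?I = "{x0 - 2 * \<delta>..x0 - \<delta>}"
  let ?c = "p (x0 - \<delta>) * bracket (-1/2) x0 ^ m / (2 * c2 * (curv * \<delta>)) ^ m"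
  have "?c * indicator ?I x \<le> indicator (res_domain x0) x * w x" for x
  proof (cases "x \<in> ?I")
    case True
    then have x: "0 \<le> x" "x \<le> x0 - \<delta>" "x0 / 2 \<le> x" "x0 - x \<le> 2 * \<delta>"
      using \<delta> by auto
    then have "dist0 x = x0 - x"
      using \<delta> by (simp add: dist0_def)
    then have dom: "x \<in> res_domain x0" and d0: "0 < dist0 x" "dist0 x \<le> x0 / 2"
      using x \<delta> by (auto simp: mem_res_domain)
    have "\<bar>g x\<bar> \<le> c2 * curv * (x0 - x)"
      using x \<delta> by (intro g_upper_near) auto
    also have "\<dots> \<le> c2 * curv * (2 * \<delta>)"
      using x c2_pos curv_pos by (intro mult_left_mono) auto
    finally have gle: "\<bar>g x\<bar> \<le> 2 * c2 * (curv * \<delta>)"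
      by (simp add: mult_ac)
    have gpos: "0 < \<bar>g x\<bar>"
      using g_lower_near[OF d0(2)] mult_pos_pos[OF mult_pos_pos[OF c1_pos curv_pos] d0(1)] by linarith
    have mono: "bracket (-s) y \<le> bracket (-s) x" if "x \<le> y" "0 \<le> s" for y s
    proof -
      have "x\<^sup>2 \<le> y\<^sup>2"
        using that x by (intro power_mono) auto
      then show ?thesis
        unfolding bracket_def using that japanese_pos[of x] by (intro powr_mono2') auto
    qed
    have "?c \<le> p x * bracket (-1/2) x ^ m / \<bar>g x\<bar> ^ m"
      using gpos gle mono[of "x0 - \<delta>" "a/2"] mono[of x0 "1/2"] x a \<delta>
      by (intro frac_le mult_mono power_mono) auto
    then show ?thesis
      using True dom by (simp add: w_eq)
  qed (simp add: w_nonneg)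
  then have "(LBINT x. ?c * indicator ?I x) \<le> J"
    unfolding J_eq using integrable_w
    by (intro integral_mono integrable_mult_right) (auto simp: integrable_indicator_iff emeasure_lborel_Icc_eq)
  then have "\<delta> * ?c \<le> J"
    using \<delta> by (simp add: mult.commute)
  moreover have "J1 = (2 * c2) ^ m * (\<delta> * ?c)"
    using c2_pos by (simp add: J1_def power_mult_distrib)
  ultimately show ?thesis
    using c2_pos by (simp only:) (intro mult_left_mono, auto)
qed

lemma J1_nonneg: "0 \<le> J1"
  using \<delta> curv_pos by (simp add: J1_def)

lemma Lambda_J1: "\<delta> * p (x0 - \<delta>) / (curv * \<delta>\<^sup>2) ^ m \<le> \<Lambda> ^ m * J1"
proof -
  have "\<delta> * p (x0 - \<delta>) / (curv * \<delta>\<^sup>2) ^ m = \<delta> * p (x0 - \<delta>) / (curv * \<delta>) ^ m * (1 / \<delta>) ^ m"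
    by (simp add: power2_eq_square power_mult_distrib power_divide mult_ac)
  also have "\<dots> \<le> \<delta> * p (x0 - \<delta>) / (curv * \<delta>) ^ m * (\<Lambda> * bracket (-1/2) x0) ^ m"
    using \<delta> curv_pos Lambda_bracket by (intro mult_left_mono power_mono) auto
  also have "\<dots> = \<Lambda> ^ m * J1"
    by (simp add: J1_def power_mult_distrib mult_ac)
  finally show ?thesis .
qed

definition "cm = exp (1::real) * fact (2 * m) * 4 ^ m"

lemma cm_pos: "0 < cm"
  by (simp add: cm_def)

lemma growth_ge_1: "1 \<le> growth"
  by (simp add: growth_def)

lemma weight_inner: "dist0 x \<le> \<delta> / growth \<Longrightarrow> p x \<le> exp 2 * p x0"
  unfolding dist0_def growth_def using a \<delta> x0 by (intro bracket_interpolation(1)) auto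

lemma weight_outer: "\<delta> / (2 * growth) \<le> dist0 x \<Longrightarrow> dist0 x \<le> \<delta> \<Longrightarrow>
    p x \<le> cm * (p (x0 - \<delta>) * (dist0 x / \<delta>) ^ (2 * m))"
  unfolding dist0_def growth_def cm_def using a \<delta> x0 by (intro bracket_interpolation(2)) auto

end

lemma lorentzian_integral:
  assumes "0 < (\<sigma>::real)"
  shows "integrable lborel (\<lambda>x. 1 / ((x - c)\<^sup>2 + \<sigma>\<^sup>2))"
    and "(LBINT x. 1 / ((x - c)\<^sup>2 + \<sigma>\<^sup>2)) = (LBINT x. bracket (-1) x) / \<sigma>"
proof -
  have eq: "1 / ((x - c)\<^sup>2 + \<sigma>\<^sup>2) = bracket (-1) (- c / \<sigma> + 1 / \<sigma> * x) / \<sigma>\<^sup>2" for x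
  proof -
    have "- c / \<sigma> + 1 / \<sigma> * x = (x - c) / \<sigma>"
      by (simp add: diff_divide_distrib)
    then have "bracket (-1) (- c / \<sigma> + 1 / \<sigma> * x) = 1 / (1 + ((x - c) / \<sigma>)\<^sup>2)"
      using japanese_pos[of "(x - c) / \<sigma>"] by (simp add: bracket_def powr_minus inverse_eq_divide)
    also have "\<dots> / \<sigma>\<^sup>2 = 1 / ((1 + ((x - c) / \<sigma>)\<^sup>2) * \<sigma>\<^sup>2)"
      by simp
    also have "(1 + ((x - c) / \<sigma>)\<^sup>2) * \<sigma>\<^sup>2 = (x - c)\<^sup>2 + \<sigma>\<^sup>2"
      using assms by (simp add: power_divide distrib_right)
    finally show ?thesis
      by simp
  qed
  have int: "integrable lborel (bracket (-1))"
    by (rule bracket_integrable) simp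
  show "integrable lborel (\<lambda>x. 1 / ((x - c)\<^sup>2 + \<sigma>\<^sup>2))"
    unfolding eq using assms lborel_integrable_real_affine[OF int, of "1 / \<sigma>" "- c / \<sigma>"] by simp
  have "(LBINT x. bracket (-1) x) = \<bar>1 / \<sigma>\<bar> *\<^sub>R (LBINT x. bracket (-1) (- c / \<sigma> + 1 / \<sigma> * x))"
    by (rule lborel_integral_real_affine) (use assms in simp)
  then show "(LBINT x. 1 / ((x - c)\<^sup>2 + \<sigma>\<^sup>2)) = (LBINT x. bracket (-1) x) / \<sigma>"
    unfolding eq using assms by (simp add: power2_eq_square)
qed

locale resonance_cutoff = resonance +
  fixes K C :: real and \<beta> f :: "real \<Rightarrow> complex" and N N1 :: real
  assumes C: "1 \<le> C" and \<beta>_one: "\<And>u. 1 \<le> \<bar>u\<bar> \<Longrightarrow> \<beta> u = 1"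
    and \<beta>: "symbol_bound m UNIV \<beta> (\<lambda>u. if \<bar>u\<bar> < 1/2 then 0 else C) (\<lambda>u. if \<bar>u\<bar> \<le> 1 then 1 else 0)"
    and phase_symbol: "\<And>U \<kappa>' R. \<forall>x\<in>U. \<bar>k\<bar> * poly_density \<alpha> x \<le> \<kappa>' x * \<bar>g x\<bar> \<Longrightarrow>
      \<forall>x\<in>U. 1 \<le> \<kappa>' x \<and> \<kappa>' x * bracket (-1/2) x \<le> R x \<Longrightarrow>
      symbol_bound m U (\<lambda>x. of_real (g x)) (\<lambda>x. K * \<bar>g x\<bar>) R"
    and f: "symbol_bound m UNIV f (\<lambda>x. N * p x) (bracket (-1/2))"
    and f1: "symbol_bound 1 UNIV f (\<lambda>x. N1 * p x) (bracket (-1/2))"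
    and N1N: "N1 \<le> N"
begin

abbreviation "E x \<equiv> cis (- 2 * pi * phase x)"

definition "cutoff T x = \<beta> ((x - x0) / T) * \<beta> ((x + x0) / T)"
definition "D = 2 ^ m * (C * C)"

lemma D_ge_1: "1 \<le> D"
proof -
  have "1 \<le> (2::real) ^ m"
    by simp
  moreover have "1 \<le> C * C"
    using mult_mono[of 1 C 1 C] C by simp
  ultimately show ?thesis
    using mult_mono[of 1 "2 ^ m" 1 "C * C"] by (simp add: D_def)
qed

lemma N1_nonneg: "0 \<le> N1"
  using symbol_bound_nonneg[OF f1, of 0] by (simp add: zero_le_mult_iff)

lemma N_nonneg: "0 \<le> N"
  using N1_nonneg N1N by linarith

lemma f_le: "cmod (f x) \<le> N1 * p x"
  using symbol_bound_le[OF f1] by simp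

lemma continuous_f: "continuous_on UNIV f"
  by (rule symbol_bound_continuous_on[OF f])

lemma integrable_f: "integrable lborel f"
  by (rule integrable_bracket_bound[OF continuous_f f_le]) (use a in simp)

lemma cutoff_symbol:
  assumes "0 < T"
  shows "symbol_bound m UNIV (cutoff T) (\<lambda>x. if dist0 x < T / 2 then 0 else D) (\<lambda>x. if dist0 x \<le> T then 1 / T else 0)"
  unfolding cutoff_def[abs_def] dist0_def D_def
  by (rule symbol_bound_two_point_cutoff[OF \<beta> assms _ C]) (use x0 in simp)

lemma cutoff_le: "0 < T \<Longrightarrow> cmod (cutoff T x) \<le> D"
  using symbol_bound_le[OF cutoff_symbol, of T x] D_ge_1 by (auto split: if_splits)

lemma cutoff_eq_1: 
  assumes "0 < T" "T \<le> dist0 x"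
  shows "cutoff T x = 1"
proof -
  have "T \<le> \<bar>x - x0\<bar>" "T \<le> \<bar>x + x0\<bar>"
    using assms x0 unfolding dist0_def by linarith+
  then have "1 \<le> \<bar>(x - x0) / T\<bar>" "1 \<le> \<bar>(x + x0) / T\<bar>"
    using assms(1) by (simp_all add: abs_div)
  then show ?thesis
    by (simp only: cutoff_def \<beta>_one mult_1)
qed

lemma continuous_E: "continuous_on UNIV (\<lambda>x. E x)"
  by (rule isCont_oscillation[OF phase_has_derivative])

lemma continuous_cutoff: "0 < T \<Longrightarrow> continuous_on UNIV (cutoff T)"
  by (rule symbol_bound_continuous_on[OF cutoff_symbol])

lemma integrable_cutoff:
  assumes "continuous_on UNIV q" "\<And>x. cmod (q x) \<le> B"
  shows "integrable lborel (\<lambda>x. q x * f x * E x)"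
proof (rule Bochner_Integration.integrable_bound)
  show "integrable lborel (\<lambda>x. B * norm (f x))"
    using integrable_f by simp
  show "(\<lambda>x. q x * f x * E x) \<in> borel_measurable lborel"
    using borel_measurable_continuous_onI[OF continuous_on_mult[OF continuous_on_mult[OF assms(1) continuous_f] continuous_E]]
    by simp
  have "0 \<le> B"
    using assms(2) norm_ge_zero order_trans by blast
  then show "AE x in lborel. norm (q x * f x * E x) \<le> norm (B * norm (f x))"
    using assms(2) by (auto simp: norm_mult intro!: mult_right_mono)
qed

lemma near_indicator:
  assumes "dist0 x \<le> T"
  shows "1 \<le> indicator {x0 - T..x0 + T} x + (indicator {- x0 - T..- x0 + T} x :: real)"
proof (cases "0 \<le> x")
  case True
  then have "x \<in> {x0 - T..x0 + T}"
    using assms by (auto simp: dist0_def)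
  then show ?thesis
    by simp
next
  case False
  then have "x \<in> {- x0 - T..- x0 + T}"
    using assms by (auto simp: dist0_def)
  then show ?thesis
    by simp
qed

lemma near_indicator_integral:
  assumes "0 < T"
  shows "integrable lborel (\<lambda>x. indicator {x0 - T..x0 + T} x + (indicator {- x0 - T..- x0 + T} x :: real))"
    and "(LBINT x. indicator {x0 - T..x0 + T} x + (indicator {- x0 - T..- x0 + T} x :: real)) = 4 * T"
  using assms by (auto simp: integrable_indicator_iff emeasure_lborel_Icc_eq Bochner_Integration.integral_add)

lemma sqrt_bracket_near:
  assumes "dist0 x \<le> x0 / 2"
  shows "bracket (-1/2) x \<le> 2 * bracket (-1/2) x0" "bracket (-1/2) x0 \<le> 3/2 * bracket (-1/2) x"
proof -
  have "sqrt (9/4) = 3/2"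
    by (rule real_sqrt_unique) (simp_all add: power2_eq_square)
  then have e: "4 powr (1/2) = (2::real)" "(9/4) powr (1/2) = (3/2::real)"
    by (simp_all add: powr_half_sqrt)
  note B = bracket_comparable[OF x0 near[OF assms], of "1/2", unfolded e]
  show "bracket (-1/2) x \<le> 2 * bracket (-1/2) x0" "bracket (-1/2) x0 \<le> 3/2 * bracket (-1/2) x"
    using B by simp_all
qed

lemma near_scale:
  assumes T: "0 < T" "T \<le> \<delta>" and x: "dist0 x \<le> \<delta>"
  shows "1 / \<tau> T x \<le> \<kappa> T x * bracket (-1/2) x"
proof -
  have b: "bracket (1/2) x0 * bracket (-1/2) x0 = 1" "bracket (1/2) x0 * bracket (1/2) x0 = 1 + x0\<^sup>2"
    by (simp_all add: bracket_mult bracket_1)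
  have "x0 \<le> bracket (1/2) x0"
    using abs_le_bracket[of x0] by linarith
  also have "bracket (1/2) x0 = (1 + x0\<^sup>2) * bracket (-1/2) x0"
    using b by (metis mult.assoc mult.commute mult_1)
  also have "\<dots> \<le> (1 + x0\<^sup>2) * (3 * bracket (-1/2) x)"
  proof (rule mult_left_mono)
    have "bracket (-1/2) x0 \<le> 3/2 * bracket (-1/2) x"
      using x \<delta> by (intro sqrt_bracket_near) simp
    then show "bracket (-1/2) x0 \<le> 3 * bracket (-1/2) x"
      using bracket_pos[of "-1/2" x] by linarith
  qed (use japanese_pos[of x0] in simp)
  finally have "x0 / (x0 * \<tau> T x) \<le> (1 + x0\<^sup>2) * (3 * bracket (-1/2) x) / (x0 * \<tau> T x)"
    using x0 \<tau>_pos(1)[OF T] by (intro divide_right_mono mult_nonneg_nonneg) (auto intro: less_imp_le)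
  also have "\<dots> = \<kappa> T x * bracket (-1/2) x"
    unfolding \<kappa>_def by (simp only: times_divide_eq_left times_divide_eq_right mult_ac)
  finally show ?thesis
    using x0 by simp
qed

definition "outer_const = parts_const K m * (2 ^ m * D) * (3 ^ m + 4 * cm * (6 / c1) ^ m * (2 * c2) ^ m)"

lemma outer_bound:
  assumes T: "0 < T" "T \<le> \<delta>" "\<delta> / growth \<le> T"
  shows "cmod (LBINT x. cutoff T x * f x * E x) \<le> outer_const * (\<Lambda> ^ m * (N * J))"
proof -
  note T12 = T(1,2)
  define R where "R x = \<kappa> T x * bracket (-1/2) x" for x
  define B where "B x = 2 ^ m * ((if dist0 x < T / 2 then 0 else D) * (N * p x))" for x
  have R: "bracket (-1/2) x \<le> R x" "R x \<le> 12 * (1 + x0\<^sup>2) / (x0 * T) * bracket (-1/2) x" for x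
  proof -
    have "1 * bracket (-1/2) x \<le> R x"
      unfolding R_def by (intro mult_right_mono \<kappa>_ge_1[OF T12]) simp
    then show "bracket (-1/2) x \<le> R x"
      by simp
    show "R x \<le> 12 * (1 + x0\<^sup>2) / (x0 * T) * bracket (-1/2) x"
      unfolding R_def by (intro mult_right_mono \<kappa>_le[OF T12]) simp
  qed
  have R0: "0 \<le> R x" for x
    using R(1)[of x] bracket_pos[of "-1/2" x] by linarith
  have "symbol_bound m UNIV (cutoff T) (\<lambda>x. if dist0 x < T / 2 then 0 else D) R"
  proof (rule symbol_bound_mono[OF cutoff_symbol[OF T(1)]])
    fix x
    show "(if dist0 x \<le> T then 1 / T else 0) \<le> R x"
    proof (cases "dist0 x \<le> T")
      case True
      have "\<tau> T x \<le> T"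
        using True T by (simp add: \<tau>_def)
      then have "1 / T \<le> 1 / \<tau> T x"
        using \<tau>_pos(1)[OF T12] T(1) by (intro divide_left_mono mult_pos_pos) auto
      then show ?thesis
        using near_scale[OF T12, of x] True T(2) unfolding R_def by simp
    qed (use R0 in simp)
  qed (use T in auto)
  moreover have "symbol_bound m UNIV f (\<lambda>x. N * p x) R"
    by (rule symbol_bound_mono[OF f]) (use R in auto)
  ultimately have h: "symbol_bound m UNIV (\<lambda>x. cutoff T x * f x) B R"
    unfolding B_def by (rule symbol_bound_mult)
  have gs: "symbol_bound m {x. T / 4 < dist0 x} (\<lambda>x. of_real (g x)) (\<lambda>x. K * \<bar>g x\<bar>) R"
    by (rule phase_symbol[where \<kappa>'="\<kappa> T"]) (use g_lower[OF T12] \<kappa>_ge_1[OF T12] in \<open>auto simp: R_def\<close>)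
  have BA: "B x \<le> (2 ^ m * D * N) * p x" for x
    using N_nonneg D_ge_1 by (auto simp: B_def intro!: mult_nonneg_nonneg)
  have meas: "B \<in> borel_measurable borel" "R \<in> borel_measurable borel"
    unfolding B_def[abs_def] R_def[abs_def] by measurable
  have main: "integrable lborel (\<lambda>x. B x * R x ^ m / \<bar>g x\<bar> ^ m) \<and>
      cmod (LBINT x. (cutoff T x * f x) * E x) \<le> parts_const K m * (LBINT x. B x * R x ^ m / \<bar>g x\<bar> ^ m)"
    by (rule resonant_integral_bound[OF T12 order_refl h gs _ BA R0 R(2) meas]) (simp add: B_def)
  define Z where "Z = 2 ^ m * D * N * (cm * (6 / c1) ^ m * \<Lambda> ^ m * (J1 / \<delta>))"
  have Z0: "0 \<le> Z"
    unfolding Z_def using D_ge_1 N_nonneg cm_pos c1_pos Lambda_pos J1_nonneg \<delta>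
    by (intro mult_nonneg_nonneg divide_nonneg_nonneg) auto
  have pt: "B x * R x ^ m / \<bar>g x\<bar> ^ m \<le> (2 ^ m * D * N * 3 ^ m * \<Lambda> ^ m) * (indicator (res_domain x0) x * w x)
      + Z * (indicator {x0 - \<delta>..x0 + \<delta>} x + indicator {- x0 - \<delta>..- x0 + \<delta>} x)" for x
  proof (cases "\<delta> \<le> dist0 x")
    case True
    then have "\<tau> T x = \<delta>"
      using T \<delta> by (simp add: \<tau>_def)
    then have "R x = 3 * \<Lambda> * bracket (-1/2) x"
      by (simp add: R_def \<kappa>_def Lambda_eq)
    then have "B x * R x ^ m / \<bar>g x\<bar> ^ m = (2 ^ m * D * N * 3 ^ m * \<Lambda> ^ m) * w x"
      using True T by (simp add: B_def w_eq power_mult_distrib)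
    moreover have "0 \<le> Z * (indicator {x0 - \<delta>..x0 + \<delta>} x + indicator {- x0 - \<delta>..- x0 + \<delta>} x)"
      using Z0 by (intro mult_nonneg_nonneg) auto
    ultimately show ?thesis
      using True by (simp add: mem_res_domain)
  next
    case False
    have "B x * R x ^ m / \<bar>g x\<bar> ^ m \<le> Z"
    proof (cases "dist0 x < T / 2")
      case True
      then show ?thesis
        using Z0 by (simp add: B_def)
    next
      case nz: False
      let ?d = "dist0 x" and ?b = "bracket (-1/2) x0"
      have d: "0 < ?d" "?d \<le> \<delta>" "?d \<le> x0 / 2" "\<delta> / (2 * growth) \<le> ?d"
        using nz False T \<delta> by auto
      have "\<tau> T x = ?d"
        using d nz T by (simp add: \<tau>_def)
      then have Rx: "R x = 3 * (\<Lambda> * (\<delta> / ?d)) * bracket (-1/2) x"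
        using \<delta> by (simp add: R_def \<kappa>_def Lambda_eq)
      have "R x \<le> 3 * (\<Lambda> * (\<delta> / ?d)) * (2 * ?b)"
        unfolding Rx using d \<delta> Lambda_pos by (intro mult_left_mono sqrt_bracket_near) auto
      then have "B x * R x ^ m / \<bar>g x\<bar> ^ m \<le>
        (2 ^ m * (D * (N * (cm * (p (x0 - \<delta>) * (?d / \<delta>) ^ (2 * m)))))) * (3 * (\<Lambda> * (\<delta> / ?d)) * (2 * ?b)) ^ m
          / (c1 * curv * ?d) ^ m"
        using nz weight_outer[OF d(4,2)] g_lower_near[OF d(3)] d R0 D_ge_1 N_nonneg c1_pos curv_pos cm_pos Lambda_pos \<delta>
        by (intro frac_le mult_mono power_mono)
          (auto simp: B_def intro!: mult_left_mono mult_nonneg_nonneg zero_le_power divide_nonneg_nonneg)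
      also have "\<dots> = 2 ^ m * D * N * cm * p (x0 - \<delta>) *
          ((?d / \<delta>) ^ (2 * m) * (3 * (\<Lambda> * (\<delta> / ?d)) * (2 * ?b)) ^ m / (c1 * curv * ?d) ^ m)"
      proof -
        have "A1 * (A2 * (A3 * (A4 * (A5 * u)))) * v / z = A1 * A2 * A3 * A4 * A5 * (u * v / z)"
          for A1 A2 A3 A4 A5 u v z :: real
          by simp
        then show ?thesis .
      qed
      also have "(?d / \<delta>) ^ (2 * m) * (3 * (\<Lambda> * (\<delta> / ?d)) * (2 * ?b)) ^ m / (c1 * curv * ?d) ^ m =
          ((?d / \<delta>)\<^sup>2 * (3 * (\<Lambda> * (\<delta> / ?d)) * (2 * ?b)) / (c1 * curv * ?d)) ^ m"
        by (simp only: power_mult power_mult_distrib power_divide)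
      also have "(?d / \<delta>)\<^sup>2 * (3 * (\<Lambda> * (\<delta> / ?d)) * (2 * ?b)) / (c1 * curv * ?d) =
          (6 / c1) * \<Lambda> * (?b / (curv * \<delta>))"
        using d \<delta> c1_pos curv_pos by (simp add: field_simps power2_eq_square)
      also have "2 ^ m * D * N * cm * p (x0 - \<delta>) * ((6 / c1) * \<Lambda> * (?b / (curv * \<delta>))) ^ m = Z"
        using \<delta> unfolding Z_def J1_def power_mult_distrib power_divide by simp
      finally show ?thesis .
    qed
    also have "Z * 1 \<le> Z * (indicator {x0 - \<delta>..x0 + \<delta>} x + indicator {- x0 - \<delta>..- x0 + \<delta>} x)"
      using Z0 False by (intro mult_left_mono near_indicator) auto
    finally show ?thesis
      using False by (simp add: mem_res_domain)
  qed
  have "(LBINT x. B x * R x ^ m / \<bar>g x\<bar> ^ m) \<le>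
     (LBINT x. (2 ^ m * D * N * 3 ^ m * \<Lambda> ^ m) * (indicator (res_domain x0) x * w x)
      + Z * (indicator {x0 - \<delta>..x0 + \<delta>} x + indicator {- x0 - \<delta>..- x0 + \<delta>} x))"
    using main by (intro integral_mono pt Bochner_Integration.integrable_add integrable_mult_right
        integrable_w near_indicator_integral(1) \<delta>) auto
  also have "\<dots> = (LBINT x. (2 ^ m * D * N * 3 ^ m * \<Lambda> ^ m) * (indicator (res_domain x0) x * w x))
      + (LBINT x. Z * (indicator {x0 - \<delta>..x0 + \<delta>} x + indicator {- x0 - \<delta>..- x0 + \<delta>} x))"
    by (intro Bochner_Integration.integral_add integrable_mult_right
        integrable_w near_indicator_integral(1) \<delta>)
  also have "\<dots> = (2 ^ m * D * N * 3 ^ m * \<Lambda> ^ m) * J + Z * (4 * \<delta>)"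
    by (simp only: integral_mult_right_zero J_eq near_indicator_integral(2)[OF \<delta>(1)])
  also have "Z * (4 * \<delta>) = 2 ^ m * D * N * cm * (6 / c1) ^ m * \<Lambda> ^ m * 4 * J1"
    using \<delta> by (simp add: Z_def)
  also have "\<dots> \<le> 2 ^ m * D * N * cm * (6 / c1) ^ m * \<Lambda> ^ m * 4 * ((2 * c2) ^ m * J)"
    using D_ge_1 N_nonneg cm_pos c1_pos Lambda_pos by (intro mult_left_mono J_lower mult_nonneg_nonneg) auto
  also have "(2 ^ m * D * N * 3 ^ m * \<Lambda> ^ m) * J + \<dots> =
      (2 ^ m * D) * (3 ^ m + 4 * cm * (6 / c1) ^ m * (2 * c2) ^ m) * (\<Lambda> ^ m * (N * J))"
    by (simp only: distrib_left distrib_right mult_ac)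
  finally have "(LBINT x. B x * R x ^ m / \<bar>g x\<bar> ^ m) \<le>
      (2 ^ m * D) * (3 ^ m + 4 * cm * (6 / c1) ^ m * (2 * c2) ^ m) * (\<Lambda> ^ m * (N * J))"
    by simp
  then have "parts_const K m * (LBINT x. B x * R x ^ m / \<bar>g x\<bar> ^ m) \<le> outer_const * (\<Lambda> ^ m * (N * J))"
    unfolding outer_const_def using mult_left_mono[OF _ less_imp_le[OF parts_const_pos]] by (simp only: mult.assoc)
  then show ?thesis
    using main by linarith
qed

definition "inner_const = 4 * (1 + D) * (exp 2 + cm * (2 * c2) ^ m)"

lemma inner_bound:
  assumes S: "0 < S" "S \<le> \<delta>" "S \<le> 1 / sqrt curv"
  shows "cmod (LBINT x. (1 - cutoff S x) * f x * E x) \<le>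
    inner_const * (N1 * (p x0 / sqrt curv) + \<Lambda> ^ m * (N * J))"
proof -
  let ?P = "p (x0 - S)"
  let ?i = "\<lambda>x. indicator {x0 - S..x0 + S} x + (indicator {- x0 - S..- x0 + S} x :: real)"
  let ?M = "(1 + D) * (N1 * ?P)"
  have M0: "0 \<le> ?M"
    using D_ge_1 N1_nonneg by simp
  have cutoff1: "cmod (1 - cutoff S x) \<le> 1 + D" for x
    using norm_triangle_ineq4[of 1 "cutoff S x"] cutoff_le[OF S(1), of x] by simp
  have cont: "continuous_on UNIV (\<lambda>x. 1 - cutoff S x)"
    by (intro continuous_intros continuous_cutoff S)
  have pt: "cmod ((1 - cutoff S x) * f x * E x) \<le> ?M * ?i x" for x
  proof (cases "S \<le> dist0 x")
    case True
    then show ?thesis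
      using M0 by (simp add: cutoff_eq_1[OF S(1)])
  next
    case False
    then have "x0 - S \<le> \<bar>x\<bar>" "0 \<le> x0 - S"
      using S \<delta> x0 by (auto simp: dist0_def)
    then have "(x0 - S)\<^sup>2 \<le> \<bar>x\<bar>\<^sup>2"
      by (intro power_mono)
    then have "p x \<le> ?P"
      unfolding bracket_def using a japanese_pos[of "x0 - S"] by (intro powr_mono2') auto
    then have "N1 * p x \<le> N1 * ?P"
      using N1_nonneg by (rule mult_left_mono)
    then have "cmod (f x) \<le> N1 * ?P"
      using f_le[of x] by linarith
    then have "cmod ((1 - cutoff S x) * f x * E x) \<le> ?M * 1"
      using cutoff1[of x] D_ge_1 by (simp add: norm_mult mult_mono)
    also have "\<dots> \<le> ?M * ?i x"
      using M0 False by (intro mult_left_mono near_indicator) auto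
    finally show ?thesis .
  qed
  have "cmod (LBINT x. (1 - cutoff S x) * f x * E x) \<le> (LBINT x. cmod ((1 - cutoff S x) * f x * E x))"
    by (rule integral_norm_bound)
  also have "\<dots> \<le> (LBINT x. ?M * ?i x)"
    by (intro integral_mono pt integrable_norm integrable_cutoff[OF cont cutoff1] integrable_mult_right
        near_indicator_integral(1) S)
  also have "\<dots> = ?M * (4 * S)"
    by (simp only: integral_mult_right_zero near_indicator_integral(2)[OF S(1)])
  also have "\<dots> = 4 * (1 + D) * (N1 * (?P * S))"
    by (simp only: mult_ac)
  also have "\<dots> \<le> 4 * (1 + D) * ((exp 2 + cm * (2 * c2) ^ m) * (N1 * (p x0 / sqrt curv) + \<Lambda> ^ m * (N * J)))"
  proof (rule mult_left_mono)
    have dS: "dist0 (x0 - S) = S"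
      using S \<delta> by (simp add: dist0_def)
    have e: "0 \<le> exp (2::real)" "0 \<le> cm * (2 * c2) ^ m"
      using cm_pos c2_pos by auto
    have nn: "0 \<le> N1 * (p x0 / sqrt curv)" "0 \<le> \<Lambda> ^ m * (N * J)"
      using N1_nonneg N_nonneg J_nonneg Lambda_pos curv_pos by auto
    show "N1 * (?P * S) \<le> (exp 2 + cm * (2 * c2) ^ m) * (N1 * (p x0 / sqrt curv) + \<Lambda> ^ m * (N * J))"
    proof (cases "S \<le> \<delta> / growth")
      case True
      have "?P * S \<le> (exp 2 * p x0) * (1 / sqrt curv)"
        using weight_inner[of "x0 - S"] True S by (intro mult_mono) (auto simp: dS)
      then have "N1 * (?P * S) \<le> N1 * ((exp 2 * p x0) * (1 / sqrt curv))"
        using N1_nonneg by (rule mult_left_mono)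
      also have "\<dots> = exp 2 * (N1 * (p x0 / sqrt curv))"
        by simp
      also have "\<dots> \<le> (exp 2 + cm * (2 * c2) ^ m) * (N1 * (p x0 / sqrt curv) + \<Lambda> ^ m * (N * J))"
        using e nn by (intro mult_mono) auto
      finally show ?thesis .
    next
      case False
      have "\<delta> / (2 * growth) \<le> \<delta> / growth"
        using growth_ge_1 \<delta> by (intro divide_left_mono) auto
      then have "?P \<le> cm * (p (x0 - \<delta>) * (S / \<delta>) ^ (2 * m))"
        using weight_outer[of "x0 - S"] False S by (simp add: dS)
      also have "(S / \<delta>) ^ (2 * m) \<le> (1 / (curv * \<delta>\<^sup>2)) ^ m"
      proof -
        have "S\<^sup>2 \<le> (1 / sqrt curv)\<^sup>2"
          using S by (intro power_mono) auto
        then have "S\<^sup>2 / \<delta>\<^sup>2 \<le> (1 / curv) / \<delta>\<^sup>2"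
          using curv_pos by (intro divide_right_mono) (auto simp: power_divide)
        then have "(S / \<delta>)\<^sup>2 \<le> 1 / (curv * \<delta>\<^sup>2)"
          by (simp add: power_divide)
        then show ?thesis
          unfolding power_mult by (intro power_mono) auto
      qed
      finally have "?P * S \<le> cm * (p (x0 - \<delta>) * (1 / (curv * \<delta>\<^sup>2)) ^ m) * \<delta>"
        using S cm_pos curv_pos by (intro mult_mono) (auto intro!: mult_nonneg_nonneg zero_le_power)
      also have "\<dots> = cm * (\<delta> * p (x0 - \<delta>) / (curv * \<delta>\<^sup>2) ^ m)"
        by (simp add: power_divide)
      also have "\<dots> \<le> cm * (\<Lambda> ^ m * ((2 * c2) ^ m * J))"
        using cm_pos Lambda_pos
        by (intro mult_left_mono order_trans[OF Lambda_J1] J_lower) auto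
      finally have le: "?P * S \<le> cm * (\<Lambda> ^ m * ((2 * c2) ^ m * J))" .
      have "N1 * (?P * S) \<le> N * (cm * (\<Lambda> ^ m * ((2 * c2) ^ m * J)))"
        by (rule mult_mono[OF N1N le N_nonneg]) (use S in simp)
      also have "\<dots> = (cm * (2 * c2) ^ m) * (\<Lambda> ^ m * (N * J))"
        by (simp only: mult_ac)
      also have "\<dots> \<le> (exp 2 + cm * (2 * c2) ^ m) * (N1 * (p x0 / sqrt curv) + \<Lambda> ^ m * (N * J))"
        using e nn by (intro mult_mono) auto
      finally show ?thesis .
    qed
  qed (use D_ge_1 in simp)
  finally show ?thesis
    by (simp only: inner_const_def mult.assoc)
qed

definition "middle_symbol_const = max 1 (max \<alpha> (c2 / c1))"
definition "middle_const = parts_const middle_symbol_const 1 * (32 * D * exp 2 / c1 * (LBINT x. bracket (-1) x))"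

lemma middle_bound:
  assumes S: "0 < S" "S < T" and T: "T \<le> \<delta> / growth"
  shows "cmod (LBINT x. (cutoff S x - cutoff T x) * f x * E x) \<le> middle_const * (N1 * (p x0 / (curv * S)))"
proof -
  have "\<delta> / growth \<le> \<delta> / 1"
    using growth_ge_1 \<delta> by (intro divide_left_mono) auto
  then have T\<delta>: "0 < T" "T \<le> \<delta>"
    using S T by auto
  have S12: "0 < S" "S \<le> \<delta>"
    using S T\<delta> by auto
  let ?K = middle_symbol_const
  have K: "1 \<le> ?K" "\<alpha> \<le> ?K" "c2 / c1 \<le> ?K"
    by (auto simp: middle_symbol_const_def)
  define R where "R x = (if dist0 x \<le> \<delta> then 1 / \<tau> S x else \<kappa> S x * bracket (-1/2) x)" for x
  define G where "G x = (if S / 2 \<le> dist0 x \<and> dist0 x \<le> T then 2 * D else 0)" for x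
  define B where "B x = 2 ^ 1 * (G x * (N1 * p x))" for x
  have bk: "1 * bracket (-1/2) x \<le> \<kappa> S x * bracket (-1/2) x" for x
    by (intro mult_right_mono \<kappa>_ge_1[OF S12]) simp
  have Rge: "bracket (-1/2) x \<le> R x" for x
  proof (cases "dist0 x \<le> \<delta>")
    case True
    have "1 \<le> 1 / \<tau> S x"
      using \<tau>_pos(1,3)[OF S12, of x] \<delta> by (simp add: le_divide_eq)
    then show ?thesis
      using bracket_le_1[of "-1/2" x] True by (simp add: R_def)
  qed (use bk[of x] in \<open>simp add: R_def\<close>)
  have R0: "0 \<le> R x" for x
    using Rge[of x] bracket_pos[of "-1/2" x] by linarith
  define \<rho> where "\<rho> = 12 * (1 + x0\<^sup>2) / (x0 * S) + 4 / S * (3 / 2 / bracket (-1/2) x0)"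
  have Rle: "R x \<le> \<rho> * bracket (-1/2) x" for x
  proof -
    let ?A = "12 * (1 + x0\<^sup>2) / (x0 * S)" and ?B = "4 / S * (3 / 2 / bracket (-1/2) x0)"
    have AB: "0 \<le> ?A" "0 \<le> ?B"
      using S x0 by (auto intro!: divide_nonneg_nonneg mult_nonneg_nonneg)
    have "R x \<le> ?A * bracket (-1/2) x \<or> R x \<le> ?B * bracket (-1/2) x"
    proof (cases "dist0 x \<le> \<delta>")
      case True
      have "1 / \<tau> S x \<le> 1 / (S / 4)"
        using \<tau>_pos[OF S12, of x] S by (intro divide_left_mono mult_pos_pos) auto
      moreover have "1 \<le> 3 / 2 / bracket (-1/2) x0 * bracket (-1/2) x"
        using sqrt_bracket_near(2)[of x] True \<delta> by (simp add: pos_le_divide_eq)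
      then have "4 / S * 1 \<le> 4 / S * (3 / 2 / bracket (-1/2) x0 * bracket (-1/2) x)"
        using S by (intro mult_left_mono) auto
      ultimately show ?thesis
        using True by (simp add: R_def)
    next
      case False
      have "\<kappa> S x * bracket (-1/2) x \<le> ?A * bracket (-1/2) x"
        by (intro mult_right_mono \<kappa>_le[OF S12]) simp
      then show ?thesis
        using False by (simp add: R_def)
    qed
    moreover have "?A * bracket (-1/2) x \<le> \<rho> * bracket (-1/2) x" "?B * bracket (-1/2) x \<le> \<rho> * bracket (-1/2) x"
      unfolding \<rho>_def using AB by (intro mult_right_mono; simp)+
    ultimately show ?thesis
      by linarith
  qed
  have cut_R: "symbol_bound 1 UNIV (cutoff T') (\<lambda>x. if dist0 x < T' / 2 then 0 else D) R"
    if T': "S \<le> T'" "T' \<le> \<delta>" for T'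
  proof -
    have "0 < T'"
      using S T' by simp
    show ?thesis
    proof (rule symbol_bound_mono[OF symbol_bound_lower[OF cutoff_symbol[OF \<open>0 < T'\<close>] m]])
      fix x
      show "(if dist0 x \<le> T' then 1 / T' else 0) \<le> R x"
      proof (cases "dist0 x \<le> T'")
        case True
        have "\<tau> S x \<le> T'"
          using True T' S by (simp add: \<tau>_def)
        then have "1 / T' \<le> 1 / \<tau> S x"
          using \<tau>_pos(1)[OF S12] \<open>0 < T'\<close> by (intro divide_left_mono mult_pos_pos) auto
        then show ?thesis
          using True T' by (simp add: R_def)
      qed (use R0 in simp)
    qed (use \<open>0 < T'\<close> in auto)
  qed
  have op: "open {x. T < dist0 x}"
    by (intro open_Collect_less continuous_intros continuous_dist0)
  have "symbol_bound 1 UNIV (\<lambda>x. cutoff S x + (-1) * cutoff T x)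
    (\<lambda>x. (if dist0 x < S / 2 then 0 else D) + cmod (-1) * (if dist0 x < T / 2 then 0 else D)) R"
    using S T\<delta> by (intro symbol_bound_add symbol_bound_cmult cut_R) auto
  then have G1: "symbol_bound 1 UNIV (\<lambda>x. cutoff S x - cutoff T x)
    (\<lambda>x. (if dist0 x < S / 2 then 0 else D) + (if dist0 x < T / 2 then 0 else D)) R"
    by simp
  have G2: "symbol_bound 1 {x. T < dist0 x} (\<lambda>x. cutoff S x - cutoff T x) (\<lambda>x. 0) (\<lambda>x. 0)"
    by (rule symbol_bound_cong[OF symbol_bound_const[of _ 0] op])
      (use S T\<delta> in \<open>auto simp: cutoff_eq_1\<close>)
  have G: "symbol_bound 1 UNIV (\<lambda>x. cutoff S x - cutoff T x) G R"
    by (rule symbol_bound_mono[OF symbol_bound_glue[OF G1 G2 open_UNIV op]])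
      (use S D_ge_1 R0 in \<open>auto simp: G_def\<close>)
  have f_R: "symbol_bound 1 UNIV f (\<lambda>x. N1 * p x) R"
    by (rule symbol_bound_mono[OF f1]) (use Rge in auto)
  have h: "symbol_bound 1 UNIV (\<lambda>x. (cutoff S x - cutoff T x) * f x) B R"
    unfolding B_def by (rule symbol_bound_mult[OF G f_R])
  have gs: "symbol_bound 1 {x. S / 4 < dist0 x} (\<lambda>x. of_real (g x)) (\<lambda>x. ?K * \<bar>g x\<bar>) R"
  proof -
    let ?g' = "\<lambda>x. k * (- \<alpha> * x * poly_density \<alpha> x / (1 + x\<^sup>2))"
    have "(g has_real_derivative ?g' x) (at x)" for x
      unfolding g_def[abs_def] using \<alpha> by (auto intro!: derivative_eq_intros poly_density_deriv)
    then have "((\<lambda>x. complex_of_real (g x)) has_vector_derivative of_real (?g' x)) (at x)" for x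
      by (rule has_vector_derivative_of_real)
    moreover have "continuous_on A (\<lambda>x. complex_of_real (?g' x))" for A
      using japanese_pos by (intro continuous_intros continuous_poly_density) (auto simp: less_imp_neq[symmetric])
    moreover have "\<bar>?g' x\<bar> \<le> ?K * \<bar>g x\<bar> * R x" if x: "S / 4 < dist0 x" for x
    proof (cases "dist0 x \<le> \<delta>")
      case True
      have nr: "dist0 x \<le> x0 / 2"
        using True \<delta> by linarith
      have d: "0 < dist0 x"
        using x S by linarith
      have R: "R x = 1 / dist0 x"
        using True x S by (simp add: R_def \<tau>_def)
      have "\<bar>?g' x\<bar> \<le> \<bar>k\<bar> * (c2 * slope \<alpha> x0)"
        unfolding abs_mult[of k] c2_def by (intro mult_left_mono poly_density_deriv_near \<alpha> x0 near[OF nr]) simp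
      also have "\<dots> = (c2 / c1) * (c1 * curv * dist0 x) * (1 / dist0 x)"
        using c1_pos d by (simp add: curv_def)
      also have "\<dots> \<le> ?K * \<bar>g x\<bar> * (1 / dist0 x)"
        using K g_lower_near[OF nr] c1_pos curv_pos d by (intro mult_right_mono mult_mono) auto
      finally show ?thesis
        by (simp only: R)
    next
      case False
      have b: "bracket (-1) x = 1 / (1 + x\<^sup>2)"
        using japanese_pos[of x] by (simp add: bracket_def powr_minus inverse_eq_divide)
      have "\<bar>x\<bar> * bracket (-1) x \<le> bracket (1/2) x * bracket (-1) x"
        by (intro mult_right_mono abs_le_bracket) simp
      then have xb: "\<bar>x\<bar> / (1 + x\<^sup>2) \<le> bracket (-1/2) x"
        unfolding bracket_mult by (simp add: b)
      have "\<bar>?g' x\<bar> = \<alpha> * (\<bar>k\<bar> * poly_density \<alpha> x) * (\<bar>x\<bar> / (1 + x\<^sup>2))"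
        using \<alpha> poly_density_pos[OF \<alpha>, of x] japanese_pos[of x] by (simp add: abs_mult)
      also have "\<dots> \<le> ?K * (\<kappa> S x * \<bar>g x\<bar>) * bracket (-1/2) x"
        by (rule mult_mono[OF mult_mono[OF K(2) g_lower[OF S12]] xb])
          (use K(1) x \<alpha> poly_density_pos[OF \<alpha>, of x] \<kappa>_ge_1[OF S12, of x] japanese_pos[of x]
            in \<open>auto intro!: mult_nonneg_nonneg divide_nonneg_nonneg\<close>)
      also have "\<dots> = ?K * \<bar>g x\<bar> * R x"
        using False by (simp add: R_def)
      finally show ?thesis .
    qed
    moreover have "\<bar>g x\<bar> \<le> ?K * \<bar>g x\<bar>" for x
      using mult_right_mono[OF K(1), of "\<bar>g x\<bar>"] by simp
    ultimately show ?thesis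
      unfolding One_nat_def symbol_bound.simps
      by (intro conjI exI[of _ "\<lambda>x. complex_of_real (?g' x)"] ballI)
        (simp_all only: norm_of_real mem_Collect_eq)
  qed
  have BA: "B x \<le> (4 * D * N1) * p x" for x
    using N1_nonneg D_ge_1 by (auto simp: B_def G_def intro!: mult_nonneg_nonneg)
  have meas: "B \<in> borel_measurable borel" "R \<in> borel_measurable borel"
  proof -
    show "B \<in> borel_measurable borel"
      unfolding B_def[abs_def] G_def[abs_def] by measurable
    show "R \<in> borel_measurable borel"
      unfolding R_def[abs_def] \<tau>_def[abs_def] by measurable
  qed
  have main: "integrable lborel (\<lambda>x. B x * R x ^ 1 / \<bar>g x\<bar> ^ 1) \<and>
      cmod (LBINT x. ((cutoff S x - cutoff T x) * f x) * E x) \<le>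
        parts_const ?K 1 * (LBINT x. B x * R x ^ 1 / \<bar>g x\<bar> ^ 1)"
    by (rule resonant_integral_bound[OF S12 m h gs _ BA R0 Rle meas]) (simp add: B_def G_def)
  define Z where "Z = 8 * D * N1 * exp 2 * p x0 / (c1 * curv)"
  let ?L = "\<lambda>x. 1 / ((x - x0)\<^sup>2 + (S / 2)\<^sup>2) + 1 / ((x - (- x0))\<^sup>2 + (S / 2)\<^sup>2)"
  have Z0: "0 \<le> Z"
    unfolding Z_def using D_ge_1 N1_nonneg c1_pos curv_pos by (intro divide_nonneg_nonneg mult_nonneg_nonneg) auto
  have pt: "B x * R x ^ 1 / \<bar>g x\<bar> ^ 1 \<le> Z * ?L x" for x
  proof (cases "S / 2 \<le> dist0 x \<and> dist0 x \<le> T")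
    case True
    let ?d = "dist0 x"
    have d: "0 < ?d" "?d \<le> \<delta>" "?d \<le> x0 / 2" "?d \<le> \<delta> / growth"
      using True S T T\<delta> \<delta> by linarith+
    have R: "R x = 1 / ?d"
      using True d S by (simp add: R_def \<tau>_def)
    have "B x * R x ^ 1 / \<bar>g x\<bar> ^ 1 = 4 * D * (N1 * p x) * (1 / ?d) / \<bar>g x\<bar>"
      using True by (simp add: B_def G_def R)
    also have "\<dots> \<le> 4 * D * (N1 * (exp 2 * p x0)) * (1 / ?d) / (c1 * curv * ?d)"
      using weight_inner[OF d(4)] g_lower_near[OF d(3)] d c1_pos curv_pos D_ge_1 N1_nonneg
      by (intro frac_le mult_right_mono mult_left_mono) auto
    also have "\<dots> = Z * (1 / (2 * ?d\<^sup>2))"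
      by (simp add: Z_def power2_eq_square mult_ac)
    also have "\<dots> \<le> Z * ?L x"
    proof (rule mult_left_mono[OF _ Z0])
      have "(S / 2)\<^sup>2 \<le> ?d\<^sup>2"
        using True S by (intro power_mono) auto
      then have le: "1 / (2 * ?d\<^sup>2) \<le> 1 / (?d\<^sup>2 + (S / 2)\<^sup>2)"
        using d S by (intro divide_left_mono mult_pos_pos) (auto intro!: add_pos_nonneg)
      have eq: "?d\<^sup>2 = (x - x0)\<^sup>2 \<or> ?d\<^sup>2 = (x - (- x0))\<^sup>2"
        by (cases "0 \<le> x") (auto simp: dist0_def power2_eq_square algebra_simps)
      have "u \<le> 1 / (y + s) + 1 / (z + s)"
        if "u \<le> 1 / (d + s)" "d = y \<or> d = z" "0 \<le> 1 / (y + s)" "0 \<le> 1 / (z + s)" for u d s y z :: real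
        using that(2)
      proof
        assume "d = y"
        show ?thesis
          using that(1)[unfolded \<open>d = y\<close>] that(4) by linarith
      next
        assume "d = z"
        show ?thesis
          using that(1)[unfolded \<open>d = z\<close>] that(3) by linarith
      qed
      from this[OF le eq] show "1 / (2 * ?d\<^sup>2) \<le> ?L x"
        by simp
    qed
    finally show ?thesis .
  next
    case False
    then have "G x = 0"
      unfolding G_def by (rule if_not_P)
    then have "B x = 0"
      by (simp add: B_def)
    moreover have "0 \<le> Z * ?L x"
      using Z0 by (intro mult_nonneg_nonneg add_nonneg_nonneg) auto
    ultimately show ?thesis
      by simp
  qed
  have S2: "0 < S / 2"
    using S by simp
  have Lint: "integrable lborel ?L"
    by (intro Bochner_Integration.integrable_add lorentzian_integral(1) S2)
  have "(LBINT x. B x * R x ^ 1 / \<bar>g x\<bar> ^ 1) \<le> (LBINT x. Z * ?L x)"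
    using main by (intro integral_mono pt integrable_mult_right Lint) auto
  also have "\<dots> = Z * (LBINT x. ?L x)"
    by (rule integral_mult_right_zero)
  also have "(LBINT x. ?L x) = (LBINT x. bracket (-1) x) / (S / 2) + (LBINT x. bracket (-1) x) / (S / 2)"
    by (subst Bochner_Integration.integral_add)
      (simp_all only: lorentzian_integral[OF S2])
  also have "Z * \<dots> = 32 * D * exp 2 / c1 * (LBINT x. bracket (-1) x) * (N1 * (p x0 / (curv * S)))"
    by (simp add: Z_def mult_ac)
  finally have "parts_const ?K 1 * (LBINT x. B x * R x ^ 1 / \<bar>g x\<bar> ^ 1) \<le>
      middle_const * (N1 * (p x0 / (curv * S)))"
    unfolding middle_const_def using mult_left_mono[OF _ less_imp_le[OF parts_const_pos]]
    by (simp only: mult.assoc)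
  then show ?thesis
    using main by linarith
qed

lemma const_nonneg: "0 \<le> inner_const" "0 \<le> middle_const" "0 \<le> outer_const"
proof -
  have "0 \<le> (LBINT x. bracket (-1) x)"
    by (rule integral_nonneg_AE) simp
  then show "0 \<le> middle_const"
    unfolding middle_const_def using D_ge_1 c1_pos parts_const_pos[of _ 1]
    by (intro mult_nonneg_nonneg divide_nonneg_nonneg) (auto intro: less_imp_le)
  show "0 \<le> inner_const"
    unfolding inner_const_def using D_ge_1 cm_pos c2_pos
    by (intro mult_nonneg_nonneg add_nonneg_nonneg zero_le_power) auto
  show "0 \<le> outer_const"
    unfolding outer_const_def using D_ge_1 cm_pos c1_pos c2_pos parts_const_pos[of _ m]
    by (intro mult_nonneg_nonneg add_nonneg_nonneg zero_le_power divide_nonneg_nonneg) (auto intro: less_imp_le)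
qed

lemma resonant_bound:
  "cmod (LBINT x. f x * E x) \<le> (inner_const + middle_const + outer_const) *
    (\<Lambda> ^ m * N * J + N1 / (poly_weight a x0 * sqrt curv))"
proof -
  define S where "S = min (1 / sqrt curv) \<delta>"
  define T where "T = max S (\<delta> / growth)"
  have sc: "0 < sqrt curv"
    using curv_pos by simp
  have S: "0 < S" "S \<le> \<delta>" "S \<le> 1 / sqrt curv"
    using sc \<delta> by (auto simp: S_def)
  have "\<delta> / growth \<le> \<delta> / 1"
    using growth_ge_1 \<delta> by (intro divide_left_mono) auto
  then have T: "S \<le> T" "T \<le> \<delta>" "\<delta> / growth \<le> T" "0 < T"
    using S by (auto simp: T_def)
  let ?P = "N1 * (p x0 / sqrt curv)" and ?Q = "\<Lambda> ^ m * (N * J)"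
  have nn: "0 \<le> ?P" "0 \<le> ?Q"
    using N1_nonneg N_nonneg J_nonneg Lambda_pos curv_pos by auto
  have mid: "cmod (LBINT x. (cutoff S x - cutoff T x) * f x * E x) \<le> middle_const * ?P"
  proof (cases "T = S")
    case True
    moreover have "0 \<le> middle_const * ?P"
      by (intro mult_nonneg_nonneg const_nonneg nn)
    ultimately show ?thesis
      by simp
  next
    case False
    then have ST: "S < T" "T \<le> \<delta> / growth"
      using T by (auto simp: T_def)
    then have "S < \<delta>"
      using T by linarith
    then have "S = 1 / sqrt curv"
      by (auto simp: S_def min_def split: if_splits)
    then have "curv * S = sqrt curv"
      using curv_pos real_sqrt_mult_self[of curv] by (simp add: divide_eq_eq)
    then show ?thesis
      using middle_bound[OF S(1) ST] by simp
  qed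
  have int: "integrable lborel (\<lambda>x. (1 - cutoff S x) * f x * E x)"
    "integrable lborel (\<lambda>x. (cutoff S x - cutoff T x) * f x * E x)"
    "integrable lborel (\<lambda>x. cutoff T x * f x * E x)"
  proof -
    show "integrable lborel (\<lambda>x. (1 - cutoff S x) * f x * E x)"
      by (rule integrable_cutoff[where B="1 + D"])
        (use cutoff_le[OF S(1)] in \<open>auto intro!: continuous_intros continuous_cutoff S
          order_trans[OF norm_triangle_ineq4] add_mono\<close>)
    show "integrable lborel (\<lambda>x. (cutoff S x - cutoff T x) * f x * E x)"
    proof (rule integrable_cutoff)
      show "cmod (cutoff S x - cutoff T x) \<le> D + D" for x
        using norm_triangle_ineq4[of "cutoff S x" "cutoff T x"] cutoff_le[OF S(1), of x] cutoff_le[OF T(4), of x]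
        by linarith
    qed (intro continuous_intros continuous_cutoff S T)
    show "integrable lborel (\<lambda>x. cutoff T x * f x * E x)"
      by (rule integrable_cutoff[OF continuous_cutoff[OF T(4)] cutoff_le[OF T(4)]])
  qed
  have "f x * E x = (1 - cutoff S x) * f x * E x + ((cutoff S x - cutoff T x) * f x * E x + cutoff T x * f x * E x)" for x
    by (simp add: algebra_simps)
  then have "(LBINT x. f x * E x) = (LBINT x. (1 - cutoff S x) * f x * E x +
      ((cutoff S x - cutoff T x) * f x * E x + cutoff T x * f x * E x))"
    by (simp only:)
  also have "\<dots> = (LBINT x. (1 - cutoff S x) * f x * E x) +
      ((LBINT x. (cutoff S x - cutoff T x) * f x * E x) + (LBINT x. cutoff T x * f x * E x))"
    using int by (subst Bochner_Integration.integral_add; (subst Bochner_Integration.integral_add)?)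
      (auto intro!: Bochner_Integration.integrable_add)
  finally have "cmod (LBINT x. f x * E x) \<le> cmod (LBINT x. (1 - cutoff S x) * f x * E x) +
      (cmod (LBINT x. (cutoff S x - cutoff T x) * f x * E x) + cmod (LBINT x. cutoff T x * f x * E x))"
    by (simp only:) (intro order_trans[OF norm_triangle_ineq] add_left_mono norm_triangle_ineq)
  also have "\<dots> \<le> inner_const * (?P + ?Q) + (middle_const * ?P + outer_const * ?Q)"
    by (intro add_mono inner_bound mid outer_bound S T)
  also have "\<dots> \<le> inner_const * (?P + ?Q) + (middle_const * (?P + ?Q) + outer_const * (?P + ?Q))"
  proof -
    have "?P \<le> ?P + ?Q" "?Q \<le> ?P + ?Q"
      using nn by linarith+
    then show ?thesis
      by (intro add_left_mono add_mono mult_left_mono const_nonneg)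
  qed
  also have "\<dots> = (inner_const + middle_const + outer_const) * (?Q + ?P)"
    by (simp add: algebra_simps add_divide_distrib)
  also have "?P = N1 / (poly_weight a x0 * sqrt curv)"
  proof -
    have "p x0 = 1 / poly_weight a x0"
      using japanese_pos[of x0] by (simp add: poly_weight_def bracket_def powr_minus inverse_eq_divide)
    then show ?thesis
      by simp
  qed
  finally show ?thesis
    by (simp only: mult.assoc)
qed

end

lemma poly_density_le_0: "1 < \<alpha> \<Longrightarrow> poly_density \<alpha> x \<le> poly_density \<alpha> 0"
  using bracket_le_1[of "-\<alpha>/2" x] density_const_pos[of \<alpha>]
  by (simp add: poly_density_bracket) (simp add: bracket_def)

lemma fourier_coeff_eq_oscillatory_integral:
  assumes "1 < \<alpha>" "1 < a" "f \<in> weighted_diff_space (poly_weight a) m"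
  shows "fourier_coeff (transplant \<alpha> f \<xi>) k =
    (LBINT x. f x * cis (- 2 * pi * (x * \<xi> + of_int k * poly_cdf \<alpha> x)))"
proof -
  have f: "symbol_bound m UNIV f (\<lambda>x. weighted_diff_norm (poly_weight a) m f * bracket (-a/2) x) (bracket (-1/2))"
    by (rule symbol_bound_weighted_diff_space[OF assms(3)]) simp
  have "integrable lborel f"
    by (rule integrable_bracket_bound[OF symbol_bound_continuous_on[OF f] symbol_bound_le[OF f]])
      (use assms(2) in auto)
  then show ?thesis
    by (rule fourier_coeff_transplant[OF assms(1) symbol_bound_continuous_on[OF f]])
qed

lemma resonant_bound_uniform:
  assumes \<alpha>: "1 < \<alpha>" and m: "1 \<le> m"
  shows "\<exists>C\<ge>0. \<forall>a (k::real) x0 f N N1.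
    1 < a \<longrightarrow> (\<alpha> - 1) * m < a - 1 \<longrightarrow> k \<noteq> 0 \<longrightarrow> 0 < x0 \<longrightarrow>
    symbol_bound m UNIV f (\<lambda>x. N * bracket (-a/2) x) (bracket (-1/2)) \<longrightarrow>
    symbol_bound 1 UNIV f (\<lambda>x. N1 * bracket (-a/2) x) (bracket (-1/2)) \<longrightarrow> N1 \<le> N \<longrightarrow>
    cmod (LBINT x. f x * cis (- 2 * pi * (x * - (k * poly_density \<alpha> x0) + k * poly_cdf \<alpha> x))) \<le>
      C * (res_Lambda x0 ^ m * N * (LBINT x:res_domain x0. 1 / ((1 + x\<^sup>2) powr ((a + real m) / 2) *
          \<bar>- (k * poly_density \<alpha> x0) + k * poly_density \<alpha> x\<bar> ^ m))
        + N1 / (poly_weight a x0 * sqrt \<bar>k * deriv (poly_density \<alpha>) x0\<bar>))"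
proof -
  obtain K where K: "\<And>\<xi> (k::real) U \<kappa> R.
    \<forall>x\<in>U. \<bar>k\<bar> * poly_density \<alpha> x \<le> \<kappa> x * \<bar>\<xi> + k * poly_density \<alpha> x\<bar> \<Longrightarrow>
    \<forall>x\<in>U. 1 \<le> \<kappa> x \<and> \<kappa> x * bracket (-1/2) x \<le> R x \<Longrightarrow>
    symbol_bound m U (\<lambda>x. of_real (\<xi> + k * poly_density \<alpha> x))
      (\<lambda>x. K * \<bar>\<xi> + k * poly_density \<alpha> x\<bar>) R"
    using symbol_bound_phase[OF \<alpha>, of m] by blast
  obtain C0 \<beta> where C0: "1 \<le> C0" "\<And>u. 1 \<le> \<bar>u\<bar> \<Longrightarrow> \<beta> u = 1"
    "symbol_bound m UNIV \<beta> (\<lambda>u. if \<bar>u\<bar> < 1/2 then 0 else C0) (\<lambda>u. if \<bar>u\<bar> \<le> 1 then 1 else 0)"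
    using exists_cutoff[of m] by blast
  define C where "C = resonance_cutoff.inner_const \<alpha> m C0 + resonance_cutoff.middle_const \<alpha> m C0 +
    resonance_cutoff.outer_const \<alpha> m K C0"
  have res: "resonance_cutoff \<alpha> a k x0 m K C0 \<beta> f N N1"
    if "1 < a" "(\<alpha> - 1) * m < a - 1" "k \<noteq> 0" "0 < x0"
      "symbol_bound m UNIV f (\<lambda>x. N * bracket (-a/2) x) (bracket (-1/2))"
      "symbol_bound 1 UNIV f (\<lambda>x. N1 * bracket (-a/2) x) (bracket (-1/2))" "N1 \<le> N" for a k x0 f N N1
  proof -
    interpret resonance \<alpha> a k x0 m
      by unfold_locales (use \<alpha> m that in auto)
    show ?thesis
    proof unfold_locales
      show "symbol_bound m U (\<lambda>x. of_real (g x)) (\<lambda>x. K * \<bar>g x\<bar>) R"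
        if "\<forall>x\<in>U. \<bar>k\<bar> * poly_density \<alpha> x \<le> \<kappa>' x * \<bar>g x\<bar>" "\<forall>x\<in>U. 1 \<le> \<kappa>' x \<and> \<kappa>' x * bracket (-1/2) x \<le> R x"
        for U \<kappa>' R
        using that unfolding g_def by (rule K)
    qed (use C0 that in \<open>auto simp del: symbol_bound.simps\<close>)
  qed
  show ?thesis
  proof (intro exI[of _ C] conjI allI impI)
    have "resonance_cutoff \<alpha> (1 + (\<alpha> - 1) * m + 1) 1 1 m K C0 \<beta> (\<lambda>x. 0) 0 0"
      by (rule res) (use \<alpha> in \<open>auto intro!: symbol_bound_const add_pos_nonneg simp del: symbol_bound.simps\<close>)
    then interpret resonance_cutoff \<alpha> "1 + (\<alpha> - 1) * m + 1" 1 1 m K C0 \<beta> "\<lambda>x. 0" 0 0 .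
    show "0 \<le> C"
      using const_nonneg by (simp add: C_def)
  next
    fix a k x0 N N1 :: real and f
    assume H: "1 < a" "(\<alpha> - 1) * m < a - 1" "k \<noteq> 0" "0 < x0"
      "symbol_bound m UNIV f (\<lambda>x. N * bracket (-a/2) x) (bracket (-1/2))"
      "symbol_bound 1 UNIV f (\<lambda>x. N1 * bracket (-a/2) x) (bracket (-1/2))" "N1 \<le> N"
    interpret resonance_cutoff \<alpha> a k x0 m K C0 \<beta> f N N1
      by (rule res[OF H])
    have "curv = \<bar>k * deriv (poly_density \<alpha>) x0\<bar>"
      by (simp add: curv_def abs_mult abs_deriv_poly_density[OF \<alpha> H(4)])
    then show "cmod (LBINT x. f x * cis (- 2 * pi * (x * - (k * poly_density \<alpha> x0) + k * poly_cdf \<alpha> x))) \<le>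
      C * (res_Lambda x0 ^ m * N * (LBINT x:res_domain x0. 1 / ((1 + x\<^sup>2) powr ((a + real m) / 2) *
          \<bar>- (k * poly_density \<alpha> x0) + k * poly_density \<alpha> x\<bar> ^ m))
        + N1 / (poly_weight a x0 * sqrt \<bar>k * deriv (poly_density \<alpha>) x0\<bar>))"
      using resonant_bound unfolding C_def[symmetric] J_def w_def[abs_def] phase_def g_def \<xi>_def by simp
  qed
qed

theorem theorem3p3:
  fixes \<alpha> :: real and m :: nat
  assumes "\<alpha> > 1" and "m \<ge> 1"
  shows "\<exists>C>0. \<forall>(a::real) (b::real) (\<Omega>::real) (\<xi>::real) (k::int) (f :: real \<Rightarrow> complex).
    a > 1 \<longrightarrow> b > 1 \<longrightarrow> real m \<le> b - 1 \<longrightarrow>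
    f \<in> weighted_diff_space (poly_weight a) m \<longrightarrow>
    fourier_transform f \<in> weighted_space (poly_weight b) \<longrightarrow>
    \<alpha> < (a - 1) / real m + 1 \<longrightarrow>
    \<Omega> > 0 \<longrightarrow> \<xi> \<in> {-\<Omega>..\<Omega>} \<longrightarrow> k \<noteq> 0 \<longrightarrow>
    ((\<xi> / real_of_int k \<ge> 0 \<or> - (\<xi> / real_of_int k) \<ge> 2 * poly_density \<alpha> 0) \<longrightarrow>
      cmod (fourier_coeff (transplant \<alpha> f \<xi>) k)
        \<le> C * (weighted_diff_norm (poly_weight a) m f *
            (LBINT x. 1 / ((1 + x\<^sup>2) powr ((a + real m) / 2) *
               \<bar>\<xi> + real_of_int k * poly_density \<alpha> x\<bar> ^ m)))) \<and>
    ((0 < - (\<xi> / real_of_int k) \<and> - (\<xi> / real_of_int k) < poly_density \<alpha> 0) \<longrightarrow>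
      (\<forall>x\<^sub>0>0. poly_density \<alpha> x\<^sub>0 = - (\<xi> / real_of_int k) \<longrightarrow>
        cmod (fourier_coeff (transplant \<alpha> f \<xi>) k)
          \<le> C * (res_Lambda x\<^sub>0 ^ m * weighted_diff_norm (poly_weight a) m f *
                (LBINT x:res_domain x\<^sub>0. 1 / ((1 + x\<^sup>2) powr ((a + real m) / 2) *
                   \<bar>\<xi> + real_of_int k * poly_density \<alpha> x\<bar> ^ m))
              + weighted_diff_norm (poly_weight a) 1 f /
                (poly_weight a x\<^sub>0 * sqrt \<bar>real_of_int k * deriv (poly_density \<alpha>) x\<^sub>0\<bar>))))"
proof -
  obtain C1 where C1: "C1 > 0" "\<And>a \<xi> (k::real) f N.
    1 < a \<Longrightarrow> (\<alpha> - 1) * m < a - 1 \<Longrightarrow> k \<noteq> 0 \<Longrightarrow>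
    symbol_bound m UNIV f (\<lambda>x. N * bracket (-a/2) x) (bracket (-1/2)) \<Longrightarrow>
    \<forall>x. \<bar>k\<bar> * poly_density \<alpha> x \<le> \<bar>\<xi> + k * poly_density \<alpha> x\<bar> \<Longrightarrow>
    cmod (LBINT x. f x * cis (- 2 * pi * (x * \<xi> + k * poly_cdf \<alpha> x))) \<le>
      C1 * (N * (LBINT x. 1 / ((1 + x\<^sup>2) powr ((a + real m) / 2) * \<bar>\<xi> + k * poly_density \<alpha> x\<bar> ^ m)))"
    using nonresonant_bound[OF assms(1), of m] by blast
  obtain C2 where C2: "C2 \<ge> 0" "\<And>a (k::real) x0 f N N1.
    1 < a \<Longrightarrow> (\<alpha> - 1) * m < a - 1 \<Longrightarrow> k \<noteq> 0 \<Longrightarrow> 0 < x0 \<Longrightarrow>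
    symbol_bound m UNIV f (\<lambda>x. N * bracket (-a/2) x) (bracket (-1/2)) \<Longrightarrow>
    symbol_bound 1 UNIV f (\<lambda>x. N1 * bracket (-a/2) x) (bracket (-1/2)) \<Longrightarrow> N1 \<le> N \<Longrightarrow>
    cmod (LBINT x. f x * cis (- 2 * pi * (x * - (k * poly_density \<alpha> x0) + k * poly_cdf \<alpha> x))) \<le>
      C2 * (res_Lambda x0 ^ m * N * (LBINT x:res_domain x0. 1 / ((1 + x\<^sup>2) powr ((a + real m) / 2) *
          \<bar>- (k * poly_density \<alpha> x0) + k * poly_density \<alpha> x\<bar> ^ m))
        + N1 / (poly_weight a x0 * sqrt \<bar>k * deriv (poly_density \<alpha>) x0\<bar>))"
    using resonant_bound_uniform[OF assms] by blast
  show ?thesis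
  proof (intro exI[of _ "C1 + C2"] conjI allI impI)
    show "0 < C1 + C2"
      using C1 C2 by simp
  next
    fix a b \<Omega> \<xi> :: real and k :: int and f :: "real \<Rightarrow> complex"
    let ?N = "\<lambda>j. weighted_diff_norm (poly_weight a) j f"
    assume a: "1 < a" and f: "f \<in> weighted_diff_space (poly_weight a) m"
      and \<alpha>: "\<alpha> < (a - 1) / real m + 1" and k: "k \<noteq> 0"
    note fc = fourier_coeff_eq_oscillatory_integral[OF assms(1) a f]
    have am: "(\<alpha> - 1) * m < a - 1"
      using \<alpha> assms(2) by (simp add: field_simps)
    have k': "real_of_int k \<noteq> 0"
      using k by simp
    have sm: "symbol_bound m UNIV f (\<lambda>x. ?N m * bracket (-a/2) x) (bracket (-1/2))"
      and s1: "symbol_bound 1 UNIV f (\<lambda>x. ?N 1 * bracket (-a/2) x) (bracket (-1/2))"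
      by (intro symbol_bound_weighted_diff_space[OF f] order_refl assms(2))+
    have N: "?N 1 \<le> ?N m" "0 \<le> ?N 1"
    proof -
      show "?N 1 \<le> ?N m"
        by (rule weighted_diff_norm_mono(2)[OF f assms(2)])
      show "0 \<le> ?N 1"
        using symbol_bound_nonneg[OF s1, of 0] by (simp add: zero_le_mult_iff)
    qed
    {
      assume nr: "\<xi> / real_of_int k \<ge> 0 \<or> - (\<xi> / real_of_int k) \<ge> 2 * poly_density \<alpha> 0"
      have "\<bar>real_of_int k\<bar> * poly_density \<alpha> x \<le> \<bar>\<xi> + real_of_int k * poly_density \<alpha> x\<bar>" for x
      proof -
        have "poly_density \<alpha> x \<le> \<bar>\<xi> / real_of_int k + poly_density \<alpha> x\<bar>"
          using nr poly_density_le_0[OF assms(1), of x] poly_density_pos[OF assms(1), of x] by linarith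
        then have "\<bar>real_of_int k\<bar> * poly_density \<alpha> x \<le> \<bar>real_of_int k\<bar> * \<bar>\<xi> / real_of_int k + poly_density \<alpha> x\<bar>"
          by (intro mult_left_mono) auto
        also have "\<dots> = \<bar>\<xi> + real_of_int k * poly_density \<alpha> x\<bar>"
          using k' by (simp add: abs_mult[symmetric] distrib_left)
        finally show ?thesis .
      qed
      then have "cmod (fourier_coeff (transplant \<alpha> f \<xi>) k) \<le> C1 * (?N m *
          (LBINT x. 1 / ((1 + x\<^sup>2) powr ((a + real m) / 2) * \<bar>\<xi> + real_of_int k * poly_density \<alpha> x\<bar> ^ m)))"
        unfolding fc by (intro C1(2) a am k' sm allI)
      also have "\<dots> \<le> (C1 + C2) * (?N m *
          (LBINT x. 1 / ((1 + x\<^sup>2) powr ((a + real m) / 2) * \<bar>\<xi> + real_of_int k * poly_density \<alpha> x\<bar> ^ m)))"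
        using N C2(1) by (intro mult_right_mono mult_nonneg_nonneg integral_nonneg_AE) auto
      finally show "cmod (fourier_coeff (transplant \<alpha> f \<xi>) k) \<le> (C1 + C2) * (?N m *
          (LBINT x. 1 / ((1 + x\<^sup>2) powr ((a + real m) / 2) * \<bar>\<xi> + real_of_int k * poly_density \<alpha> x\<bar> ^ m)))" .
    next
      fix x0 :: real
      assume x0: "0 < x0" "poly_density \<alpha> x0 = - (\<xi> / real_of_int k)"
      then have \<xi>: "- (real_of_int k * poly_density \<alpha> x0) = \<xi>"
        using k' by simp
      let ?X = "res_Lambda x0 ^ m * ?N m * (LBINT x:res_domain x0. 1 / ((1 + x\<^sup>2) powr ((a + real m) / 2) *
          \<bar>\<xi> + real_of_int k * poly_density \<alpha> x\<bar> ^ m))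
        + ?N 1 / (poly_weight a x0 * sqrt \<bar>real_of_int k * deriv (poly_density \<alpha>) x0\<bar>)"
      have "0 \<le> res_Lambda x0"
        using x0 res_delta_bounds[OF x0(1)] by (auto simp: res_Lambda_def intro!: divide_nonneg_nonneg)
      then have "0 \<le> ?X"
        unfolding set_lebesgue_integral_def using N
        by (intro add_nonneg_nonneg mult_nonneg_nonneg divide_nonneg_nonneg integral_nonneg_AE)
          (auto simp: poly_weight_nonneg)
      have "cmod (fourier_coeff (transplant \<alpha> f \<xi>) k) \<le> C2 * ?X"
        using C2(2)[OF a am k' x0(1) sm s1 N(1)] unfolding fc \<xi> .
      also have "\<dots> \<le> (C1 + C2) * ?X"
        using C1(1) \<open>0 \<le> ?X\<close> by (intro mult_right_mono) auto
      finally show "cmod (fourier_coeff (transplant \<alpha> f \<xi>) k) \<le> (C1 + C2) * ?X" .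
    }
  qed
qed

end
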